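(* Let $(M,g)$ be a smooth connected Riemannian manifold and let $\phi_1,\phi_2\colon M\to\mathbb{S}^n$ be two smooth biharmonic maps into the Euclidean unit sphere. If $\phi_1$ and $\phi_2$ agree on a non-empty open subset of $M$, then $\phi_1=\phi_2$ on all of $M$.
   Context: All manifolds are connected and all objects are smooth. $\mathbb{S}^n$ is the unit sphere in $\mathbb{R}^{n+1}$ with its standard metric of constant curvature $1$. For a smooth map $\phi\colon M\to N$ between Riemannian manifolds, the tension field is $\tau(\phi)=\operatorname{Tr}_g\nabla d\phi\in\Gamma(\phi^\ast TN)$, and $\phi$ is biharmonic if $$\tau_2(\phi)=\Delta\tau(\phi)-\sum_{i=1}^{m}R^N\left(d\phi(e_i),\tau(\phi)\right)d\phi(e_i)=0,$$ where $m=\dim M$, $\{e_i\}$ is a local orthonormal frame of $M$, $\Delta=\operatorname{Tr}_g(\nabla\nabla-\nabla_{\nabla})$ is the rough Laplacian on $\phi^\ast TN$, and $R(X,Y)Z=[\nabla_X,\nabla_Y]Z-\nabla_{[X,Y]}Z$. *)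

theory Defs
  imports "HOL-Analysis.Analysis"
begin

section \<open>Smooth functions on open subsets of Euclidean spaces\<close>

text \<open>All uses below have an open \<open>S\<close>, so derivatives are taken with respect to the full
  neighbourhood filter.\<close>

primrec Ck_on :: "nat \<Rightarrow> 'a::euclidean_space set \<Rightarrow> ('a \<Rightarrow> 'b::real_normed_vector) \<Rightarrow> bool" where
  "Ck_on 0 S f \<longleftrightarrow> continuous_on S f"
| "Ck_on (Suc k) S f \<longleftrightarrow>
     (\<forall>x\<in>S. f differentiable (at x)) \<and> (\<forall>v. Ck_on k S (\<lambda>x. frechet_derivative f (at x) v))"

definition smooth_on :: "'a::euclidean_space set \<Rightarrow> ('a \<Rightarrow> 'b::real_normed_vector) \<Rightarrow> bool" where
  "smooth_on S f \<longleftrightarrow> (\<forall>k. Ck_on k S f)"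

section \<open>Smooth and Riemannian manifolds\<close>

text \<open>A chart is a domain together with a coordinate map into a Euclidean space \<open>'e\<close>; the
  dimension of the manifold is \<open>DIM('e)\<close>.\<close>

type_synonym ('a, 'e) chart = "'a set \<times> ('a \<Rightarrow> 'e)"

definition chart_image :: "('a, 'e) chart \<Rightarrow> 'e set" where
  "chart_image c = snd c ` fst c"

definition chart_inv :: "('a, 'e) chart \<Rightarrow> 'e \<Rightarrow> 'a" where
  "chart_inv c = inv_into (fst c) (snd c)"

definition chart_of :: "'a topology \<Rightarrow> ('a, 'e::euclidean_space) chart \<Rightarrow> bool" where
  "chart_of X c \<longleftrightarrow> openin X (fst c) \<and> open (chart_image c) \<and>
     homeomorphic_map (subtopology X (fst c)) (top_of_set (chart_image c)) (snd c)"

definition smooth_atlas :: "'a topology \<Rightarrow> ('a, 'e::euclidean_space) chart set \<Rightarrow> bool" where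
  "smooth_atlas X A \<longleftrightarrow> (\<forall>c\<in>A. chart_of X c) \<and> (\<Union>c\<in>A. fst c) = topspace X \<and>
     (\<forall>c\<in>A. \<forall>d\<in>A. smooth_on (snd c ` (fst c \<inter> fst d)) (snd d \<circ> chart_inv c))"

text \<open>The metric is given by its local representations: \<open>metric M c y v w\<close> is the inner product
  of the tangent vectors with components \<open>v\<close> and \<open>w\<close> in the chart \<open>c\<close>, at the point with
  coordinates \<open>y\<close>.\<close>

record ('a, 'e) riemannian =
  mtop :: "'a topology"
  atlas :: "('a, 'e) chart set"
  metric :: "('a, 'e) chart \<Rightarrow> 'e \<Rightarrow> 'e \<Rightarrow> 'e \<Rightarrow> real"

definition riemannian_manifold :: "('a, 'e::euclidean_space) riemannian \<Rightarrow> bool" where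
  "riemannian_manifold M \<longleftrightarrow>
     Hausdorff_space (mtop M) \<and> second_countable (mtop M) \<and> smooth_atlas (mtop M) (atlas M) \<and>
     (\<forall>c\<in>atlas M.
        (\<forall>v w. smooth_on (chart_image c) (\<lambda>y. metric M c y v w)) \<and>
        (\<forall>y\<in>chart_image c. bilinear (metric M c y) \<and>
           (\<forall>v w. metric M c y v w = metric M c y w v) \<and>
           (\<forall>v. v \<noteq> 0 \<longrightarrow> metric M c y v v > 0))) \<and>
     (\<forall>c\<in>atlas M. \<forall>d\<in>atlas M. \<forall>p\<in>fst c \<inter> fst d. \<forall>v w.
        metric M c (snd c p) v w =
          metric M d (snd d p)
            (frechet_derivative (snd d \<circ> chart_inv c) (at (snd c p)) v)
            (frechet_derivative (snd d \<circ> chart_inv c) (at (snd c p)) w))"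

definition local_rep :: "('a, 'e) chart \<Rightarrow> ('b, 'f) chart \<Rightarrow> ('a \<Rightarrow> 'b) \<Rightarrow> 'e \<Rightarrow> 'f" where
  "local_rep c d \<phi> = snd d \<circ> \<phi> \<circ> chart_inv c"

definition smooth_map ::
  "('a, 'e::euclidean_space) riemannian \<Rightarrow> ('b, 'f::euclidean_space) riemannian \<Rightarrow> ('a \<Rightarrow> 'b) \<Rightarrow> bool"
where
  "smooth_map M N \<phi> \<longleftrightarrow> continuous_map (mtop M) (mtop N) \<phi> \<and>
     (\<forall>c\<in>atlas M. \<forall>d\<in>atlas N. smooth_on (snd c ` (fst c \<inter> \<phi> -` fst d)) (local_rep c d \<phi>))"

section \<open>Levi-Civita connection and curvature in a chart\<close>

text \<open>In a chart a vector field is a function \<open>X :: 'e \<Rightarrow> 'e\<close>, and a connection has the form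
  \<open>\<nabla>\<^sub>X Y = D\<^sub>X Y + \<Gamma>(X, Y)\<close>. Testing on constant fields, it is torsion free iff \<open>\<Gamma>\<close> is symmetric
  and metric iff \<open>\<partial>\<^sub>u g(v, w) = g(\<Gamma>(u, v), w) + g(v, \<Gamma>(u, w))\<close>. Together these determine \<open>\<Gamma>\<close>.\<close>

definition levi_civita ::
  "('e::euclidean_space \<Rightarrow> 'e \<Rightarrow> 'e \<Rightarrow> real) \<Rightarrow> 'e \<Rightarrow> 'e \<Rightarrow> 'e \<Rightarrow> 'e" where
  "levi_civita g y = (THE \<Gamma>. bilinear \<Gamma> \<and> (\<forall>v w. \<Gamma> v w = \<Gamma> w v) \<and>
     (\<forall>u v w. frechet_derivative (\<lambda>z. g z v w) (at y) u = g y (\<Gamma> u v) w + g y v (\<Gamma> u w)))"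

definition nabla ::
  "('e::euclidean_space \<Rightarrow> 'e \<Rightarrow> 'e \<Rightarrow> real) \<Rightarrow> ('e \<Rightarrow> 'e) \<Rightarrow> ('e \<Rightarrow> 'e) \<Rightarrow> 'e \<Rightarrow> 'e" where
  "nabla g X Y y = frechet_derivative Y (at y) (X y) + levi_civita g y (X y) (Y y)"

definition lie_bracket :: "('e::euclidean_space \<Rightarrow> 'e) \<Rightarrow> ('e \<Rightarrow> 'e) \<Rightarrow> 'e \<Rightarrow> 'e" where
  "lie_bracket X Y y = frechet_derivative Y (at y) (X y) - frechet_derivative X (at y) (Y y)"

definition curvature ::
  "('e::euclidean_space \<Rightarrow> 'e \<Rightarrow> 'e \<Rightarrow> real) \<Rightarrow> ('e \<Rightarrow> 'e) \<Rightarrow> ('e \<Rightarrow> 'e) \<Rightarrow> ('e \<Rightarrow> 'e) \<Rightarrow> 'e \<Rightarrow> 'e" where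
  "curvature g X Y Z y =
     nabla g X (nabla g Y Z) y - nabla g Y (nabla g X Z) y - nabla g (lie_bracket X Y) Z y"

text \<open>By tensoriality, tangent vectors at a point may be extended by fields with constant
  components; the same is done under the traces below.\<close>

definition curvature_tensor ::
  "('e::euclidean_space \<Rightarrow> 'e \<Rightarrow> 'e \<Rightarrow> real) \<Rightarrow> 'e \<Rightarrow> 'e \<Rightarrow> 'e \<Rightarrow> 'e \<Rightarrow> 'e" where
  "curvature_tensor g y a b c = curvature g (\<lambda>_. a) (\<lambda>_. b) (\<lambda>_. c) y"

section \<open>Tension and bitension field in charts\<close>

definition orthonormal_basis :: "('e::euclidean_space \<Rightarrow> 'e \<Rightarrow> real) \<Rightarrow> 'e set \<Rightarrow> bool" where
  "orthonormal_basis G E \<longleftrightarrow> card E = DIM('e) \<and>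
     (\<forall>a\<in>E. \<forall>b\<in>E. G a b = (if a = b then 1 else 0))"

text \<open>The trace of a bilinear form does not depend on the orthonormal basis.\<close>

definition trace_wrt ::
  "('e::euclidean_space \<Rightarrow> 'e \<Rightarrow> real) \<Rightarrow> ('e \<Rightarrow> 'e \<Rightarrow> 'f::real_vector) \<Rightarrow> 'f" where
  "trace_wrt G B = (\<Sum>e\<in>(SOME E. orthonormal_basis G E). B e e)"

text \<open>In the following, \<open>g\<close> and \<open>h\<close> are the metrics of domain and target in fixed charts, and \<open>F\<close>
  is the map in these charts. A section of the pull-back of the target tangent bundle is a
  function \<open>V :: 'e \<Rightarrow> 'f\<close>; \<open>pullback_nabla h F X V\<close> is its derivative with respect to the pull-back
  of the Levi-Civita connection of \<open>h\<close>.\<close>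

definition pullback_nabla ::
  "('f::euclidean_space \<Rightarrow> 'f \<Rightarrow> 'f \<Rightarrow> real) \<Rightarrow> ('e::euclidean_space \<Rightarrow> 'f) \<Rightarrow>
   ('e \<Rightarrow> 'e) \<Rightarrow> ('e \<Rightarrow> 'f) \<Rightarrow> 'e \<Rightarrow> 'f" where
  "pullback_nabla h F X V y =
     frechet_derivative V (at y) (X y) +
     levi_civita h (F y) (frechet_derivative F (at y) (X y)) (V y)"

definition nabla_d ::
  "('e::euclidean_space \<Rightarrow> 'e \<Rightarrow> 'e \<Rightarrow> real) \<Rightarrow> ('f::euclidean_space \<Rightarrow> 'f \<Rightarrow> 'f \<Rightarrow> real) \<Rightarrow>
   ('e \<Rightarrow> 'f) \<Rightarrow> ('e \<Rightarrow> 'e) \<Rightarrow> ('e \<Rightarrow> 'e) \<Rightarrow> 'e \<Rightarrow> 'f" where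
  "nabla_d g h F X Y y =
     pullback_nabla h F X (\<lambda>z. frechet_derivative F (at z) (Y z)) y -
     frechet_derivative F (at y) (nabla g X Y y)"

definition tension ::
  "('e::euclidean_space \<Rightarrow> 'e \<Rightarrow> 'e \<Rightarrow> real) \<Rightarrow> ('f::euclidean_space \<Rightarrow> 'f \<Rightarrow> 'f \<Rightarrow> real) \<Rightarrow>
   ('e \<Rightarrow> 'f) \<Rightarrow> 'e \<Rightarrow> 'f" where
  "tension g h F y = trace_wrt (g y) (\<lambda>v w. nabla_d g h F (\<lambda>_. v) (\<lambda>_. w) y)"

definition rough_laplacian ::
  "('e::euclidean_space \<Rightarrow> 'e \<Rightarrow> 'e \<Rightarrow> real) \<Rightarrow> ('f::euclidean_space \<Rightarrow> 'f \<Rightarrow> 'f \<Rightarrow> real) \<Rightarrow>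
   ('e \<Rightarrow> 'f) \<Rightarrow> ('e \<Rightarrow> 'f) \<Rightarrow> 'e \<Rightarrow> 'f" where
  "rough_laplacian g h F V y = trace_wrt (g y) (\<lambda>v w.
     pullback_nabla h F (\<lambda>_. v) (pullback_nabla h F (\<lambda>_. w) V) y -
     pullback_nabla h F (nabla g (\<lambda>_. v) (\<lambda>_. w)) V y)"

definition bitension ::
  "('e::euclidean_space \<Rightarrow> 'e \<Rightarrow> 'e \<Rightarrow> real) \<Rightarrow> ('f::euclidean_space \<Rightarrow> 'f \<Rightarrow> 'f \<Rightarrow> real) \<Rightarrow>
   ('e \<Rightarrow> 'f) \<Rightarrow> 'e \<Rightarrow> 'f" where
  "bitension g h F y =
     rough_laplacian g h F (tension g h F) y -
     trace_wrt (g y) (\<lambda>v w. curvature_tensor h (F y)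
       (frechet_derivative F (at y) v) (tension g h F y) (frechet_derivative F (at y) w))"

definition biharmonic ::
  "('a, 'e::euclidean_space) riemannian \<Rightarrow> ('b, 'f::euclidean_space) riemannian \<Rightarrow> ('a \<Rightarrow> 'b) \<Rightarrow> bool"
where
  "biharmonic M N \<phi> \<longleftrightarrow> smooth_map M N \<phi> \<and>
     (\<forall>c\<in>atlas M. \<forall>d\<in>atlas N. \<forall>p\<in>fst c \<inter> \<phi> -` fst d.
        bitension (metric M c) (metric N d) (local_rep c d \<phi>) (snd c p) = 0)"

section \<open>The unit sphere\<close>

text \<open>The charts are the inverses of all smooth regular parametrisations of open subsets of the
  sphere, and the metric is induced by the inner product of the ambient space. The dimension
  \<open>DIM('f)\<close> of the parameter space has to be \<open>DIM('b) - 1\<close>; otherwise no chart has a non-empty domain.\<close>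

definition unit_sphere :: "('b::euclidean_space, 'f::euclidean_space) riemannian" where
  "unit_sphere = \<lparr>
     mtop = top_of_set (sphere 0 1),
     atlas = {d. chart_of (top_of_set (sphere 0 1)) d \<and>
                 smooth_on (chart_image d) (chart_inv d) \<and>
                 (\<forall>y\<in>chart_image d. inj (frechet_derivative (chart_inv d) (at y)))},
     metric = (\<lambda>d y v w. frechet_derivative (chart_inv d) (at y) v \<bullet>
                         frechet_derivative (chart_inv d) (at y) w)\<rparr>"

end

theory Submission
  imports Defs
begin

text \<open>In charts, a biharmonic map \<open>F\<close> and its tension field \<open>V\<close> together satisfy a second order system
  \<open>\<Sum> g\<^sup>i\<^sup>j \<partial>\<^sub>i\<partial>\<^sub>j F = \<dots>\<close>, \<open>\<Sum> g\<^sup>i\<^sup>j \<partial>\<^sub>i\<partial>\<^sub>j V = \<dots>\<close> whose right-hand sides depend smoothly on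
  \<open>F\<close>, \<open>V\<close> and their first derivatives: the only second derivatives of \<open>F\<close> in the bitension field enter
  through \<open>\<Sum> g\<^sup>i\<^sup>j \<partial>\<^sub>i\<partial>\<^sub>j F\<close>, which the first equation eliminates. The differences \<open>u\<close> of the components of
  two solutions therefore satisfy \<open>\<bar>\<Sum> g\<^sup>i\<^sup>j \<partial>\<^sub>i\<partial>\<^sub>j u\<bar> \<le> C \<Sum> (\<bar>u\<bar> + \<bar>\<nabla>u\<bar>)\<close>. A Carleman estimate with weight
  \<open>exp (\<tau> exp (- \<kappa> \<bar>x - x\<^sub>0\<bar>\<^sup>2))\<close> shows that such \<open>u\<close> vanish on every coordinate ball whose centre has a
  neighbourhood on which they vanish. Hence the interior of the coincidence set is closed.\<close>

section \<open>Functions of class C^k\<close>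

text \<open>The biharmonic equation is of fourth order. For the pair of map and tension field the
  principal part is diagonal, with the same scalar operator in every component, so a scalar Carleman
  estimate can be summed over the components while its large parameter absorbs the coupling.

  The weight is largest at the centre of the ball. The inner ball on which \<open>u\<close> vanishes
  removes that centre, the only critical point of the squared distance, and the error made by the
  cut-off lies where the weight is strictly smaller than at a point with nonzero \<open>u\<close>.
  This is why neither the radius nor the constant \<open>C\<close> has to be small.

  A limit point of the open set of agreement has no neighbourhood of agreement to start from. The
  local result is therefore applied around a nearby point of that set, with a radius that depends on
  the limit point only.

  Integration by parts enters only as the vanishing of the integral of a derivative of a compactly
  supported C^1 function over a box.\<close>

definition pd :: "'a::euclidean_space \<Rightarrow> ('a \<Rightarrow> 'b::real_normed_vector) \<Rightarrow> 'a \<Rightarrow> 'b" where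
  "pd v f x = frechet_derivative f (at x) v"

lemma Ck_on_Suc_pd:
  "Ck_on (Suc k) S f \<longleftrightarrow> (\<forall>x\<in>S. f differentiable (at x)) \<and> (\<forall>v. Ck_on k S (pd v f))"
  by (simp add: pd_def[abs_def])

lemma pd_has_derivative:
  "f differentiable (at x) \<Longrightarrow> (f has_derivative (\<lambda>v. pd v f x)) (at x)"
  unfolding pd_def by (simp add: frechet_derivative_works[symmetric] eta_contract_eq)

lemma pd_eqI: "(f has_derivative D) (at x) \<Longrightarrow> pd v f x = D v"
  unfolding pd_def using frechet_derivative_at by metis

lemma has_derivative_cong_open:
  assumes "open S" "x \<in> S" "\<And>y. y \<in> S \<Longrightarrow> f y = g y"
  shows "(f has_derivative D) (at x) \<longleftrightarrow> (g has_derivative D) (at x)"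
  using has_derivative_transform_within_open[of f D x UNIV S g]
    has_derivative_transform_within_open[of g D x UNIV S f] assms by auto

lemma frechet_derivative_cong_open:
  assumes "open S" "x \<in> S" "\<And>y. y \<in> S \<Longrightarrow> f y = g y"
  shows "frechet_derivative f (at x) = frechet_derivative g (at x)"
  unfolding frechet_derivative_def using has_derivative_cong_open[OF assms] by simp

lemma pd_cong_open:
  assumes "open S" "x \<in> S" "\<And>y. y \<in> S \<Longrightarrow> f y = g y"
  shows "pd v f x = pd v g x"
  unfolding pd_def using frechet_derivative_cong_open[OF assms] by simp

lemma differentiable_cong_open:
  assumes "open S" "x \<in> S" "\<And>y. y \<in> S \<Longrightarrow> f y = g y"
  shows "f differentiable (at x) \<longleftrightarrow> g differentiable (at x)"
  unfolding differentiable_def using has_derivative_cong_open[OF assms] by simp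

lemma Ck_on_cong:
  assumes "open S" "\<And>x. x \<in> S \<Longrightarrow> f x = g x"
  shows "Ck_on k S f \<longleftrightarrow> Ck_on k S g"
  using assms(2)
proof (induction k arbitrary: f g)
  case 0
  then show ?case by (simp cong: continuous_on_cong)
next
  case (Suc k)
  have "Ck_on k S (pd v f) = Ck_on k S (pd v g)" for v
    by (rule Suc.IH) (auto intro: pd_cong_open[OF assms(1)] Suc.prems)
  moreover have "f differentiable (at x) \<longleftrightarrow> g differentiable (at x)" if "x \<in> S" for x
    using differentiable_cong_open[OF assms(1) that] Suc.prems by blast
  ultimately show ?case unfolding Ck_on_Suc_pd by simp
qed

lemma Ck_on_subset: "Ck_on k T f \<Longrightarrow> S \<subseteq> T \<Longrightarrow> Ck_on k S f"
  by (induction k arbitrary: f) (auto intro: continuous_on_subset)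

lemma Ck_on_imp_continuous_on: "Ck_on k S f \<Longrightarrow> continuous_on S f"
  by (cases k) (auto intro!: continuous_at_imp_continuous_on simp: differentiable_imp_continuous_within)

lemma Ck_on_SucD: "Ck_on (Suc k) S f \<Longrightarrow> Ck_on k S f"
proof (induction k arbitrary: f)
  case 0
  then show ?case using Ck_on_imp_continuous_on by fastforce
next
  case (Suc k)
  then show ?case unfolding Ck_on_Suc_pd[of "Suc k"] Ck_on_Suc_pd[of k] by blast
qed

lemma Ck_on_mono: "Ck_on k S f \<Longrightarrow> l \<le> k \<Longrightarrow> Ck_on l S f"
  by (induction k) (metis le_zero_eq, metis Ck_on_SucD le_Suc_eq)

lemma Ck_on_differentiable: "Ck_on (Suc k) S f \<Longrightarrow> x \<in> S \<Longrightarrow> f differentiable (at x)"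
  by simp

lemma Ck_on_pd: "Ck_on (Suc k) S f \<Longrightarrow> Ck_on k S (pd v f)"
  by (simp add: pd_def[abs_def])

declare Ck_on.simps(2) [simp del]

text \<open>Derivatives are taken along the full filter \<open>at x\<close>, so they see only a
  neighbourhood of the point. This locality is what allows compactly supported functions to be
  extended by zero in \<open>Ck_on_UNIV_extension\<close>.\<close>

lemma Ck_on_local:
  assumes "\<And>x. x \<in> S \<Longrightarrow> \<exists>U. open U \<and> x \<in> U \<and> Ck_on k U f"
  shows "Ck_on k S f"
  using assms
proof (induction k arbitrary: f)
  case 0
  show ?case unfolding Ck_on.simps
  proof (rule continuous_at_imp_continuous_on, rule ballI)
    fix x assume "x \<in> S"
    from 0[OF this] obtain U where "open U" "x \<in> U" "continuous_on U f" by auto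
    then show "isCont f x"
      using continuous_on_eq_continuous_at by blast
  qed
next
  case (Suc k)
  show ?case unfolding Ck_on_Suc_pd
  proof (intro conjI ballI allI)
    fix x assume "x \<in> S"
    from Suc.prems[OF this] show "f differentiable (at x)"
      by (auto intro: Ck_on_differentiable)
  next
    fix v
    have "\<exists>U. open U \<and> x \<in> U \<and> Ck_on k U (pd v f)" if "x \<in> S" for x
      using Suc.prems[OF that] Ck_on_pd by blast
    then show "Ck_on k S (pd v f)" by (rule Suc.IH)
  qed
qed

lemma Ck_on_Un:
  assumes "open S" "open T" "Ck_on k S f" "Ck_on k T f"
  shows "Ck_on k (S \<union> T) f"
  by (rule Ck_on_local) (use assms in blast)

lemma Ck_on_const [simp]:
  fixes S :: "'a::euclidean_space set" and c :: "'b::real_normed_vector"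
  shows "Ck_on k S (\<lambda>x. c)"
proof (induction k arbitrary: c)
  case (Suc k)
  have "pd v (\<lambda>x. c) = (\<lambda>x. 0)" for v :: 'a by (simp add: fun_eq_iff pd_def)
  then show ?case unfolding Ck_on_Suc_pd using Suc by simp
qed simp

lemma Ck_on_bounded_linear:
  assumes L: "bounded_linear L" and f: "Ck_on k S f" and S: "open S"
  shows "Ck_on k S (\<lambda>x. L (f x))"
  using f
proof (induction k arbitrary: f)
  case 0
  then show ?case using bounded_linear.continuous_on[OF L] by auto
next
  case (Suc k)
  have D: "((\<lambda>x. L (f x)) has_derivative (\<lambda>v. L (pd v f x))) (at x)" if "x \<in> S" for x
    using bounded_linear.has_derivative[OF L pd_has_derivative] Suc.prems that by (auto simp: Ck_on_Suc_pd)
  have "Ck_on k S (pd v (\<lambda>x. L (f x)))" for v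
    by (subst Ck_on_cong[OF S pd_eqI[OF D]]) (use Suc Ck_on_pd in blast)+
  with D show ?case unfolding Ck_on_Suc_pd differentiable_def by blast
qed

lemma Ck_on_linear_id [simp]: "Ck_on k S (\<lambda>x. x)"
proof (cases k)
  case (Suc l)
  have "pd v (\<lambda>x::'a. x) = (\<lambda>x. v)" for v by (simp add: fun_eq_iff pd_def)
  then show ?thesis unfolding Suc Ck_on_Suc_pd by simp
qed simp

lemma Ck_on_add:
  assumes "open S" "Ck_on k S f" "Ck_on k S g"
  shows "Ck_on k S (\<lambda>x. f x + g x)"
  using assms(2,3)
proof (induction k arbitrary: f g)
  case 0
  then show ?case by (auto intro: continuous_intros)
next
  case (Suc k)
  have D: "((\<lambda>x. f x + g x) has_derivative (\<lambda>v. pd v f x + pd v g x)) (at x)" if "x \<in> S" for x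
    by (rule has_derivative_add; rule pd_has_derivative) (use Suc.prems that in \<open>auto simp: Ck_on_Suc_pd\<close>)
  have "Ck_on k S (pd v (\<lambda>x. f x + g x))" for v
    by (subst Ck_on_cong[OF assms(1) pd_eqI[OF D]]) (use Suc Ck_on_pd in blast)+
  with D show ?case unfolding Ck_on_Suc_pd differentiable_def by blast
qed

lemma Ck_on_scaleR:
  assumes "open S" "Ck_on k S f" "Ck_on k S g"
  shows "Ck_on k S (\<lambda>x. f x *\<^sub>R g x)"
  using assms(2,3)
proof (induction k arbitrary: f g)
  case 0
  then show ?case by (auto intro: continuous_intros)
next
  case (Suc k)
  have D: "((\<lambda>x. f x *\<^sub>R g x) has_derivative (\<lambda>v. f x *\<^sub>R pd v g x + pd v f x *\<^sub>R g x)) (at x)"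
    if "x \<in> S" for x
    by (rule has_derivative_scaleR; rule pd_has_derivative) (use Suc.prems that in \<open>auto simp: Ck_on_Suc_pd\<close>)
  have "Ck_on k S (pd v (\<lambda>x. f x *\<^sub>R g x))" for v
    by (subst Ck_on_cong[OF assms(1) pd_eqI[OF D]])
      (auto intro!: Ck_on_add assms(1) Suc.IH Ck_on_pd[OF Suc.prems(1)] Ck_on_pd[OF Suc.prems(2)]
         Ck_on_SucD[OF Suc.prems(1)] Ck_on_SucD[OF Suc.prems(2)])
  with D show ?case unfolding Ck_on_Suc_pd differentiable_def by blast
qed

lemma Ck_on_mult:
  fixes f g :: "'a::euclidean_space \<Rightarrow> real"
  assumes "open S" "Ck_on k S f" "Ck_on k S g"
  shows "Ck_on k S (\<lambda>x. f x * g x)"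
  using Ck_on_scaleR[OF assms] by simp

lemma Ck_on_minus: "open S \<Longrightarrow> Ck_on k S f \<Longrightarrow> Ck_on k S (\<lambda>x. - f x)"
  using Ck_on_bounded_linear[OF bounded_linear_minus[OF bounded_linear_ident]] by blast

lemma Ck_on_diff:
  assumes "open S" "Ck_on k S f" "Ck_on k S g"
  shows "Ck_on k S (\<lambda>x. f x - g x)"
  using Ck_on_add[OF assms(1,2) Ck_on_minus[OF assms(1,3)]] by simp

lemma Ck_on_sum:
  assumes "open S" "\<And>i. i \<in> I \<Longrightarrow> Ck_on k S (f i)"
  shows "Ck_on k S (\<lambda>x. \<Sum>i\<in>I. f i x)"
  using assms(2) by (induction I rule: infinite_finite_induct) (auto intro: Ck_on_add assms(1))

lemma Ck_on_inner_left: "open S \<Longrightarrow> Ck_on k S f \<Longrightarrow> Ck_on k S (\<lambda>x. f x \<bullet> c)"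
  using Ck_on_bounded_linear[OF bounded_linear_inner_left] by blast

lemma Ck_on_inner:
  fixes f g :: "'a::euclidean_space \<Rightarrow> 'b::euclidean_space"
  assumes "open S" "Ck_on k S f" "Ck_on k S g"
  shows "Ck_on k S (\<lambda>x. f x \<bullet> g x)"
  by (subst euclidean_inner) (intro Ck_on_sum Ck_on_mult Ck_on_inner_left assms)

lemma Ck_on_power:
  fixes f :: "'a::euclidean_space \<Rightarrow> real"
  assumes "open S" "Ck_on k S f"
  shows "Ck_on k S (\<lambda>x. f x ^ n)"
  by (induction n) (auto intro: Ck_on_mult assms)

lemma linear_pd: "f differentiable (at x) \<Longrightarrow> linear (\<lambda>v. pd v f x)"
  using pd_has_derivative has_derivative_linear by blast

text \<open>\<open>Ck_on\<close> speaks about fixed directions. The expansion trades a direction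
  that may vary with the point for coefficients in finitely many fixed directions.\<close>

lemma pd_basis_expansion:
  assumes "f differentiable (at x)"
  shows "pd v f x = (\<Sum>i\<in>Basis. (v \<bullet> i) *\<^sub>R pd i f x)"
proof -
  have "pd v f x = pd (\<Sum>i\<in>Basis. (v \<bullet> i) *\<^sub>R i) f x"
    by (simp add: euclidean_representation)
  also have "\<dots> = (\<Sum>i\<in>Basis. pd ((v \<bullet> i) *\<^sub>R i) f x)"
    by (rule linear_sum[OF linear_pd[OF assms]])
  also have "\<dots> = (\<Sum>i\<in>Basis. (v \<bullet> i) *\<^sub>R pd i f x)"
    by (intro sum.cong refl linear_scale[OF linear_pd[OF assms]])
  finally show ?thesis .
qed

text \<open>The chain rule differentiates \<open>g\<close> in the direction \<open>pd v f x\<close>,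
  which varies with \<open>x\<close>. Expanded in the basis it becomes a sum of products in which
  \<open>g\<close> occurs only through \<open>pd i g\<close>, and the induction hypothesis
  applies.\<close>

lemma Ck_on_compose:
  fixes f :: "'a::euclidean_space \<Rightarrow> 'b::euclidean_space"
  assumes "open S" "open T" "Ck_on k S f" "Ck_on k T g" "\<And>x. x \<in> S \<Longrightarrow> f x \<in> T"
  shows "Ck_on k S (\<lambda>x. g (f x))"
  using assms(3,4,5)
proof (induction k arbitrary: g)
  case 0
  then show ?case by (auto intro: continuous_on_compose2)
next
  case (Suc k)
  have D: "((\<lambda>x. g (f x)) has_derivative (\<lambda>v. \<Sum>i\<in>Basis. (pd v f x \<bullet> i) *\<^sub>R pd i g (f x))) (at x)"
    if x: "x \<in> S" for x
  proof -
    have "((\<lambda>x. g (f x)) has_derivative (\<lambda>v. pd (pd v f x) g (f x))) (at x)"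
      by (rule has_derivative_compose; rule pd_has_derivative) (use Suc.prems x in \<open>auto simp: Ck_on_Suc_pd\<close>)
    moreover have "g differentiable (at (f x))" using Suc.prems x by (auto simp: Ck_on_Suc_pd)
    ultimately show ?thesis by (simp add: pd_basis_expansion[of g "f x" "pd _ f x"])
  qed
  have "Ck_on k S (pd v (\<lambda>x. g (f x)))" for v
    by (subst Ck_on_cong[OF assms(1) pd_eqI[OF D]])
     (auto intro!: Ck_on_sum Ck_on_scaleR Ck_on_inner_left assms(1) Suc.IH Ck_on_pd[OF Suc.prems(1)]
       Ck_on_pd[OF Suc.prems(2)] Ck_on_SucD[OF Suc.prems(1)] Suc.prems(3))
  with D show ?case unfolding Ck_on_Suc_pd differentiable_def by blast
qed

text \<open>Drives the inductions for \<open>exp\<close>, \<open>inverse\<close>,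
  \<open>sqrt\<close> and powers of the positive part: each has a derivative built from functions of
  the same kind, so one order of regularity is gained at a time.\<close>

lemma Ck_on_real_fun:
  assumes "open S" and D: "\<And>x. x \<in> S \<Longrightarrow> (f has_real_derivative f' x) (at x)" and "Ck_on k S f'"
  shows "Ck_on (Suc k) S f"
proof -
  have D': "(f has_derivative (\<lambda>v. f' x * v)) (at x)" if "x \<in> S" for x
    using D[OF that] by (simp add: has_field_derivative_def)
  have "Ck_on k S (pd v f)" for v
    by (subst Ck_on_cong[OF assms(1) pd_eqI[OF D']]) (auto intro!: Ck_on_mult assms)
  with D' show ?thesis unfolding Ck_on_Suc_pd differentiable_def by blast
qed

lemma Ck_on_exp_real: "Ck_on k UNIV (exp :: real \<Rightarrow> real)"
  by (induction k) (auto intro!: Ck_on_real_fun DERIV_exp continuous_intros)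

lemma Ck_on_exp:
  fixes f :: "'a::euclidean_space \<Rightarrow> real"
  shows "open S \<Longrightarrow> Ck_on k S f \<Longrightarrow> Ck_on k S (\<lambda>x. exp (f x))"
  by (rule Ck_on_compose[of S UNIV k f exp]) (auto simp: Ck_on_exp_real)

lemma Ck_on_inverse_real: "Ck_on k {0<..} (inverse :: real \<Rightarrow> real)"
proof (induction k)
  case 0
  show ?case by (auto intro!: continuous_intros)
next
  case (Suc k)
  show ?case
  proof (rule Ck_on_real_fun)
    show "(inverse has_real_derivative - (inverse x * inverse x)) (at x)" if "x \<in> {0<..}" for x :: real
      using that by (auto intro!: derivative_eq_intros)
  qed (auto intro!: Ck_on_minus Ck_on_mult Suc)
qed

lemma Ck_on_inverse:
  fixes f :: "'a::euclidean_space \<Rightarrow> real"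
  shows "open S \<Longrightarrow> Ck_on k S f \<Longrightarrow> (\<And>x. x \<in> S \<Longrightarrow> f x > 0) \<Longrightarrow> Ck_on k S (\<lambda>x. inverse (f x))"
  by (rule Ck_on_compose[of S "{0<..}" k f inverse]) (auto simp: Ck_on_inverse_real)

text \<open>One power more than the number of derivatives removes the kink at 0. The Carleman
  estimate asks only for C^2 functions, so a cut-off made from such powers is good enough.\<close>

lemma Ck_on_pos_part_power: "Ck_on k UNIV (\<lambda>s::real. max 0 s ^ Suc k)"
proof (induction k)
  case 0
  show ?case by (auto intro!: continuous_intros)
next
  case (Suc k)
  show ?case
  proof (rule Ck_on_real_fun)
    fix s :: real
    consider "s < 0" | "s = 0" | "s > 0" by linarith
    then show "((\<lambda>s. max 0 s ^ Suc (Suc k)) has_real_derivative real (Suc (Suc k)) * max 0 s ^ Suc k) (at s)"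
    proof cases
      case 1
      have "((\<lambda>s::real. 0) has_real_derivative 0) (at s)" by simp
      then have "((\<lambda>s. max 0 s ^ Suc (Suc k)) has_real_derivative 0) (at s)"
        by (rule has_field_derivative_transform_within_open[where S="{..<0}"]) (use 1 in auto)
      with 1 show ?thesis by simp
    next
      case 3
      have "((\<lambda>s::real. s ^ Suc (Suc k)) has_real_derivative real (Suc (Suc k)) * s ^ Suc k) (at s)"
        using DERIV_pow[of "Suc (Suc k)" s] by simp
      then have "((\<lambda>s. max 0 s ^ Suc (Suc k)) has_real_derivative real (Suc (Suc k)) * s ^ Suc k) (at s)"
        by (rule has_field_derivative_transform_within_open[where S="{0<..}"]) (use 3 in auto)
      with 3 show ?thesis by simp
    next
      \<comment> \<open>At the kink the difference quotient \<open>max 0 h ^ (k + 2) / h\<close> is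
        squeezed by \<open>max 0 h ^ (k + 1)\<close>.\<close>
      case 2
      have "((\<lambda>h::real. max 0 h ^ Suc (Suc k) / h) \<longlongrightarrow> 0) (at 0)"
      proof (rule tendsto_rabs_zero_cancel, rule tendsto_sandwich[where f="\<lambda>_. 0"])
        show "\<forall>\<^sub>F h::real in at 0. \<bar>max 0 h ^ Suc (Suc k) / h\<bar> \<le> max 0 h ^ Suc k"
        proof (rule always_eventually, rule allI)
          fix h :: real
          show "\<bar>max 0 h ^ Suc (Suc k) / h\<bar> \<le> max 0 h ^ Suc k"
            by (cases "h \<le> 0") (auto simp: max_def)
        qed
        have "((\<lambda>h::real. max 0 h ^ Suc k) \<longlongrightarrow> max 0 0 ^ Suc k) (at 0)"
          by (intro tendsto_intros)
        then show "((\<lambda>h::real. max 0 h ^ Suc k) \<longlongrightarrow> 0) (at 0)" by simp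
      qed auto
      then show ?thesis unfolding 2 by (simp add: DERIV_def)
    qed
  qed (auto intro!: Ck_on_mult Suc simp del: power_Suc)
qed

section \<open>Differentiation rules for directional derivatives\<close>

lemma pd_add: "f differentiable (at x) \<Longrightarrow> g differentiable (at x) \<Longrightarrow>
    pd v (\<lambda>x. f x + g x) x = pd v f x + pd v g x"
  by (rule pd_eqI[OF has_derivative_add[OF pd_has_derivative pd_has_derivative]])

lemma pd_diff: "f differentiable (at x) \<Longrightarrow> g differentiable (at x) \<Longrightarrow>
    pd v (\<lambda>x. f x - g x) x = pd v f x - pd v g x"
  by (rule pd_eqI[OF has_derivative_diff[OF pd_has_derivative pd_has_derivative]])

lemma pd_scaleR: "f differentiable (at x) \<Longrightarrow> g differentiable (at x) \<Longrightarrow>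
    pd v (\<lambda>x. f x *\<^sub>R g x) x = f x *\<^sub>R pd v g x + pd v f x *\<^sub>R g x"
  by (rule pd_eqI[OF has_derivative_scaleR[OF pd_has_derivative pd_has_derivative]])

lemma pd_mult:
  fixes f g :: "'a::euclidean_space \<Rightarrow> real"
  shows "f differentiable (at x) \<Longrightarrow> g differentiable (at x) \<Longrightarrow>
    pd v (\<lambda>x. f x * g x) x = f x * pd v g x + pd v f x * g x"
  using pd_scaleR[of f x g v] by simp

lemma pd_sum: "(\<And>i. i \<in> I \<Longrightarrow> f i differentiable (at x)) \<Longrightarrow>
    pd v (\<lambda>x. \<Sum>i\<in>I. f i x) x = (\<Sum>i\<in>I. pd v (f i) x)"
  by (rule pd_eqI[OF has_derivative_sum[OF pd_has_derivative]])

lemma pd_const [simp]: "pd v (\<lambda>x. c) x = 0"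
  by (simp add: fun_eq_iff pd_def)

lemma pd_bounded_linear:
  "bounded_linear L \<Longrightarrow> f differentiable (at x) \<Longrightarrow> pd v (\<lambda>x. L (f x)) x = L (pd v f x)"
  by (rule pd_eqI[OF bounded_linear.has_derivative[OF _ pd_has_derivative]])

lemma pd_inner_left: "f differentiable (at x) \<Longrightarrow> pd v (\<lambda>x. f x \<bullet> c) x = pd v f x \<bullet> c"
  by (rule pd_bounded_linear[OF bounded_linear_inner_left])

lemma pd_exp:
  fixes f :: "'a::euclidean_space \<Rightarrow> real"
  assumes "f differentiable (at x)"
  shows "pd v (\<lambda>x. exp (f x)) x = exp (f x) * pd v f x"
  by (rule pd_eqI, rule has_derivative_exp[THEN has_derivative_eq_rhs, OF pd_has_derivative[OF assms]])
    (auto simp: mult.commute)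

section \<open>Symmetry of second derivatives\<close>

lemma has_real_derivative_line:
  fixes f :: "'a::euclidean_space \<Rightarrow> real"
  assumes "f differentiable (at (x + t *\<^sub>R v))"
  shows "((\<lambda>t. f (x + t *\<^sub>R v)) has_real_derivative pd v f (x + t *\<^sub>R v)) (at t)"
proof -
  have "((\<lambda>t. x + t *\<^sub>R v) has_derivative (\<lambda>s. s *\<^sub>R v)) (at t)"
    by (auto intro!: derivative_eq_intros)
  from has_derivative_compose[OF this pd_has_derivative[OF assms]]
  have "((\<lambda>t. f (x + t *\<^sub>R v)) has_derivative (\<lambda>s. pd (s *\<^sub>R v) f (x + t *\<^sub>R v))) (at t)" .
  moreover have "pd (s *\<^sub>R v) f (x + t *\<^sub>R v) = pd v f (x + t *\<^sub>R v) * s" for s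
    using linear_scale[OF linear_pd[OF assms]] by (simp add: mult.commute)
  ultimately show ?thesis by (simp add: has_field_derivative_def)
qed

text \<open>The mean value theorem is applied twice: along \<open>v\<close> to the increment of
  \<open>f\<close> over the step \<open>h *\<^sub>R w\<close>, then along \<open>w\<close> to
  \<open>pd v f\<close>.\<close>

lemma second_difference_mvt:
  fixes f :: "'a::euclidean_space \<Rightarrow> real"
  assumes f: "Ck_on 2 S f" and h: "h > 0"
    and S: "\<And>s t. 0 \<le> s \<Longrightarrow> s \<le> h \<Longrightarrow> 0 \<le> t \<Longrightarrow> t \<le> h \<Longrightarrow> x + s *\<^sub>R v + t *\<^sub>R w \<in> S"
  shows "\<exists>s t. 0 < s \<and> s < h \<and> 0 < t \<and> t < h \<and>
    f (x + h *\<^sub>R v + h *\<^sub>R w) - f (x + h *\<^sub>R v) - f (x + h *\<^sub>R w) + f x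
      = h\<^sup>2 * pd w (pd v f) (x + s *\<^sub>R v + t *\<^sub>R w)"
proof -
  have d1: "f differentiable (at y)" if "y \<in> S" for y
    using f that by (simp add: numeral_2_eq_2 Ck_on_Suc_pd)
  have d2: "pd v f differentiable (at y)" if "y \<in> S" for y
    using f that by (simp add: numeral_2_eq_2 Ck_on_Suc_pd)
  define G where "G s = f ((x + h *\<^sub>R w) + s *\<^sub>R v) - f (x + s *\<^sub>R v)" for s
  have in1: "(x + h *\<^sub>R w) + s *\<^sub>R v \<in> S" "x + s *\<^sub>R v \<in> S" if "0 \<le> s" "s \<le> h" for s
    using S[of s h] S[of s 0] that h by (auto simp: algebra_simps)
  have "\<exists>s>0. s < h \<and> G h - G 0 = (h - 0) * (pd v f ((x + h *\<^sub>R w) + s *\<^sub>R v) - pd v f (x + s *\<^sub>R v))"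
    by (rule MVT2[OF h])
      (auto simp: G_def intro!: DERIV_diff has_real_derivative_line d1 in1)
  then obtain s where s: "0 < s" "s < h"
    "G h - G 0 = h * (pd v f ((x + h *\<^sub>R w) + s *\<^sub>R v) - pd v f (x + s *\<^sub>R v))" by auto
  have "\<exists>t>0. t < h \<and> pd v f ((x + s *\<^sub>R v) + h *\<^sub>R w) - pd v f ((x + s *\<^sub>R v) + 0 *\<^sub>R w)
      = (h - 0) * pd w (pd v f) ((x + s *\<^sub>R v) + t *\<^sub>R w)"
    by (rule MVT2[OF h]) (use s S in \<open>auto intro!: has_real_derivative_line d2\<close>)
  then obtain t where t: "0 < t" "t < h"
    "pd v f ((x + s *\<^sub>R v) + h *\<^sub>R w) - pd v f (x + s *\<^sub>R v)
      = h * pd w (pd v f) ((x + s *\<^sub>R v) + t *\<^sub>R w)" by auto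
  have "G h - G 0 = h * (h * pd w (pd v f) (x + s *\<^sub>R v + t *\<^sub>R w))"
    using s(3) t(3) by (simp add: add.commute add.left_commute)
  then show ?thesis using s t by (intro exI[of _ s] exI[of _ t])
      (auto simp: G_def algebra_simps power2_eq_square)
qed

text \<open>The second difference does not change when \<open>v\<close> and \<open>w\<close> are
  exchanged, so both mixed derivatives take a common value at points arbitrarily near
  \<open>x\<close>. Continuity transfers this to \<open>x\<close>.\<close>

lemma pd_commute:
  fixes f :: "'a::euclidean_space \<Rightarrow> real"
  assumes S: "open S" and f: "Ck_on 2 S f" and x: "x \<in> S"
  shows "pd w (pd v f) x = pd v (pd w f) x"
proof (rule ccontr)
  assume ne: "pd w (pd v f) x \<noteq> pd v (pd w f) x"
  define e where "e = dist (pd w (pd v f) x) (pd v (pd w f) x) / 2"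
  have e: "e > 0" using ne by (simp add: e_def)
  have cont: "continuous (at x) (pd u (pd u' f))" for u u'
    using f x S by (auto simp: numeral_2_eq_2 Ck_on_Suc_pd continuous_on_eq_continuous_at)
  obtain d1 where d1: "d1 > 0" "\<And>y. dist y x < d1 \<Longrightarrow> dist (pd w (pd v f) y) (pd w (pd v f) x) < e"
    using cont[of w v] e unfolding continuous_at_eps_delta by (metis dist_norm)
  obtain d2 where d2: "d2 > 0" "\<And>y. dist y x < d2 \<Longrightarrow> dist (pd v (pd w f) y) (pd v (pd w f) x) < e"
    using cont[of v w] e unfolding continuous_at_eps_delta by (metis dist_norm)
  obtain d3 where d3: "d3 > 0" "ball x d3 \<subseteq> S" using S x openE by blast
  define d where "d = min d1 (min d2 d3)"
  \<comment> \<open>This size keeps the whole parallelogram spanned by \<open>h *\<^sub>R v\<close>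
    and \<open>h *\<^sub>R w\<close> within \<open>d / 2\<close> of \<open>x\<close>; the summand 1
    covers zero directions.\<close>
  define h where "h = d / (norm v + norm w + 1) / 2"
  have pos: "norm v + norm w + 1 > 0" by (simp add: add_nonneg_pos)
  have d: "d > 0" using d1 d2 d3 by (simp add: d_def)
  then have h: "h > 0" using pos by (simp add: h_def field_simps)
  have near: "dist (x + s *\<^sub>R v + t *\<^sub>R w) x < d" if "0 \<le> s" "s \<le> h" "0 \<le> t" "t \<le> h" for s t
  proof -
    have "dist (x + s *\<^sub>R v + t *\<^sub>R w) x = norm (s *\<^sub>R v + t *\<^sub>R w)"
      by (simp add: dist_norm add.assoc)
    also have "\<dots> \<le> s * norm v + t * norm w"
      using norm_triangle_ineq[of "s *\<^sub>R v" "t *\<^sub>R w"] that by simp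
    also have "\<dots> \<le> h * norm v + h * norm w" using that by (intro add_mono mult_right_mono) auto
    also have "\<dots> \<le> h * (norm v + norm w + 1)" using h by (simp add: algebra_simps)
    also have "\<dots> = d / 2" using pos by (simp add: h_def field_simps)
    finally show ?thesis using d by simp
  qed
  have inS: "x + s *\<^sub>R v + t *\<^sub>R w \<in> S" if "0 \<le> s" "s \<le> h" "0 \<le> t" "t \<le> h" for s t
    using near[OF that] d3 by (auto simp: d_def dist_commute)
  have inS': "x + s *\<^sub>R w + t *\<^sub>R v \<in> S" if "0 \<le> s" "s \<le> h" "0 \<le> t" "t \<le> h" for s t
    using inS[of t s] that by (simp add: algebra_simps)
  obtain s t where st: "0 < s" "s < h" "0 < t" "t < h"
    "f (x + h *\<^sub>R v + h *\<^sub>R w) - f (x + h *\<^sub>R v) - f (x + h *\<^sub>R w) + f x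
      = h\<^sup>2 * pd w (pd v f) (x + s *\<^sub>R v + t *\<^sub>R w)"
    using second_difference_mvt[OF f h inS] by blast
  obtain s' t' where st': "0 < s'" "s' < h" "0 < t'" "t' < h"
    "f (x + h *\<^sub>R w + h *\<^sub>R v) - f (x + h *\<^sub>R w) - f (x + h *\<^sub>R v) + f x
      = h\<^sup>2 * pd v (pd w f) (x + s' *\<^sub>R w + t' *\<^sub>R v)"
    using second_difference_mvt[OF f h inS'] by blast
  have "h\<^sup>2 * pd w (pd v f) (x + s *\<^sub>R v + t *\<^sub>R w) = h\<^sup>2 * pd v (pd w f) (x + t' *\<^sub>R v + s' *\<^sub>R w)"
    using st(5) st'(5) by (simp add: algebra_simps)
  then have "pd w (pd v f) (x + s *\<^sub>R v + t *\<^sub>R w) = pd v (pd w f) (x + t' *\<^sub>R v + s' *\<^sub>R w)"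
    using h by simp
  moreover have "dist (pd w (pd v f) (x + s *\<^sub>R v + t *\<^sub>R w)) (pd w (pd v f) x) < e"
    using near[of s t] st by (intro d1) (auto simp: d_def)
  moreover have "dist (pd v (pd w f) (x + t' *\<^sub>R v + s' *\<^sub>R w)) (pd v (pd w f) x) < e"
    using near[of t' s'] st' by (intro d2) (auto simp: d_def)
  ultimately have "dist (pd w (pd v f) x) (pd v (pd w f) x) < e + e"
    using dist_triangle3[of "pd w (pd v f) x" "pd v (pd w f) x" "pd w (pd v f) (x + s *\<^sub>R v + t *\<^sub>R w)"]
    by simp
  then show False by (simp add: e_def)
qed

section \<open>The divergence theorem and second order operators\<close>

text \<open>Translation invariance replaces an iterated integral. Translates of \<open>Z\<close> by
  small multiples of \<open>v\<close> keep their support in the box, so their integrals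
  \<open>J t\<close> are constant, while differentiating under the integral at 0 gives the integral
  of \<open>pd v Z\<close>.\<close>

lemma integral_pd_eq_0:
  fixes Z :: "'a::euclidean_space \<Rightarrow> real"
  assumes Z: "Ck_on 1 UNIV Z" and K: "compact K" "K \<subseteq> box a b"
    and supp: "\<And>x. x \<notin> K \<Longrightarrow> Z x = 0"
  shows "integral (cbox a b) (pd v Z) = 0"
proof -
  have diff: "Z differentiable (at x)" for x
    using Z by (simp add: Ck_on_Suc_pd)
  have cZ: "continuous_on UNIV Z" by (rule Ck_on_imp_continuous_on[OF Z])
  have cpd: "continuous_on UNIV (pd v Z)"
    using Z by (simp add: Ck_on_Suc_pd)
  obtain e where e: "e > 0" "(\<Union>x\<in>K. ball x e) \<subseteq> box a b"
    using compact_subset_open_imp_ball_epsilon_subset[OF K(1) open_box K(2)] by metis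
  \<comment> \<open>Translations by \<open>t *\<^sub>R v\<close> with \<open>t\<close> below
    \<open>d\<close> in absolute value move points by less than \<open>e\<close>, so the support
    does not leave the box.\<close>
  define d where "d = e / (norm v + 1)"
  have d: "d > 0" using e by (simp add: d_def add_nonneg_pos)
  have dv: "norm (t *\<^sub>R v) < e" if "t \<in> {-d<..<d}" for t
  proof -
    have "norm (t *\<^sub>R v) \<le> \<bar>t\<bar> * (norm v + 1)" by (simp add: mult_left_mono)
    also have "\<dots> < d * (norm v + 1)"
      using that by (intro mult_strict_right_mono) (auto simp: add_nonneg_pos)
    also have "\<dots> = e"
      using add_nonneg_pos[OF norm_ge_zero[of v] zero_less_one] by (simp add: d_def)
    finally show ?thesis .
  qed
  define J where "J t = integral (cbox a b) (\<lambda>x. Z (x + t *\<^sub>R v))" for t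
  have J: "J t = integral UNIV Z" if t: "t \<in> {-d<..<d}" for t
  proof -
    have "x \<in> cbox (a + t *\<^sub>R v) (b + t *\<^sub>R v)" if "x \<in> K" for x
    proof -
      have "x - t *\<^sub>R v \<in> ball x e" using dv[OF t] by (simp add: dist_norm)
      then have "x - t *\<^sub>R v \<in> cbox a b" using e(2) that box_subset_cbox by blast
      then show ?thesis by (auto simp: mem_box algebra_simps)
    qed
    then have Zeq: "(\<lambda>x. if x \<in> cbox (a + t *\<^sub>R v) (b + t *\<^sub>R v) then Z x else 0) = Z"
      using supp by (auto simp: fun_eq_iff)
    have "J t = integral (cbox a b) (Z \<circ> ((+) (t *\<^sub>R v)))"
      by (simp add: J_def o_def add.commute)
    also have "\<dots> = integral (cbox (a + t *\<^sub>R v) (b + t *\<^sub>R v)) Z"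
      by (rule integral_shift_cbox_plus)
    also have "\<dots> = integral UNIV Z"
      using integral_restrict_UNIV[of "cbox (a + t *\<^sub>R v) (b + t *\<^sub>R v)" Z] Zeq by simp
    finally show ?thesis .
  qed
  have "(J has_real_derivative integral (cbox a b) (\<lambda>x. pd v Z (x + 0 *\<^sub>R v))) (at 0 within {-d<..<d})"
    unfolding J_def
  proof (rule leibniz_rule_field_derivative)
    show "((\<lambda>t. Z (x + t *\<^sub>R v)) has_real_derivative pd v Z (x + t *\<^sub>R v)) (at t within {-d<..<d})"
      for x t
      using has_real_derivative_line[OF diff] has_field_derivative_at_within by blast
    show "(\<lambda>x. Z (x + t *\<^sub>R v)) integrable_on cbox a b" for t
      by (intro integrable_continuous continuous_on_compose2[OF cZ] continuous_intros) auto
    show "continuous_on ({-d<..<d} \<times> cbox a b) (\<lambda>(t, x). pd v Z (x + t *\<^sub>R v))"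
      unfolding split_beta by (intro continuous_on_compose2[OF cpd] continuous_intros) auto
  qed (use d in auto)
  then have 1: "(J has_real_derivative integral (cbox a b) (pd v Z)) (at 0)"
    using d at_within_open[of 0 "{-d<..<d}"] by simp
  have 2: "(J has_real_derivative 0) (at 0)"
    by (rule has_field_derivative_transform_within_open[where S="{-d<..<d}" and f="\<lambda>_. integral UNIV Z"])
      (use d J in auto)
  show ?thesis using DERIV_unique[OF 1 2] .
qed

section \<open>Uniform bounds on compact sets\<close>

lemma compact_family_bound:
  fixes f :: "'i \<Rightarrow> 'a::topological_space \<Rightarrow> real"
  assumes "finite I" "compact K" "\<And>i. i \<in> I \<Longrightarrow> continuous_on K (f i)"
  shows "\<exists>C\<ge>0. \<forall>i\<in>I. \<forall>x\<in>K. \<bar>f i x\<bar> \<le> C"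
  using assms(1,3)
proof (induction I)
  case (insert j I)
  then obtain C where C: "C \<ge> 0" "\<forall>i\<in>I. \<forall>x\<in>K. \<bar>f i x\<bar> \<le> C" by auto
  have "bounded (f j ` K)"
    using insert.prems assms(2) compact_continuous_image compact_imp_bounded by blast
  then obtain D where D: "\<forall>x\<in>K. \<bar>f j x\<bar> \<le> D" by (auto simp: bounded_iff)
  show ?case by (rule exI[of _ "max C D"]) (use C D in \<open>auto simp: le_max_iff_disj\<close>)
qed auto

lemma compact_bound:
  fixes f :: "'a::topological_space \<Rightarrow> real"
  assumes "compact K" "continuous_on K f"
  shows "\<exists>C\<ge>0. \<forall>x\<in>K. \<bar>f x\<bar> \<le> C"
  using compact_family_bound[of "{()}" K "\<lambda>_. f"] assms by auto

lemma compact_pos_lower_bound: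
  fixes f :: "'a::topological_space \<Rightarrow> real"
  assumes "compact K" "continuous_on K f" "\<And>x. x \<in> K \<Longrightarrow> f x > 0"
  shows "\<exists>c>0. \<forall>x\<in>K. c \<le> f x"
proof (cases "K = {}")
  case False
  then obtain x where "x \<in> K" "\<forall>y\<in>K. f x \<le> f y"
    using continuous_attains_inf[OF assms(1) _ assms(2)] by blast
  then show ?thesis using assms(3) by blast
qed (auto intro: exI[of _ 1])

lemma quadratic_form_bound:
  fixes c :: "'i \<Rightarrow> 'i \<Rightarrow> real"
  assumes "finite I" "C \<ge> 0" "\<And>i j. i \<in> I \<Longrightarrow> j \<in> I \<Longrightarrow> \<bar>c i j\<bar> \<le> C"
  shows "\<bar>\<Sum>i\<in>I. \<Sum>j\<in>I. c i j * w i * w j\<bar> \<le> C * card I * (\<Sum>i\<in>I. (w i)\<^sup>2)"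
proof -
  have "\<bar>\<Sum>i\<in>I. \<Sum>j\<in>I. c i j * w i * w j\<bar> \<le> (\<Sum>i\<in>I. \<Sum>j\<in>I. \<bar>c i j * w i * w j\<bar>)"
    by (rule order_trans[OF sum_abs]) (intro sum_mono sum_abs)
  also have "\<dots> \<le> (\<Sum>i\<in>I. \<Sum>j\<in>I. C * ((w i)\<^sup>2 / 2 + (w j)\<^sup>2 / 2))"
  proof (intro sum_mono)
    fix i j assume "i \<in> I" "j \<in> I"
    have "\<bar>w i * w j\<bar> \<le> (w i)\<^sup>2 / 2 + (w j)\<^sup>2 / 2"
      using sum_squares_bound[of "\<bar>w i\<bar>" "\<bar>w j\<bar>"] by (simp add: abs_mult)
    then have "\<bar>c i j\<bar> * \<bar>w i * w j\<bar> \<le> C * ((w i)\<^sup>2 / 2 + (w j)\<^sup>2 / 2)"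
      by (intro mult_mono assms \<open>i \<in> I\<close> \<open>j \<in> I\<close>) auto
    then show "\<bar>c i j * w i * w j\<bar> \<le> C * ((w i)\<^sup>2 / 2 + (w j)\<^sup>2 / 2)"
      by (simp add: abs_mult mult.assoc)
  qed
  also have "\<dots> = C * card I * (\<Sum>i\<in>I. (w i)\<^sup>2)"
    by (simp add: sum.distrib sum_distrib_left[symmetric] sum_divide_distrib[symmetric] field_simps)
  finally show ?thesis .
qed

section \<open>Second order elliptic operators in divergence form\<close>

locale elliptic_op =
  fixes \<Omega> :: "'e::euclidean_space set" and a :: "'e \<Rightarrow> 'e \<Rightarrow> 'e \<Rightarrow> real"
  assumes open_\<Omega>: "open \<Omega>"
    and a_smooth: "\<And>i j k. i \<in> Basis \<Longrightarrow> j \<in> Basis \<Longrightarrow> Ck_on k \<Omega> (a i j)"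
    and a_sym: "\<And>i j x. x \<in> \<Omega> \<Longrightarrow> i \<in> Basis \<Longrightarrow> j \<in> Basis \<Longrightarrow> a i j x = a j i x"
    and a_pos: "\<And>x \<xi>. x \<in> \<Omega> \<Longrightarrow> \<exists>i\<in>Basis. \<xi> i \<noteq> 0 \<Longrightarrow>
      (\<Sum>i\<in>Basis. \<Sum>j\<in>Basis. a i j x * \<xi> i * \<xi> j) > 0"
begin

definition flux :: "('e \<Rightarrow> real) \<Rightarrow> 'e \<Rightarrow> 'e \<Rightarrow> real" where
  "flux f i x = (\<Sum>j\<in>Basis. a i j x * pd j f x)"

text \<open>The divergence form of the operator integrates by parts without remainder. It differs
  from the sum of \<open>a i j x * pd i (pd j f) x\<close> by first order terms only
  (\<open>div_op_expand\<close>), which the final estimate absorbs.\<close>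

definition div_op :: "('e \<Rightarrow> real) \<Rightarrow> 'e \<Rightarrow> real" where
  "div_op f x = (\<Sum>i\<in>Basis. pd i (flux f i) x)"

definition grad_inner :: "('e \<Rightarrow> real) \<Rightarrow> ('e \<Rightarrow> real) \<Rightarrow> 'e \<Rightarrow> real" where
  "grad_inner f g x = (\<Sum>i\<in>Basis. flux f i x * pd i g x)"

lemma Ck_flux: "Ck_on (Suc k) \<Omega> f \<Longrightarrow> i \<in> Basis \<Longrightarrow> Ck_on k \<Omega> (flux f i)"
  unfolding flux_def[abs_def]
  by (intro Ck_on_sum Ck_on_mult open_\<Omega> a_smooth Ck_on_pd) auto

lemma Ck_div_op: "Ck_on (Suc (Suc k)) \<Omega> f \<Longrightarrow> Ck_on k \<Omega> (div_op f)"
  unfolding div_op_def[abs_def]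
  by (intro Ck_on_sum open_\<Omega> Ck_on_pd Ck_flux)

lemma Ck_grad_inner: "Ck_on (Suc k) \<Omega> f \<Longrightarrow> Ck_on (Suc k) \<Omega> g \<Longrightarrow> Ck_on k \<Omega> (grad_inner f g)"
  unfolding grad_inner_def[abs_def]
  by (intro Ck_on_sum Ck_on_mult open_\<Omega> Ck_on_pd Ck_flux)

lemma grad_inner_commute: "x \<in> \<Omega> \<Longrightarrow> grad_inner f g x = grad_inner g f x"
  unfolding grad_inner_def flux_def sum_distrib_right
  by (subst sum.swap) (auto intro!: sum.cong simp: a_sym)

text \<open>The form is positive and continuous on the compact product of \<open>K\<close> with the
  unit sphere, hence bounded below there; homogeneity of degree two gives all other vectors.\<close>

lemma grad_inner_ellipticity:
  assumes "compact K" "K \<subseteq> \<Omega>"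
  shows "\<exists>c>0. \<forall>x\<in>K. \<forall>\<xi>. c * (\<Sum>i\<in>Basis. (\<xi> i)\<^sup>2) \<le> (\<Sum>i\<in>Basis. \<Sum>j\<in>Basis. a i j x * \<xi> i * \<xi> j)"
proof -
  define F where "F z = (\<Sum>i\<in>Basis. \<Sum>j\<in>Basis. a i j (fst z) * (snd z \<bullet> i) * (snd z \<bullet> j))" for z :: "'e \<times> 'e"
  have ca: "continuous_on K (a i j)" if "i \<in> Basis" "j \<in> Basis" for i j
    using Ck_on_imp_continuous_on[OF a_smooth[OF that, of 0]] continuous_on_subset assms(2) by blast
  have "\<exists>c>0. \<forall>z\<in>K \<times> sphere 0 1. c \<le> F z"
  proof (rule compact_pos_lower_bound)
    show "compact (K \<times> sphere (0::'e) 1)" by (intro compact_Times assms compact_sphere)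
    show "continuous_on (K \<times> sphere 0 1) F"
      unfolding F_def
      by (intro continuous_on_sum continuous_on_mult continuous_on_compose2[OF ca] continuous_intros) auto
    fix z :: "'e \<times> 'e" assume z: "z \<in> K \<times> sphere 0 1"
    then have "snd z \<noteq> 0" by auto
    then have "\<exists>i\<in>Basis. snd z \<bullet> i \<noteq> 0" using euclidean_all_zero_iff by blast
    then show "F z > 0" unfolding F_def using z assms(2) by (intro a_pos) auto
  qed
  then obtain c where c: "c > 0" "\<And>x v. x \<in> K \<Longrightarrow> norm v = 1 \<Longrightarrow> c \<le> F (x, v)" by auto
  have "c * (\<Sum>i\<in>Basis. (\<xi> i)\<^sup>2) \<le> (\<Sum>i\<in>Basis. \<Sum>j\<in>Basis. a i j x * \<xi> i * \<xi> j)" if x: "x \<in> K" for x \<xi>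
  proof -
    define v :: 'e where "v = (\<Sum>i\<in>Basis. \<xi> i *\<^sub>R i)"
    have vi: "v \<bullet> i = \<xi> i" if "i \<in> Basis" for i using that by (simp add: v_def)
    have nv: "(norm v)\<^sup>2 = (\<Sum>i\<in>Basis. (\<xi> i)\<^sup>2)"
        unfolding power2_norm_eq_inner by (subst euclidean_inner) (simp add: vi power2_eq_square)
    have "c * (norm v)\<^sup>2 \<le> F (x, v)"
    proof (cases "v = 0")
      case False
      have "F (x, v) = (norm v)\<^sup>2 * F (x, v /\<^sub>R norm v)"
        using False unfolding F_def fst_conv snd_conv sum_distrib_left
        by (intro sum.cong refl) (simp add: field_simps power2_eq_square)
      moreover have "c \<le> F (x, v /\<^sub>R norm v)" using False x by (intro c) auto
      ultimately show ?thesis by (simp add: mult.commute[of c] mult_left_mono)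
    qed (simp add: F_def)
    then show ?thesis by (simp add: nv F_def vi)
  qed
  then show ?thesis using c(1) by blast
qed

end

text \<open>The algebra of \<open>divergence_identity\<close> without the calculus. There
  \<open>p\<close>, \<open>X\<close> are the fluxes of \<open>w\<close>, \<open>\<phi>\<close>;
  \<open>S\<close>, \<open>N\<close> are \<open>grad_inner \<phi> w\<close>,
  \<open>grad_inner w w\<close>; \<open>m\<close>, \<open>t\<close> are \<open>\<mu>\<close>,
  \<open>\<theta>\<close>; primes are derivatives. The identity holds summand by summand, hence the
  induction on \<open>I\<close>.\<close>

lemma divergence_sum_identity:
  fixes p S' :: "'i \<Rightarrow> real"
  shows "(\<Sum>i\<in>I. 2 * (p i * S' i + p' i * S) - (X i * N' i + X' i * N)
      + (m * w * p' i + (m * w' i + m' i * w) * p i)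
      + (t * X i * (2 * w * w' i) + (t * X' i + t' i * X i) * w\<^sup>2))
    = 2 * (\<Sum>i\<in>I. p i * S' i) + 2 * S * (\<Sum>i\<in>I. p' i) - (\<Sum>i\<in>I. X i * N' i) - N * (\<Sum>i\<in>I. X' i)
      + m * w * (\<Sum>i\<in>I. p' i) + m * (\<Sum>i\<in>I. p i * w' i) + w * (\<Sum>i\<in>I. p i * m' i)
      + 2 * t * w * (\<Sum>i\<in>I. X i * w' i) + t * w\<^sup>2 * (\<Sum>i\<in>I. X' i) + w\<^sup>2 * (\<Sum>i\<in>I. X i * t' i)"
  by (induction I rule: infinite_finite_induct) (simp_all add: algebra_simps)

context elliptic_op
begin

text \<open>A Rellich type multiplier identity: multiplying \<open>div_op w + \<theta> w\<close> by
  \<open>2 * grad_inner \<phi> w + \<mu> w\<close> gives a divergence up to a form that is quadratic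
  in \<open>w\<close> and its gradient and free of second derivatives of \<open>w\<close>.\<close>

lemma divergence_identity:
  fixes w \<phi> \<mu> \<theta> :: "'e \<Rightarrow> real"
  assumes x: "x \<in> \<Omega>" and w: "Ck_on 2 \<Omega> w" and \<phi>: "Ck_on 2 \<Omega> \<phi>"
    and \<mu>: "Ck_on 1 \<Omega> \<mu>" and \<theta>: "Ck_on 1 \<Omega> \<theta>"
  defines "Z \<equiv> \<lambda>i x. 2 * (flux w i x * grad_inner \<phi> w x) - flux \<phi> i x * grad_inner w w x
      + \<mu> x * w x * flux w i x + \<theta> x * flux \<phi> i x * (w x)\<^sup>2"
  shows "(\<Sum>i\<in>Basis. pd i (Z i) x) =
      (div_op w x + \<theta> x * w x) * (2 * grad_inner \<phi> w x + \<mu> x * w x)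
      + (2 * (\<Sum>i\<in>Basis. \<Sum>k\<in>Basis. flux w i x * pd i (flux \<phi> k) x * pd k w x)
         - (\<Sum>i\<in>Basis. \<Sum>j\<in>Basis. (\<Sum>k\<in>Basis. flux \<phi> k x * pd k (a i j) x) * pd i w x * pd j w x)
         + (\<mu> x - div_op \<phi> x) * grad_inner w w x + w x * grad_inner w \<mu> x
         + (grad_inner \<phi> \<theta> x - \<theta> x * (\<mu> x - div_op \<phi> x)) * (w x)\<^sup>2)"
proof -
  have w': "Ck_on (Suc (Suc 0)) \<Omega> w" "Ck_on (Suc (Suc 0)) \<Omega> \<phi>" "Ck_on (Suc 0) \<Omega> \<mu>" "Ck_on (Suc 0) \<Omega> \<theta>"
    using w \<phi> \<mu> \<theta> by (auto simp: numeral_2_eq_2)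
  have d: "f differentiable (at x)" if "Ck_on (Suc k) \<Omega> f" for k and f :: "'e \<Rightarrow> real"
    by (rule Ck_on_differentiable[OF that x])
  note dw = d[OF w'(1)] and d\<mu> = d[OF w'(3)] and d\<theta> = d[OF w'(4)]
  have da: "i \<in> Basis \<Longrightarrow> j \<in> Basis \<Longrightarrow> a i j differentiable (at x)" for i j
    by (rule d[OF a_smooth])
  have dpw: "pd j w differentiable (at x)" for j by (rule d[OF Ck_on_pd[OF w'(1)]])
  have df: "i \<in> Basis \<Longrightarrow> flux w i differentiable (at x)" "i \<in> Basis \<Longrightarrow> flux \<phi> i differentiable (at x)" for i
    by (rule d[OF Ck_flux[OF w'(1)]] d[OF Ck_flux[OF w'(2)]]; assumption)+
  have dS: "grad_inner \<phi> w differentiable (at x)"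
    unfolding grad_inner_def[abs_def] by (intro differentiable_sum ballI finite_Basis differentiable_mult df dpw)
  have dN: "grad_inner w w differentiable (at x)"
    unfolding grad_inner_def[abs_def] by (intro differentiable_sum ballI finite_Basis differentiable_mult df dpw)
  have S': "pd i (grad_inner \<phi> w) x = (\<Sum>k\<in>Basis. flux \<phi> k x * pd i (pd k w) x + pd i (flux \<phi> k) x * pd k w x)" for i
    unfolding grad_inner_def[abs_def] by (subst pd_sum) (simp_all add: pd_mult df dpw)
  have N': "pd k (grad_inner w w) x = (\<Sum>i\<in>Basis. \<Sum>j\<in>Basis. pd k (a i j) x * pd i w x * pd j w x)
       + 2 * (\<Sum>i\<in>Basis. flux w i x * pd k (pd i w) x)" for k
  proof -
    have f': "pd k (flux w i) x = (\<Sum>j\<in>Basis. a i j x * pd k (pd j w) x + pd k (a i j) x * pd j w x)"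
      if "i \<in> Basis" for i
      unfolding flux_def[abs_def] using that
      by (subst pd_sum) (simp_all add: pd_mult da dpw)
    have "pd k (grad_inner w w) x = (\<Sum>i\<in>Basis. flux w i x * pd k (pd i w) x + pd k (flux w i) x * pd i w x)"
      unfolding grad_inner_def[abs_def] by (subst pd_sum) (simp_all add: pd_mult df dpw)
    also have "\<dots> = (\<Sum>i\<in>Basis. flux w i x * pd k (pd i w) x)
        + (\<Sum>i\<in>Basis. \<Sum>j\<in>Basis. a i j x * pd i w x * pd k (pd j w) x)
        + (\<Sum>i\<in>Basis. \<Sum>j\<in>Basis. pd k (a i j) x * pd i w x * pd j w x)"
      by (simp add: f' sum.distrib sum_distrib_left sum_distrib_right algebra_simps)
    also have "(\<Sum>i\<in>Basis. \<Sum>j\<in>Basis. a i j x * pd i w x * pd k (pd j w) x)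
        = (\<Sum>j\<in>Basis. \<Sum>i\<in>Basis. a i j x * pd i w x * pd k (pd j w) x)" by (rule sum.swap)
    also have "\<dots> = (\<Sum>j\<in>Basis. flux w j x * pd k (pd j w) x)"
      unfolding flux_def sum_distrib_right by (intro sum.cong refl) (simp add: a_sym[OF x])
    finally show ?thesis by simp
  qed
  \<comment> \<open>\<open>T\<close> collects the second derivatives of \<open>w\<close> outside
    \<open>div_op w\<close>. It arises twice from \<open>grad_inner \<phi> w\<close> and twice, with
    the opposite sign, from \<open>grad_inner w w\<close>; symmetry of second derivatives makes the
    contributions equal, and they cancel.\<close>
  define T where "T = (\<Sum>i\<in>Basis. \<Sum>k\<in>Basis. flux w i x * flux \<phi> k x * pd i (pd k w) x)"
  define P where "P = (\<Sum>i\<in>Basis. \<Sum>k\<in>Basis. flux w i x * pd i (flux \<phi> k) x * pd k w x)"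
  define A where "A = (\<Sum>i\<in>Basis. \<Sum>j\<in>Basis. (\<Sum>k\<in>Basis. flux \<phi> k x * pd k (a i j) x) * pd i w x * pd j w x)"
  have pS: "(\<Sum>i\<in>Basis. flux w i x * pd i (grad_inner \<phi> w) x) = T + P"
    by (simp add: S' T_def P_def sum.distrib sum_distrib_left algebra_simps)
  have "(\<Sum>k\<in>Basis. flux \<phi> k x * (\<Sum>i\<in>Basis. flux w i x * pd k (pd i w) x)) = T"
    unfolding T_def sum_distrib_left
    by (subst sum.swap) (intro sum.cong refl, simp add: pd_commute[OF open_\<Omega> w x])
  moreover have "(\<Sum>k\<in>Basis. flux \<phi> k x * (\<Sum>i\<in>Basis. \<Sum>j\<in>Basis. pd k (a i j) x * pd i w x * pd j w x)) = A"
  proof -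
    have "A = (\<Sum>i\<in>Basis. \<Sum>j\<in>Basis. \<Sum>k\<in>Basis. flux \<phi> k x * (pd k (a i j) x * pd i w x * pd j w x))"
      by (simp add: A_def sum_distrib_right mult.assoc)
    also have "\<dots> = (\<Sum>i\<in>Basis. \<Sum>k\<in>Basis. \<Sum>j\<in>Basis. flux \<phi> k x * (pd k (a i j) x * pd i w x * pd j w x))"
      by (intro sum.cong refl sum.swap)
    also have "\<dots> = (\<Sum>k\<in>Basis. \<Sum>i\<in>Basis. \<Sum>j\<in>Basis. flux \<phi> k x * (pd k (a i j) x * pd i w x * pd j w x))"
      by (rule sum.swap)
    finally show ?thesis by (simp add: sum_distrib_left)
  qed
  ultimately have XN: "(\<Sum>k\<in>Basis. flux \<phi> k x * pd k (grad_inner w w) x) = A + 2 * T"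
    by (simp only: N' distrib_left sum.distrib mult.left_commute[of _ 2] sum_distrib_left[symmetric])
  have "pd i (Z i) x = 2 * (flux w i x * pd i (grad_inner \<phi> w) x + pd i (flux w i) x * grad_inner \<phi> w x)
      - (flux \<phi> i x * pd i (grad_inner w w) x + pd i (flux \<phi> i) x * grad_inner w w x)
      + (\<mu> x * w x * pd i (flux w i) x + (\<mu> x * pd i w x + pd i \<mu> x * w x) * flux w i x)
      + (\<theta> x * flux \<phi> i x * (2 * w x * pd i w x) + (\<theta> x * pd i (flux \<phi> i) x + pd i \<theta> x * flux \<phi> i x) * (w x)\<^sup>2)"
    if i: "i \<in> Basis" for i
    unfolding Z_def power2_eq_square
    by (simp add: pd_add pd_diff pd_mult dw d\<mu> d\<theta> df[OF i] dS dN differentiable_mult differentiable_add differentiable_diff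
        algebra_simps)
  then have "(\<Sum>i\<in>Basis. pd i (Z i) x) = 2 * (T + P) + 2 * grad_inner \<phi> w x * div_op w x - (A + 2 * T) - grad_inner w w x * div_op \<phi> x
      + \<mu> x * w x * div_op w x + \<mu> x * grad_inner w w x + w x * grad_inner w \<mu> x
      + 2 * \<theta> x * w x * grad_inner \<phi> w x + \<theta> x * (w x)\<^sup>2 * div_op \<phi> x + (w x)\<^sup>2 * grad_inner \<phi> \<theta> x"
    by (simp only: divergence_sum_identity pS XN div_op_def[symmetric] grad_inner_def[symmetric] cong: sum.cong)
  then show ?thesis
    unfolding P_def[symmetric] A_def[symmetric] by (simp add: algebra_simps power2_eq_square)
qed

end

section \<open>Carleman estimate\<close>

lemma power2_diff_le: "(a - b)\<^sup>2 \<le> 2 * a\<^sup>2 + 2 * b\<^sup>2" for a b :: real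
  using zero_le_power2[of "a + b"] by (simp add: power2_eq_square algebra_simps)

context elliptic_op
begin

text \<open>On the right, \<open>div_op w\<close> and the \<tau>^2 term form the formally symmetric
  part of the conjugated operator; the two terms linear in \<tau> form the antisymmetric
  part.\<close>

lemma conjugated_operator:
  fixes u \<phi> :: "'e \<Rightarrow> real" and \<tau> :: real
  assumes x: "x \<in> \<Omega>" and u: "Ck_on 2 \<Omega> u" and \<phi>: "Ck_on 2 \<Omega> \<phi>"
  defines "w \<equiv> \<lambda>x. exp (\<tau> * \<phi> x) * u x"
  shows "pd j w x = exp (\<tau> * \<phi> x) * pd j u x + \<tau> * pd j \<phi> x * w x"
    and "exp (\<tau> * \<phi> x) * div_op u x =
      div_op w x + \<tau>\<^sup>2 * grad_inner \<phi> \<phi> x * w x - 2 * \<tau> * grad_inner \<phi> w x - \<tau> * div_op \<phi> x * w x"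
proof -
  have u': "Ck_on (Suc (Suc 0)) \<Omega> u" "Ck_on (Suc (Suc 0)) \<Omega> \<phi>"
    using u \<phi> by (auto simp: numeral_2_eq_2)
  have du: "u differentiable (at y)" and d\<phi>: "\<phi> differentiable (at y)" if "y \<in> \<Omega>" for y
    using u' Ck_on_differentiable that by blast+
  have dfu: "flux u i differentiable (at y)" and df\<phi>: "flux \<phi> i differentiable (at y)"
    if "i \<in> Basis" "y \<in> \<Omega>" for i y
    using Ck_flux[OF u'(1) that(1)] Ck_flux[OF u'(2) that(1)] Ck_on_differentiable that(2) by blast+
  have dt: "(\<lambda>x. \<tau> * \<phi> x) differentiable (at y)" if "y \<in> \<Omega>" for y
    using d\<phi>[OF that] by simp
  have de: "(\<lambda>x. exp (\<tau> * \<phi> x)) differentiable (at y)" if "y \<in> \<Omega>" for y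
    using has_derivative_exp[OF pd_has_derivative[OF dt[OF that]]] unfolding differentiable_def by blast
  have pe: "pd i (\<lambda>x. exp (\<tau> * \<phi> x)) y = exp (\<tau> * \<phi> y) * (\<tau> * pd i \<phi> y)" if "y \<in> \<Omega>" for i y
    by (simp add: pd_exp dt pd_mult d\<phi> that)
  have pw: "pd i w y = exp (\<tau> * \<phi> y) * (pd i u y + \<tau> * pd i \<phi> y * u y)" if "y \<in> \<Omega>" for i y
    unfolding w_def using that by (simp add: pd_mult de du pe algebra_simps)
  show "pd j w x = exp (\<tau> * \<phi> x) * pd j u x + \<tau> * pd j \<phi> x * w x"
    using pw[OF x] by (simp add: w_def algebra_simps)
  have fw: "flux w i y = exp (\<tau> * \<phi> y) * (flux u i y + \<tau> * u y * flux \<phi> i y)" if "y \<in> \<Omega>" for i y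
    unfolding flux_def pw[OF that] by (simp add: sum_distrib_left sum.distrib algebra_simps)
  have pfw: "pd i (flux w i) x = exp (\<tau> * \<phi> x) *
      (pd i (flux u i) x + \<tau> * (u x * pd i (flux \<phi> i) x + pd i u x * flux \<phi> i x)
       + \<tau> * pd i \<phi> x * (flux u i x + \<tau> * u x * flux \<phi> i x))" if i: "i \<in> Basis" for i
  proof -
    have "pd i (flux w i) x = pd i (\<lambda>y. exp (\<tau> * \<phi> y) * (flux u i y + \<tau> * u y * flux \<phi> i y)) x"
      by (rule pd_cong_open[OF open_\<Omega> x fw])
    also have "\<dots> = exp (\<tau> * \<phi> x) *
      (pd i (flux u i) x + \<tau> * (u x * pd i (flux \<phi> i) x + pd i u x * flux \<phi> i x)
       + \<tau> * pd i \<phi> x * (flux u i x + \<tau> * u x * flux \<phi> i x))"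
      using x i by (simp add: pd_mult pd_add de pe du d\<phi> dfu df\<phi> differentiable_add algebra_simps)
    finally show ?thesis .
  qed
  have dw: "div_op w x = exp (\<tau> * \<phi> x) * (div_op u x + \<tau> * (u x * div_op \<phi> x + grad_inner \<phi> u x)
      + \<tau> * (grad_inner u \<phi> x + \<tau> * u x * grad_inner \<phi> \<phi> x))"
    unfolding div_op_def grad_inner_def
    by (simp add: pfw sum_distrib_left sum.distrib algebra_simps)
  have gw: "grad_inner \<phi> w x = exp (\<tau> * \<phi> x) * (grad_inner \<phi> u x + \<tau> * u x * grad_inner \<phi> \<phi> x)"
    unfolding grad_inner_def pw[OF x] by (simp add: sum_distrib_left sum.distrib algebra_simps)
  have wx: "w x = exp (\<tau> * \<phi> x) * u x" by (simp add: w_def)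
  show "exp (\<tau> * \<phi> x) * div_op u x =
      div_op w x + \<tau>\<^sup>2 * grad_inner \<phi> \<phi> x * w x - 2 * \<tau> * grad_inner \<phi> w x - \<tau> * div_op \<phi> x * w x"
    unfolding dw gw grad_inner_commute[OF x, of u \<phi>] wx by (simp add: algebra_simps power2_eq_square)
qed

text \<open>The open sets \<open>\<Omega>\<close> and \<open>- K\<close> cover the space, and
  \<open>f\<close> is zero on the second, so regularity on each suffices.\<close>

lemma Ck_on_UNIV_extension:
  assumes "Ck_on k \<Omega> f" "compact K" "K \<subseteq> \<Omega>" "\<And>x. x \<notin> K \<Longrightarrow> f x = 0"
  shows "Ck_on k UNIV f"
proof -
  have o: "open (- K)" using assms(2) compact_imp_closed by blast
  have "Ck_on k (- K) f" using Ck_on_cong[OF o, of f "\<lambda>_. 0"] assms(4) by simp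
  then have "Ck_on k (\<Omega> \<union> - K) f" using Ck_on_Un[OF open_\<Omega> o] assms(1) by blast
  moreover have "\<Omega> \<union> - K = UNIV" using assms(3) by blast
  ultimately show ?thesis by simp
qed

text \<open>The gradient part of the form in \<open>divergence_identity\<close>. It is half the
  iterated Poisson bracket {p, {p, \<phi>}} of the symbol p = \<open>a_form\<close>, the quantity in
  pseudoconvexity conditions, and twice the Hessian of \<open>\<phi>\<close> for the metric whose
  inverse has the entries \<open>a\<close>.\<close>

definition hess_form :: "('e \<Rightarrow> real) \<Rightarrow> 'e \<Rightarrow> ('e \<Rightarrow> real) \<Rightarrow> real" where
  "hess_form \<phi> x \<xi> =
    2 * (\<Sum>i\<in>Basis. \<Sum>k\<in>Basis. (\<Sum>j\<in>Basis. a i j x * \<xi> j) * pd i (flux \<phi> k) x * \<xi> k)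
    - (\<Sum>i\<in>Basis. \<Sum>j\<in>Basis. (\<Sum>k\<in>Basis. flux \<phi> k x * pd k (a i j) x) * \<xi> i * \<xi> j)"

definition a_form :: "'e \<Rightarrow> ('e \<Rightarrow> real) \<Rightarrow> real" where
  "a_form x \<xi> = (\<Sum>i\<in>Basis. \<Sum>j\<in>Basis. a i j x * \<xi> i * \<xi> j)"

lemma grad_inner_self: "grad_inner w w x = a_form x (\<lambda>i. pd i w x)"
  unfolding grad_inner_def flux_def a_form_def sum_distrib_right by (intro sum.cong refl) simp

lemma sq_le_combination:
  fixes f A B \<tau> :: real
  assumes "f = A - \<tau> * B"
  shows "- (2 * \<tau> * (A * B)) \<le> f\<^sup>2"
proof -
  have "f\<^sup>2 + 2 * \<tau> * (A * B) = A\<^sup>2 + (\<tau> * B)\<^sup>2"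
    unfolding assms by (simp add: power2_eq_square algebra_simps)
  then show ?thesis by (smt (verit) zero_le_power2)
qed

text \<open>With \<open>w = e\<^sup>\<tau>\<^sup>\<phi> u\<close> the conjugated operator splits as \<open>A - \<tau> B\<close> where \<open>B = 2 \<langle>\<nabla>\<phi>, \<nabla>w\<rangle> + \<mu> w\<close>, and
  \<open>(A - \<tau> B)\<^sup>2 \<ge> - 2 \<tau> A B\<close>. By the divergence identity, \<open>- A B\<close> is, up to a divergence, the quadratic form in
  \<open>w\<close> and \<open>\<nabla>w\<close> that the two hypotheses on \<open>\<nu>\<close> make positive for large \<open>\<tau>\<close>.\<close>

lemma carleman_weighted:
  fixes \<phi> \<nu> :: "'e \<Rightarrow> real"
  assumes K: "compact K" "K \<subseteq> \<Omega>"
    and \<phi>: "\<And>k. Ck_on k \<Omega> \<phi>" and \<nu>: "\<And>k. Ck_on k \<Omega> \<nu>" and c: "c > 0"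
    and pc1: "\<And>x \<xi>. x \<in> K \<Longrightarrow> c * (\<Sum>i\<in>Basis. (\<xi> i)\<^sup>2) \<le> hess_form \<phi> x \<xi> + \<nu> x * a_form x \<xi>"
    and pc2: "\<And>x. x \<in> K \<Longrightarrow> c \<le> grad_inner \<phi> (grad_inner \<phi> \<phi>) x - \<nu> x * grad_inner \<phi> \<phi> x"
  shows "\<exists>C>0. \<exists>\<tau>\<^sub>0>0. \<forall>\<tau>\<ge>\<tau>\<^sub>0. \<forall>u A B. Ck_on 2 UNIV u \<longrightarrow> (\<forall>x. x \<notin> K \<longrightarrow> u x = 0) \<longrightarrow> K \<subseteq> box A B \<longrightarrow>
    \<tau> * integral (cbox A B) (\<lambda>x. exp (2 * \<tau> * \<phi> x) * ((u x)\<^sup>2 + (\<Sum>i\<in>Basis. (pd i u x)\<^sup>2)))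
      \<le> C * integral (cbox A B) (\<lambda>x. exp (2 * \<tau> * \<phi> x) * (div_op u x)\<^sup>2)"
proof -
  \<comment> \<open>With this choice \<open>\<mu> - div_op \<phi>\<close> is \<open>\<nu>\<close>,
    so the divergence identity produces exactly the two expressions that \<open>pc1\<close> and
    \<open>pc2\<close> bound from below.\<close>
  define \<mu> where "\<mu> x = \<nu> x + div_op \<phi> x" for x
  define q where "q = grad_inner \<phi> \<phi>"
  have \<mu>: "Ck_on k \<Omega> \<mu>" for k
    unfolding \<mu>_def by (intro Ck_on_add open_\<Omega> \<nu> Ck_div_op \<phi>)
  have q: "Ck_on k \<Omega> q" for k unfolding q_def by (intro Ck_grad_inner \<phi>)
  have cK: "continuous_on K f" if "Ck_on 0 \<Omega> f" for f :: "'e \<Rightarrow> real"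
    using that K(2) continuous_on_subset by fastforce
  have "\<exists>M1\<ge>0. \<forall>x\<in>K. \<bar>grad_inner \<phi> \<nu> x - (\<nu> x)\<^sup>2\<bar> \<le> M1"
    by (intro compact_bound K cK Ck_on_diff Ck_on_power open_\<Omega> Ck_grad_inner \<phi> \<nu>)
  then obtain M1 where M1: "M1 \<ge> 0" "\<And>x. x \<in> K \<Longrightarrow> \<bar>grad_inner \<phi> \<nu> x - (\<nu> x)\<^sup>2\<bar> \<le> M1" by auto
  have "\<exists>M2\<ge>0. \<forall>i\<in>Basis. \<forall>x\<in>K. \<bar>flux \<mu> i x\<bar> \<le> M2"
    by (intro compact_family_bound finite_Basis K cK Ck_flux \<mu>)
  then obtain M2 where M2: "M2 \<ge> 0" "\<And>i x. i \<in> Basis \<Longrightarrow> x \<in> K \<Longrightarrow> \<bar>flux \<mu> i x\<bar> \<le> M2" by auto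
  have "\<exists>M3\<ge>0. \<forall>i\<in>Basis. \<forall>x\<in>K. \<bar>pd i \<phi> x\<bar> \<le> M3"
    by (intro compact_family_bound finite_Basis K cK Ck_on_pd \<phi>)
  then obtain M3 where M3: "M3 \<ge> 0" "\<And>i x. i \<in> Basis \<Longrightarrow> x \<in> K \<Longrightarrow> \<bar>pd i \<phi> x\<bar> \<le> M3" by auto
  define n where "n = real (DIM('e))"
  \<comment> \<open>\<open>R\<close> is the price in \<open>(w x)\<^sup>2\<close> of absorbing
    \<open>w x * grad_inner w \<mu> x\<close> into half of the gradient term, and \<open>M4\<close>
    collects the terms to be beaten by \<open>\<tau>\<^sup>2 * c / 2\<close>. \<open>D\<close> pays
    for the return from \<open>w\<close> to \<open>u\<close>. The summand 1 in
    \<open>\<tau>\<^sub>0\<close> gives \<tau> at least 1.\<close>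
  define R where "R = n * M2\<^sup>2 / (2 * c)"
  define M4 where "M4 = M1 + R"
  define D where "D = 3 + 2 * n * M3\<^sup>2"
  define \<tau>\<^sub>0 where "\<tau>\<^sub>0 = 1 + 2 * M4 / c"
  have M4: "M4 \<ge> 0" using M1 M2 c by (simp add: M4_def R_def n_def)
  have D: "D > 0" by (simp add: D_def n_def add_pos_nonneg)
  have \<tau>\<^sub>0: "\<tau>\<^sub>0 \<ge> 1" using M4 c by (simp add: \<tau>\<^sub>0_def)
  have main: "\<tau> * integral (cbox A B) (\<lambda>x. exp (2 * \<tau> * \<phi> x) * ((u x)\<^sup>2 + (\<Sum>i\<in>Basis. (pd i u x)\<^sup>2)))
      \<le> (D / c) * integral (cbox A B) (\<lambda>x. exp (2 * \<tau> * \<phi> x) * (div_op u x)\<^sup>2)"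
    if \<tau>: "\<tau> \<ge> \<tau>\<^sub>0" and u: "Ck_on 2 UNIV u" and supp: "\<forall>x. x \<notin> K \<longrightarrow> u x = 0" and box: "K \<subseteq> box A B"
    for \<tau> u A B
  proof -
    have \<tau>1: "\<tau> \<ge> 1" using \<tau> \<tau>\<^sub>0 by simp
    define w where "w = (\<lambda>x. exp (\<tau> * \<phi> x) * u x)"
    \<comment> \<open>The zero order coefficient of the symmetric part. The term
      \<open>\<tau> * \<nu> x\<close> compensates for using \<open>\<mu>\<close> instead of
      \<open>div_op \<phi>\<close> in the other part.\<close>
    define \<theta> where "\<theta> = (\<lambda>x. \<tau>\<^sup>2 * q x + \<tau> * \<nu> x)"
    define Z where "Z = (\<lambda>i x. 2 * (flux w i x * grad_inner \<phi> w x) - flux \<phi> i x * grad_inner w w x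
      + \<mu> x * w x * flux w i x + \<theta> x * flux \<phi> i x * (w x)\<^sup>2)"
    define E where "E = (\<lambda>x. exp (2 * \<tau> * \<phi> x) * ((u x)\<^sup>2 + (\<Sum>i\<in>Basis. (pd i u x)\<^sup>2)))"
    define G where "G = (\<lambda>x. exp (2 * \<tau> * \<phi> x) * (div_op u x)\<^sup>2)"
    have u\<Omega>: "Ck_on 2 \<Omega> u" using Ck_on_subset[OF u] by simp
    have w: "Ck_on 2 \<Omega> w"
      unfolding w_def by (intro Ck_on_mult Ck_on_exp open_\<Omega> Ck_on_const \<phi> u\<Omega>)
    have w': "Ck_on (Suc 1) \<Omega> w" and u': "Ck_on (Suc (Suc 0)) \<Omega> u"
      using w u\<Omega> by (simp_all add: numeral_2_eq_2)
    have \<theta>: "Ck_on k \<Omega> \<theta>" for k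
      unfolding \<theta>_def by (intro Ck_on_add Ck_on_mult open_\<Omega> Ck_on_const q \<nu>)
    have oK: "open (- K)" using K(1) compact_imp_closed by blast
    have pdu0: "pd i u x = 0" if "x \<notin> K" for i x
      using pd_cong_open[OF oK, of x u "\<lambda>_. 0" i] that supp by simp
    have w0: "w x = 0" if "x \<notin> K" for x using that supp by (simp add: w_def)
    have pdw0: "pd i w x = 0" if "x \<notin> K" for i x
      using pd_cong_open[OF oK, of x w "\<lambda>_. 0" i] that w0 by simp
    have fu0: "flux u i x = 0" and fw0: "flux w i x = 0" if "x \<notin> K" for i x
      using that by (simp_all add: flux_def pdu0 pdw0)
    have du0: "div_op u x = 0" if "x \<notin> K" for x
    proof -
      have "pd i (flux u i) x = 0" for i
        using pd_cong_open[OF oK, of x "flux u i" "\<lambda>_. 0"] that fu0 by simp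
      then show ?thesis by (simp add: div_op_def)
    qed
    have Z0: "Z i x = 0" if "x \<notin> K" for i x
      using that by (simp add: Z_def fw0 w0 grad_inner_def)
    have Z: "Ck_on 1 UNIV (Z i)" if "i \<in> Basis" for i
    proof (rule Ck_on_UNIV_extension[OF _ K Z0])
      show "Ck_on 1 \<Omega> (Z i)"
        unfolding Z_def
        by (intro Ck_on_add Ck_on_diff Ck_on_mult Ck_on_power open_\<Omega> Ck_on_const Ck_flux Ck_grad_inner
            that w' \<phi> \<mu> \<theta> Ck_on_SucD[OF w'])
    qed
    have Zint: "integral (cbox A B) (pd i (Z i)) = 0" if "i \<in> Basis" for i
      by (rule integral_pd_eq_0[OF Z[OF that] K(1) box Z0])
    have Zc: "(pd i (Z i)) integrable_on cbox A B" if "i \<in> Basis" for i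
    proof (rule integrable_continuous)
      have "continuous_on UNIV (pd i (Z i))" using Z[OF that] by (simp add: Ck_on_Suc_pd)
      then show "continuous_on (cbox A B) (pd i (Z i))" by (rule continuous_on_subset) simp
    qed
    have int: "f integrable_on cbox A B" if "Ck_on 0 \<Omega> f" "\<And>x. x \<notin> K \<Longrightarrow> f x = 0" for f :: "'e \<Rightarrow> real"
    proof (rule integrable_continuous)
      have "continuous_on UNIV f" using Ck_on_UNIV_extension[OF that(1) K that(2)] by simp
      then show "continuous_on (cbox A B) f" by (rule continuous_on_subset) simp
    qed
    have Eint: "E integrable_on cbox A B"
      unfolding E_def
      by (intro int Ck_on_mult Ck_on_add Ck_on_sum Ck_on_power Ck_on_exp open_\<Omega> Ck_on_const \<phi>
          Ck_on_pd Ck_on_mono[OF u\<Omega>]) (auto simp: supp pdu0)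
    have Gint: "G integrable_on cbox A B"
      unfolding G_def
      by (intro int Ck_on_mult Ck_on_power Ck_on_exp open_\<Omega> Ck_on_const \<phi> Ck_div_op u') (auto simp: du0)
    \<comment> \<open>The estimate holds pointwise up to the divergence of \<open>Z\<close>, whose
      integral vanishes. Outside \<open>K\<close> everything is zero.\<close>
    have point: "(c / D) * \<tau> * E x - 2 * \<tau> * (\<Sum>i\<in>Basis. pd i (Z i) x) \<le> G x" for x
    proof (cases "x \<in> K")
      case False
      have "pd i (Z i) x = 0" for i
        using pd_cong_open[OF oK, of x "Z i" "\<lambda>_. 0"] False Z0 by simp
      then show ?thesis using False by (simp add: E_def G_def du0 supp pdu0)
    next
      case True
      then have x: "x \<in> \<Omega>" using K by blast
      define W where "W = (\<Sum>i\<in>Basis. (pd i w x)\<^sup>2)"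
      define Q where "Q = hess_form \<phi> x (\<lambda>i. pd i w x) + \<nu> x * grad_inner w w x + w x * grad_inner w \<mu> x
         + (grad_inner \<phi> \<theta> x - \<theta> x * \<nu> x) * (w x)\<^sup>2"
      have W0: "W \<ge> 0" by (simp add: W_def sum_nonneg)
      have id: "(\<Sum>i\<in>Basis. pd i (Z i) x) =
         (div_op w x + \<theta> x * w x) * (2 * grad_inner \<phi> w x + \<mu> x * w x) + Q"
        unfolding Z_def Q_def hess_form_def
        using divergence_identity[OF x w \<phi> \<mu> \<theta>]
        by (simp add: flux_def[of w] \<mu>_def)
      have wx: "exp (\<tau> * \<phi> x) * u x = w x" by (simp add: w_def)
      have eq: "exp (\<tau> * \<phi> x) * div_op u x
         = (div_op w x + \<theta> x * w x) - \<tau> * (2 * grad_inner \<phi> w x + \<mu> x * w x)"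
        using conjugated_operator(2)[OF x u\<Omega> \<phi>, of \<tau>]
        unfolding w_def[symmetric] wx \<theta>_def \<mu>_def q_def by (simp add: algebra_simps)
      have exp2: "exp (2 * \<tau> * \<phi> x) = (exp (\<tau> * \<phi> x))\<^sup>2"
        by (simp add: exp_double[symmetric] mult.assoc)
      have G: "2 * \<tau> * Q - 2 * \<tau> * (\<Sum>i\<in>Basis. pd i (Z i) x) \<le> G x"
        using sq_le_combination[OF eq] unfolding id G_def exp2 by (simp add: algebra_simps power_mult_distrib)
      have "grad_inner \<phi> \<theta> x = \<tau>\<^sup>2 * grad_inner \<phi> q x + \<tau> * grad_inner \<phi> \<nu> x"
      proof -
        have "pd i \<theta> x = \<tau>\<^sup>2 * pd i q x + \<tau> * pd i \<nu> x" for i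
          unfolding \<theta>_def using Ck_on_differentiable[OF q x] Ck_on_differentiable[OF \<nu> x]
          by (simp add: pd_add pd_mult)
        then show ?thesis by (simp add: grad_inner_def sum_distrib_left sum.distrib algebra_simps)
      qed
      then have "grad_inner \<phi> \<theta> x - \<theta> x * \<nu> x
         = \<tau>\<^sup>2 * (grad_inner \<phi> q x - \<nu> x * q x) + \<tau> * (grad_inner \<phi> \<nu> x - (\<nu> x)\<^sup>2)"
        by (simp add: \<theta>_def algebra_simps power2_eq_square)
      also have "\<dots> \<ge> \<tau>\<^sup>2 * c + \<tau> * (- M1)"
        using pc2[OF True] M1(2)[OF True] \<tau>1
        by (intro add_mono mult_left_mono) (auto simp: q_def)
      finally have "(\<tau>\<^sup>2 * c + \<tau> * (- M1)) * (w x)\<^sup>2 \<le> (grad_inner \<phi> \<theta> x - \<theta> x * \<nu> x) * (w x)\<^sup>2"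
        by (rule mult_right_mono) simp
      moreover have "c * W \<le> hess_form \<phi> x (\<lambda>i. pd i w x) + \<nu> x * grad_inner w w x"
        using pc1[OF True, of "\<lambda>i. pd i w x"] by (simp add: W_def grad_inner_self)
      moreover have "- (c / 2 * W + R * (w x)\<^sup>2) \<le> w x * grad_inner w \<mu> x"
      proof -
        have "- (flux \<mu> i x * pd i w x * w x) \<le> c / 2 * (pd i w x)\<^sup>2 + M2\<^sup>2 / (2 * c) * (w x)\<^sup>2"
          if "i \<in> Basis" for i
        proof -
          \<comment> \<open>Young's inequality, balanced so that only half of the gradient term
            provided by \<open>pc1\<close> is used up.\<close>
          have "0 \<le> (c * pd i w x + flux \<mu> i x * w x)\<^sup>2" by simp
          also have "\<dots> = c * (2 * (flux \<mu> i x * pd i w x * w x)) + c\<^sup>2 * (pd i w x)\<^sup>2 + (flux \<mu> i x)\<^sup>2 * (w x)\<^sup>2"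
            by (simp add: power2_eq_square algebra_simps)
          also have "(flux \<mu> i x)\<^sup>2 * (w x)\<^sup>2 \<le> M2\<^sup>2 * (w x)\<^sup>2"
            using M2(2)[OF that True] by (intro mult_right_mono) (auto simp: abs_le_square_iff[symmetric])
          finally show ?thesis using c by (simp add: field_simps power2_eq_square)
        qed
        then have "(\<Sum>i\<in>Basis. - (flux \<mu> i x * pd i w x * w x))
            \<le> (\<Sum>i\<in>Basis. c / 2 * (pd i w x)\<^sup>2 + M2\<^sup>2 / (2 * c) * (w x)\<^sup>2)" by (rule sum_mono)
        moreover have "(\<Sum>i\<in>Basis. - (flux \<mu> i x * pd i w x * w x)) = - (w x * grad_inner w \<mu> x)"
          unfolding trans[OF grad_inner_commute[OF x] grad_inner_def, of w \<mu>] sum_distrib_left sum_negf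
          by (simp add: mult.commute mult.left_commute)
        moreover have "(\<Sum>i\<in>Basis. c / 2 * (pd i w x)\<^sup>2 + M2\<^sup>2 / (2 * c) * (w x)\<^sup>2)
            = c / 2 * W + R * (w x)\<^sup>2"
          unfolding sum.distrib W_def sum_distrib_left R_def n_def by simp
        ultimately show ?thesis by linarith
      qed
      ultimately have Q1: "c / 2 * W + (\<tau>\<^sup>2 * c - \<tau> * M1 - R) * (w x)\<^sup>2 \<le> Q"
        unfolding Q_def by (simp add: algebra_simps)
      have "\<tau> * M4 \<le> \<tau>\<^sup>2 * c / 2"
      proof -
        have "M4 \<le> \<tau> * c / 2" using \<tau> c by (simp add: \<tau>\<^sub>0_def field_simps)
        then have "\<tau> * M4 \<le> \<tau> * (\<tau> * c / 2)" using \<tau>1 by (intro mult_left_mono) auto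
        then show ?thesis by (simp add: power2_eq_square)
      qed
      moreover have "R \<le> \<tau> * (R)"
        using mult_right_mono[OF \<tau>1, of "R"] c by (simp add: R_def n_def)
      ultimately have "\<tau>\<^sup>2 * c / 2 \<le> \<tau>\<^sup>2 * c - \<tau> * M1 - R"
        by (simp add: M4_def algebra_simps)
      then have "\<tau>\<^sup>2 * c / 2 * (w x)\<^sup>2 \<le> (\<tau>\<^sup>2 * c - \<tau> * M1 - R) * (w x)\<^sup>2"
        by (rule mult_right_mono) simp
      then have Q2: "c / 2 * (W + \<tau>\<^sup>2 * (w x)\<^sup>2) \<le> Q" using Q1 by (simp add: algebra_simps)
      have "E x \<le> D * (W + \<tau>\<^sup>2 * (w x)\<^sup>2)"
      proof -
        have Eeq: "E x = (w x)\<^sup>2 + (\<Sum>i\<in>Basis. (exp (\<tau> * \<phi> x) * pd i u x)\<^sup>2)"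
          unfolding E_def exp2 w_def by (simp add: algebra_simps power_mult_distrib sum_distrib_left)
        have "(\<Sum>i\<in>Basis. (exp (\<tau> * \<phi> x) * pd i u x)\<^sup>2)
          \<le> (\<Sum>i\<in>Basis. 2 * (pd i w x)\<^sup>2 + 2 * M3\<^sup>2 * (\<tau>\<^sup>2 * (w x)\<^sup>2))"
        proof (rule sum_mono)
          fix i :: 'e assume i: "i \<in> Basis"
          have "exp (\<tau> * \<phi> x) * pd i u x = pd i w x - pd i \<phi> x * (\<tau> * w x)"
            using conjugated_operator(1)[OF x u\<Omega> \<phi>, of i \<tau>] unfolding w_def[symmetric] wx by simp
          then have "(exp (\<tau> * \<phi> x) * pd i u x)\<^sup>2 \<le> 2 * (pd i w x)\<^sup>2 + 2 * (pd i \<phi> x * (\<tau> * w x))\<^sup>2"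
            by (simp only: power2_diff_le)
          also have "(pd i \<phi> x * (\<tau> * w x))\<^sup>2 \<le> M3\<^sup>2 * (\<tau>\<^sup>2 * (w x)\<^sup>2)"
            using M3(2)[OF i True] unfolding power_mult_distrib
            by (intro mult_right_mono) (auto simp: abs_le_square_iff[symmetric])
          finally show "(exp (\<tau> * \<phi> x) * pd i u x)\<^sup>2 \<le> 2 * (pd i w x)\<^sup>2 + 2 * M3\<^sup>2 * (\<tau>\<^sup>2 * (w x)\<^sup>2)"
            by simp
        qed
        also have "\<dots> = 2 * W + 2 * n * M3\<^sup>2 * (\<tau>\<^sup>2 * (w x)\<^sup>2)"
          by (simp add: sum.distrib W_def sum_distrib_left n_def)
        finally have "E x \<le> (w x)\<^sup>2 + 2 * W + 2 * n * M3\<^sup>2 * (\<tau>\<^sup>2 * (w x)\<^sup>2)" unfolding Eeq by simp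
        moreover have "1 * (w x)\<^sup>2 \<le> \<tau>\<^sup>2 * (w x)\<^sup>2" using \<tau>1 by (intro mult_right_mono) auto
        moreover have "0 \<le> \<tau>\<^sup>2 * (w x)\<^sup>2" by simp
        moreover have "0 \<le> 2 * n * M3\<^sup>2 * W" using W0 by (simp add: n_def)
        ultimately show ?thesis using W0 by (simp only: D_def algebra_simps)
      qed
      then have "c * E x \<le> c * (D * (W + \<tau>\<^sup>2 * (w x)\<^sup>2))" using c by (intro mult_left_mono) auto
      then have "c / D * E x \<le> c * (W + \<tau>\<^sup>2 * (w x)\<^sup>2)"
        using D by (simp add: pos_divide_le_eq mult.commute mult.left_commute)
      then have "c / D * E x \<le> 2 * Q" using Q2 by simp
      then have "\<tau> * (c / D * E x) \<le> \<tau> * (2 * Q)" using \<tau>1 by (intro mult_left_mono) auto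
      then show ?thesis using G by (simp add: algebra_simps)
    qed
    have Zs: "(\<lambda>x. \<Sum>i\<in>Basis. pd i (Z i) x) integrable_on cbox A B"
      by (intro integrable_sum finite_Basis Zc)
    have I1: "(\<lambda>x. (c / D) * \<tau> * E x) integrable_on cbox A B"
      by (rule integrable_on_mult_right[OF Eint])
    have I2: "(\<lambda>x. 2 * \<tau> * (\<Sum>i\<in>Basis. pd i (Z i) x)) integrable_on cbox A B"
      by (rule integrable_on_mult_right[OF Zs])
    have "integral (cbox A B) (\<lambda>x. (c / D) * \<tau> * E x - 2 * \<tau> * (\<Sum>i\<in>Basis. pd i (Z i) x)) \<le> integral (cbox A B) G"
      by (rule integral_le[OF integrable_diff[OF I1 I2] Gint point])
    also have "integral (cbox A B) (\<lambda>x. (c / D) * \<tau> * E x - 2 * \<tau> * (\<Sum>i\<in>Basis. pd i (Z i) x))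
      = (c / D) * \<tau> * integral (cbox A B) E - 2 * \<tau> * (\<Sum>i\<in>Basis. integral (cbox A B) (pd i (Z i)))"
      unfolding integral_diff[OF I1 I2] integral_mult_right by (simp add: integral_sum Zc)
    finally have "(c / D) * \<tau> * integral (cbox A B) E \<le> integral (cbox A B) G" by (simp add: Zint)
    then have "\<tau> * integral (cbox A B) E \<le> (D / c) * integral (cbox A B) G"
      using c D by (simp add: field_simps)
    then show ?thesis by (simp only: E_def G_def)
  qed
  show ?thesis
    by (intro exI[of _ "D / c"] exI[of _ \<tau>\<^sub>0] conjI allI impI main) (use c D \<tau>\<^sub>0 in auto)
qed

end

lemma double_sum_factor:
  fixes p f g h :: "'i \<Rightarrow> real"
  shows "(\<Sum>i\<in>I. \<Sum>k\<in>J. p i * (c * f i * g k) * h k) = c * ((\<Sum>i\<in>I. p i * f i) * (\<Sum>k\<in>J. g k * h k))"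
  by (subst sum_product) (simp add: sum_distrib_left mult_ac)

context elliptic_op
begin

text \<open>For \<open>\<phi> = exp (\<kappa> \<psi>)\<close> and \<open>\<nu> = \<kappa>\<^sup>2 \<phi> \<bar>\<nabla>\<psi>\<bar>\<^sup>2\<close> the terms of highest order in \<open>\<kappa>\<close> are positive in both
  inequalities and dominate the others once \<open>\<kappa>\<close> is large.\<close>

lemma pseudoconvex_weight:
  fixes \<psi> :: "'e \<Rightarrow> real"
  assumes K: "compact K" "K \<subseteq> \<Omega>"
    and \<psi>: "\<And>k. Ck_on k \<Omega> \<psi>" and grad: "\<And>x. x \<in> K \<Longrightarrow> \<exists>i\<in>Basis. pd i \<psi> x \<noteq> 0"
  shows "\<exists>\<kappa>>0. \<exists>\<nu>. \<exists>c>0. (\<forall>k. Ck_on k \<Omega> \<nu>) \<and>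
    (\<forall>x\<in>K. \<forall>\<xi>. c * (\<Sum>i\<in>Basis. (\<xi> i)\<^sup>2) \<le> hess_form (\<lambda>x. exp (\<kappa> * \<psi> x)) x \<xi> + \<nu> x * a_form x \<xi>) \<and>
    (\<forall>x\<in>K. c \<le> grad_inner (\<lambda>x. exp (\<kappa> * \<psi> x)) (grad_inner (\<lambda>x. exp (\<kappa> * \<psi> x)) (\<lambda>x. exp (\<kappa> * \<psi> x))) x
        - \<nu> x * grad_inner (\<lambda>x. exp (\<kappa> * \<psi> x)) (\<lambda>x. exp (\<kappa> * \<psi> x)) x)"
proof -
  define m where "m = grad_inner \<psi> \<psi>"
  define Y where "Y = flux \<psi>"
  have cK: "continuous_on K f" if "Ck_on 0 \<Omega> f" for f :: "'e \<Rightarrow> real"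
    using that K(2) continuous_on_subset by fastforce
  have m: "Ck_on k \<Omega> m" for k unfolding m_def by (intro Ck_grad_inner \<psi>)
  have Y: "Ck_on k \<Omega> (Y i)" if "i \<in> Basis" for i k unfolding Y_def by (intro Ck_flux \<psi> that)
  have "\<exists>m\<^sub>0>0. \<forall>x\<in>K. m\<^sub>0 \<le> m x"
  proof (rule compact_pos_lower_bound)
    show "m x > 0" if "x \<in> K" for x
      unfolding m_def grad_inner_self a_form_def using that K grad by (intro a_pos) auto
  qed (intro K cK m)+
  then obtain m\<^sub>0 where m\<^sub>0: "m\<^sub>0 > 0" "\<And>x. x \<in> K \<Longrightarrow> m\<^sub>0 \<le> m x" by auto
  obtain a\<^sub>0 where a\<^sub>0: "a\<^sub>0 > 0" "\<And>x \<xi>. x \<in> K \<Longrightarrow> a\<^sub>0 * (\<Sum>i\<in>Basis. (\<xi> i)\<^sup>2) \<le> a_form x \<xi>"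
    using grad_inner_ellipticity[OF K] unfolding a_form_def by auto
  have "\<exists>M\<ge>0. \<forall>x\<in>K. \<bar>grad_inner \<psi> m x\<bar> \<le> M"
    by (intro compact_bound K cK Ck_grad_inner \<psi> m)
  then obtain M where M: "M \<ge> 0" "\<And>x. x \<in> K \<Longrightarrow> \<bar>grad_inner \<psi> m x\<bar> \<le> M" by auto
  \<comment> \<open>The coefficients of \<open>hess_form \<psi> x\<close> as a quadratic form in
    \<xi>. They may have any sign; their common bound \<open>H\<close> on \<open>K\<close> turns
    into a lower bound for the form.\<close>
  define h where "h = (\<lambda>(j, k) x. 2 * (\<Sum>i\<in>Basis. a i j x * pd i (Y k) x)
      - (\<Sum>l\<in>Basis. Y l x * pd l (a j k) x))"
  have "\<exists>H\<ge>0. \<forall>jk\<in>Basis \<times> Basis. \<forall>x\<in>K. \<bar>h jk x\<bar> \<le> H"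
  proof (intro compact_family_bound K cK)
    fix jk :: "'e \<times> 'e" assume "jk \<in> Basis \<times> Basis"
    then show "Ck_on 0 \<Omega> (h jk)" unfolding h_def
      by (auto intro!: Ck_on_diff Ck_on_mult Ck_on_sum open_\<Omega> Ck_on_pd Y a_smooth simp del: Ck_on.simps)
  qed auto
  then obtain H where H: "H \<ge> 0"
    "\<And>j k x. j \<in> Basis \<Longrightarrow> k \<in> Basis \<Longrightarrow> x \<in> K \<Longrightarrow> \<bar>h (j, k) x\<bar> \<le> H" by auto
  have hess\<psi>: "hess_form \<psi> x \<xi> = (\<Sum>j\<in>Basis. \<Sum>k\<in>Basis. h (j, k) x * \<xi> j * \<xi> k)" for x \<xi>
  proof -
    have "(\<Sum>i\<in>Basis. \<Sum>k\<in>Basis. (\<Sum>j\<in>Basis. a i j x * \<xi> j) * pd i (Y k) x * \<xi> k)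
      = (\<Sum>i\<in>Basis. \<Sum>k\<in>Basis. \<Sum>j\<in>Basis. a i j x * pd i (Y k) x * \<xi> j * \<xi> k)"
      by (simp add: sum_distrib_left sum_distrib_right algebra_simps)
    also have "\<dots> = (\<Sum>i\<in>Basis. \<Sum>j\<in>Basis. \<Sum>k\<in>Basis. a i j x * pd i (Y k) x * \<xi> j * \<xi> k)"
      by (intro sum.cong refl sum.swap)
    also have "\<dots> = (\<Sum>j\<in>Basis. \<Sum>i\<in>Basis. \<Sum>k\<in>Basis. a i j x * pd i (Y k) x * \<xi> j * \<xi> k)"
      by (rule sum.swap)
    also have "\<dots> = (\<Sum>j\<in>Basis. \<Sum>k\<in>Basis. \<Sum>i\<in>Basis. a i j x * pd i (Y k) x * \<xi> j * \<xi> k)"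
      by (intro sum.cong refl sum.swap)
    also have "\<dots> = (\<Sum>j\<in>Basis. \<Sum>k\<in>Basis. (\<Sum>i\<in>Basis. a i j x * pd i (Y k) x) * \<xi> j * \<xi> k)"
      by (simp add: sum_distrib_right)
    finally show ?thesis
      unfolding hess_form_def h_def Y_def[symmetric] prod.case
      by (simp only: left_diff_distrib sum_subtractf mult.assoc sum_distrib_left[symmetric])
  qed
  define n where "n = real DIM('e)"
  \<comment> \<open>The second summand makes \<open>\<kappa> * (m x)\<^sup>2\<close> exceed
    \<open>M\<close> by at least 1, for \<open>pc2\<close>; the third lets
    \<open>\<kappa> * m x * a_form x \<xi>\<close> beat the worst value of
    \<open>hess_form \<psi> x \<xi>\<close> by the squared length of \<xi>, for
    \<open>pc1\<close>.\<close>
  define \<kappa> where "\<kappa> = 1 + (M + 1) / m\<^sub>0\<^sup>2 + (H * n + 1) / (m\<^sub>0 * a\<^sub>0)"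
  have \<kappa>1: "\<kappa> \<ge> 1" and \<kappa>2: "\<kappa> \<ge> (M + 1) / m\<^sub>0\<^sup>2" and \<kappa>3: "\<kappa> \<ge> (H * n + 1) / (m\<^sub>0 * a\<^sub>0)"
    using m\<^sub>0 a\<^sub>0 M H by (simp_all add: \<kappa>_def n_def)
  define \<phi> where "\<phi> = (\<lambda>x. exp (\<kappa> * \<psi> x))"
  \<comment> \<open>The exponential adds to \<open>hess_form\<close> only a multiple of the square
    of \<open>\<Sum>k\<in>Basis. Y k x * \<xi> k\<close>, which vanishes for some directions \<xi>.
    Positivity in all directions therefore comes from \<open>\<nu>\<close>, which costs half of the
    leading term \<open>2 * \<kappa>^4 * (\<phi> x)^3 * (m x)\<^sup>2\<close> of the other
    inequality.\<close>
  define \<nu> where "\<nu> = (\<lambda>x. \<kappa>\<^sup>2 * \<phi> x * m x)"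
  have \<phi>: "Ck_on k \<Omega> \<phi>" for k
    unfolding \<phi>_def by (intro Ck_on_exp Ck_on_mult open_\<Omega> Ck_on_const \<psi>)
  have \<nu>: "Ck_on k \<Omega> \<nu>" for k
    unfolding \<nu>_def by (intro Ck_on_mult open_\<Omega> Ck_on_const \<phi> m)
  have \<phi>pos: "\<phi> x > 0" for x by (simp add: \<phi>_def)
  obtain e where e: "e > 0" "\<And>x. x \<in> K \<Longrightarrow> e \<le> \<phi> x"
    using compact_pos_lower_bound[OF K(1) cK[OF \<phi>]] \<phi>pos by blast
  have d: "f differentiable (at x)" if "\<And>k. Ck_on k \<Omega> f" "x \<in> \<Omega>" for f :: "'e \<Rightarrow> real" and x
    by (rule Ck_on_differentiable[OF that])
  have p\<phi>: "pd i \<phi> x = \<kappa> * \<phi> x * pd i \<psi> x" if "x \<in> \<Omega>" for i x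
  proof -
    have "pd i \<phi> x = exp (\<kappa> * \<psi> x) * pd i (\<lambda>x. \<kappa> * \<psi> x) x"
      unfolding \<phi>_def by (rule pd_exp) (simp add: d[OF \<psi> that])
    then show ?thesis by (simp add: pd_mult d[OF \<psi> that] \<phi>_def)
  qed
  have f\<phi>: "flux \<phi> k x = \<kappa> * \<phi> x * Y k x" if "x \<in> \<Omega>" for k x
    unfolding flux_def Y_def p\<phi>[OF that] by (simp add: sum_distrib_left algebra_simps)
  have g\<phi>: "grad_inner \<phi> f x = \<kappa> * \<phi> x * grad_inner \<psi> f x" if "x \<in> \<Omega>" for f x
    unfolding grad_inner_def f\<phi>[OF that] Y_def by (simp add: sum_distrib_left algebra_simps)
  have q: "grad_inner \<phi> \<phi> x = \<kappa>\<^sup>2 * (\<phi> x * \<phi> x) * m x" if "x \<in> \<Omega>" for x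
    unfolding g\<phi>[OF that] m_def unfolding grad_inner_def p\<phi>[OF that]
    by (simp add: sum_distrib_left algebra_simps power2_eq_square)
  have pq: "pd i (grad_inner \<phi> \<phi>) x = \<kappa>\<^sup>2 * (2 * \<kappa> * (\<phi> x)\<^sup>2 * m x * pd i \<psi> x + (\<phi> x)\<^sup>2 * pd i m x)"
    if x: "x \<in> \<Omega>" for i x
  proof -
    have "pd i (grad_inner \<phi> \<phi>) x = pd i (\<lambda>x. \<kappa>\<^sup>2 * (\<phi> x * \<phi> x) * m x) x"
      by (rule pd_cong_open[OF open_\<Omega> x q])
    also have "\<dots> = \<kappa>\<^sup>2 * (2 * \<kappa> * (\<phi> x)\<^sup>2 * m x * pd i \<psi> x + (\<phi> x)\<^sup>2 * pd i m x)"
      using x by (simp add: pd_mult d[OF \<phi>] d[OF m] p\<phi> algebra_simps power2_eq_square)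
    finally show ?thesis .
  qed
  have gq: "grad_inner \<phi> (grad_inner \<phi> \<phi>) x = \<kappa>^3 * (\<phi> x)^3 * (2 * \<kappa> * (m x)\<^sup>2 + grad_inner \<psi> m x)" if x: "x \<in> \<Omega>" for x
  proof -
    have "grad_inner \<psi> (grad_inner \<phi> \<phi>) x = \<kappa>\<^sup>2 * (\<phi> x)\<^sup>2 * (2 * \<kappa> * m x * grad_inner \<psi> \<psi> x + grad_inner \<psi> m x)"
      unfolding grad_inner_def[of \<psi> "grad_inner \<phi> \<phi>"] pq[OF x] grad_inner_def[of \<psi> \<psi>] grad_inner_def[of \<psi> m]
      by (simp add: sum_distrib_left sum.distrib algebra_simps)
    then show ?thesis unfolding g\<phi>[OF x] m_def[symmetric]
      by (simp add: power2_eq_square power3_eq_cube algebra_simps)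
  qed
  define c where "c = min (\<kappa> * e) (\<kappa>^3 * e^3)"
  have c: "c > 0" using \<kappa>1 e by (simp add: c_def)
  have pc2: "c \<le> grad_inner \<phi> (grad_inner \<phi> \<phi>) x - \<nu> x * grad_inner \<phi> \<phi> x" if x: "x \<in> K" for x
  proof -
    have x': "x \<in> \<Omega>" using x K by blast
    have eq: "grad_inner \<phi> (grad_inner \<phi> \<phi>) x - \<nu> x * grad_inner \<phi> \<phi> x = \<kappa>^3 * (\<phi> x)^3 * (\<kappa> * (m x)\<^sup>2 + grad_inner \<psi> m x)"
      unfolding gq[OF x'] q[OF x'] \<nu>_def
      by (simp add: algebra_simps power2_eq_square power3_eq_cube)
    have "M + 1 \<le> \<kappa> * m\<^sub>0\<^sup>2" using \<kappa>2 m\<^sub>0 by (simp add: field_simps)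
    also have "\<dots> \<le> \<kappa> * (m x)\<^sup>2"
      using \<kappa>1 m\<^sub>0 x by (intro mult_left_mono power_mono) auto
    finally have "1 \<le> \<kappa> * (m x)\<^sup>2 + grad_inner \<psi> m x" using M(2)[OF x] by linarith
    moreover have "\<kappa>^3 * e^3 \<le> \<kappa>^3 * (\<phi> x)^3"
      using \<kappa>1 e x by (intro mult_left_mono power_mono) auto
    ultimately have "\<kappa>^3 * e^3 * 1 \<le> \<kappa>^3 * (\<phi> x)^3 * (\<kappa> * (m x)\<^sup>2 + grad_inner \<psi> m x)"
      using \<kappa>1 e \<phi>pos[of x] by (intro mult_mono) auto
    then show ?thesis unfolding eq c_def by linarith
  qed
  have pc1: "c * (\<Sum>i\<in>Basis. (\<xi> i)\<^sup>2) \<le> hess_form \<phi> x \<xi> + \<nu> x * a_form x \<xi>" if x: "x \<in> K" for x \<xi>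
  proof -
    have x': "x \<in> \<Omega>" using x K by blast
    define N where "N = (\<Sum>i\<in>Basis. (\<xi> i)\<^sup>2)"
    define s where "s = (\<Sum>k\<in>Basis. Y k x * \<xi> k)"
    have N0: "N \<ge> 0" by (simp add: N_def sum_nonneg)
    have pf: "pd i (flux \<phi> k) x = \<kappa> * \<phi> x * pd i (Y k) x + \<kappa>\<^sup>2 * \<phi> x * pd i \<psi> x * Y k x"
      if k: "k \<in> Basis" for i k
    proof -
      have "pd i (flux \<phi> k) x = pd i (\<lambda>x. \<kappa> * \<phi> x * Y k x) x"
        by (rule pd_cong_open[OF open_\<Omega> x' f\<phi>])
      also have "\<dots> = \<kappa> * \<phi> x * pd i (Y k) x + \<kappa>\<^sup>2 * \<phi> x * pd i \<psi> x * Y k x"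
        using x' by (simp add: pd_mult d[OF \<phi>] d[OF Y[OF k]] p\<phi> algebra_simps power2_eq_square)
      finally show ?thesis .
    qed
    have sY: "(\<Sum>i\<in>Basis. (\<Sum>j\<in>Basis. a i j x * \<xi> j) * pd i \<psi> x) = s"
    proof -
      have "(\<Sum>i\<in>Basis. (\<Sum>j\<in>Basis. a i j x * \<xi> j) * pd i \<psi> x)
        = (\<Sum>i\<in>Basis. \<Sum>j\<in>Basis. a i j x * pd i \<psi> x * \<xi> j)"
        unfolding sum_distrib_right by (intro sum.cong refl) (simp add: algebra_simps)
      also have "\<dots> = (\<Sum>j\<in>Basis. \<Sum>i\<in>Basis. a i j x * pd i \<psi> x * \<xi> j)" by (rule sum.swap)
      also have "\<dots> = s"
        unfolding s_def Y_def flux_def sum_distrib_right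
        by (intro sum.cong refl) (simp add: a_sym[OF x'])
      finally show ?thesis .
    qed
    have "(\<Sum>i\<in>Basis. \<Sum>k\<in>Basis. (\<Sum>j\<in>Basis. a i j x * \<xi> j) * (\<kappa>\<^sup>2 * \<phi> x * pd i \<psi> x * Y k x) * \<xi> k)
      = \<kappa>\<^sup>2 * \<phi> x * ((\<Sum>i\<in>Basis. (\<Sum>j\<in>Basis. a i j x * \<xi> j) * pd i \<psi> x) * s)"
      unfolding s_def by (rule double_sum_factor)
    then have ss: "(\<Sum>i\<in>Basis. \<Sum>k\<in>Basis. (\<Sum>j\<in>Basis. a i j x * \<xi> j) * (\<kappa>\<^sup>2 * \<phi> x * pd i \<psi> x * Y k x) * \<xi> k)
      = \<kappa>\<^sup>2 * \<phi> x * s\<^sup>2" by (simp only: sY power2_eq_square)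
    have "(\<Sum>i\<in>Basis. \<Sum>k\<in>Basis. (\<Sum>j\<in>Basis. a i j x * \<xi> j) * pd i (flux \<phi> k) x * \<xi> k)
      = (\<Sum>i\<in>Basis. \<Sum>k\<in>Basis. \<kappa> * \<phi> x * ((\<Sum>j\<in>Basis. a i j x * \<xi> j) * pd i (Y k) x * \<xi> k)
         + (\<Sum>j\<in>Basis. a i j x * \<xi> j) * (\<kappa>\<^sup>2 * \<phi> x * pd i \<psi> x * Y k x) * \<xi> k)"
      by (intro sum.cong refl) (simp add: pf algebra_simps)
    also have "\<dots> = \<kappa> * \<phi> x * (\<Sum>i\<in>Basis. \<Sum>k\<in>Basis. (\<Sum>j\<in>Basis. a i j x * \<xi> j) * pd i (Y k) x * \<xi> k)
       + \<kappa>\<^sup>2 * \<phi> x * s\<^sup>2"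
      by (simp only: sum.distrib sum_distrib_left[symmetric] ss)
    finally have h1: "(\<Sum>i\<in>Basis. \<Sum>k\<in>Basis. (\<Sum>j\<in>Basis. a i j x * \<xi> j) * pd i (flux \<phi> k) x * \<xi> k)
      = \<kappa> * \<phi> x * (\<Sum>i\<in>Basis. \<Sum>k\<in>Basis. (\<Sum>j\<in>Basis. a i j x * \<xi> j) * pd i (Y k) x * \<xi> k)
       + \<kappa>\<^sup>2 * \<phi> x * s\<^sup>2" .
    have h2: "(\<Sum>i\<in>Basis. \<Sum>j\<in>Basis. (\<Sum>k\<in>Basis. flux \<phi> k x * pd k (a i j) x) * \<xi> i * \<xi> j)
      = \<kappa> * \<phi> x * (\<Sum>i\<in>Basis. \<Sum>j\<in>Basis. (\<Sum>k\<in>Basis. Y k x * pd k (a i j) x) * \<xi> i * \<xi> j)"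
      unfolding f\<phi>[OF x'] by (simp add: sum_distrib_left sum_distrib_right mult.assoc)
    have hess: "hess_form \<phi> x \<xi> = \<kappa> * \<phi> x * hess_form \<psi> x \<xi> + 2 * \<kappa>\<^sup>2 * \<phi> x * s\<^sup>2"
      unfolding hess_form_def h1 h2 Y_def[symmetric] by (simp add: algebra_simps)
    have "\<bar>hess_form \<psi> x \<xi>\<bar> \<le> H * n * N"
      unfolding hess\<psi> n_def N_def
      by (rule quadratic_form_bound) (use H x in auto)
    then have A: "- (H * n * N) \<le> hess_form \<psi> x \<xi>" by linarith
    have B: "m\<^sub>0 * (a\<^sub>0 * N) \<le> m x * a_form x \<xi>"
    proof (rule mult_mono)
      show "m\<^sub>0 \<le> m x" by (rule m\<^sub>0(2)[OF x])
      then show "0 \<le> m x" using m\<^sub>0(1) by linarith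
      show "a\<^sub>0 * N \<le> a_form x \<xi>" unfolding N_def by (rule a\<^sub>0(2)[OF x])
      show "0 \<le> a\<^sub>0 * N" using a\<^sub>0(1) N0 by simp
    qed
    have "(H * n + 1) * N \<le> \<kappa> * (m\<^sub>0 * a\<^sub>0) * N"
      using \<kappa>3 m\<^sub>0 a\<^sub>0 N0 by (intro mult_right_mono) (auto simp: pos_divide_le_eq)
    also have "\<dots> \<le> \<kappa> * (m x * a_form x \<xi>)"
      using mult_left_mono[OF B, of \<kappa>] \<kappa>1 by (simp add: mult.assoc)
    finally have "N \<le> hess_form \<psi> x \<xi> + \<kappa> * (m x * a_form x \<xi>)" using A by (simp add: algebra_simps)
    then have "\<kappa> * \<phi> x * N \<le> \<kappa> * \<phi> x * (hess_form \<psi> x \<xi> + \<kappa> * (m x * a_form x \<xi>))"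
      using \<kappa>1 \<phi>pos[of x] by (intro mult_left_mono) auto
    also have "\<dots> \<le> hess_form \<phi> x \<xi> + \<nu> x * a_form x \<xi>"
    proof -
      have "hess_form \<phi> x \<xi> + \<nu> x * a_form x \<xi>
        = \<kappa> * \<phi> x * (hess_form \<psi> x \<xi> + \<kappa> * (m x * a_form x \<xi>)) + 2 * \<kappa>\<^sup>2 * \<phi> x * s\<^sup>2"
        unfolding hess \<nu>_def by (simp add: algebra_simps power2_eq_square)
      moreover have "0 \<le> 2 * \<kappa>\<^sup>2 * \<phi> x * s\<^sup>2" using \<phi>pos[of x] by simp
      ultimately show ?thesis by linarith
    qed
    finally have 1: "\<kappa> * \<phi> x * N \<le> hess_form \<phi> x \<xi> + \<nu> x * a_form x \<xi>" .
    have "\<kappa> * e \<le> \<kappa> * \<phi> x" using e(2)[OF x] \<kappa>1 by (intro mult_left_mono) auto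
    then have "c \<le> \<kappa> * \<phi> x" unfolding c_def by linarith
    then have "c * N \<le> \<kappa> * \<phi> x * N" using N0 by (rule mult_right_mono)
    then show ?thesis using 1 unfolding N_def by linarith
  qed
  have "\<kappa> > 0" using \<kappa>1 by simp
  then show ?thesis using c \<nu> pc1 pc2 unfolding \<phi>_def by blast
qed

end

section \<open>Unique continuation for second order systems\<close>

text \<open>Cauchy-Schwarz, once over the derivatives and once over the components: it converts the
  sum of absolute values in a differential inequality into the quadratic integrand of the Carleman
  estimate.\<close>

lemma sum_abs_power2_le:
  fixes p :: "'s \<Rightarrow> real" and q :: "'i \<Rightarrow> 's \<Rightarrow> real"
  assumes "finite I" "finite J"
  shows "(\<Sum>t\<in>I. \<bar>p t\<bar> + (\<Sum>i\<in>J. \<bar>q i t\<bar>))\<^sup>2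
    \<le> 2 * (real (card J) + 1) * real (card I) * (\<Sum>t\<in>I. (p t)\<^sup>2 + (\<Sum>i\<in>J. (q i t)\<^sup>2))"
proof -
  have "(\<bar>p t\<bar> + (\<Sum>i\<in>J. \<bar>q i t\<bar>))\<^sup>2 \<le> 2 * (real (card J) + 1) * ((p t)\<^sup>2 + (\<Sum>i\<in>J. (q i t)\<^sup>2))" for t
  proof -
    define S where "S = (\<Sum>i\<in>J. (q i t)\<^sup>2)"
    have S0: "S \<ge> 0" by (simp add: S_def sum_nonneg)
    have "(\<bar>p t\<bar> + (\<Sum>i\<in>J. \<bar>q i t\<bar>))\<^sup>2 \<le> 2 * (p t)\<^sup>2 + 2 * (\<Sum>i\<in>J. \<bar>q i t\<bar>)\<^sup>2"
      using zero_le_power2[of "\<bar>p t\<bar> - (\<Sum>i\<in>J. \<bar>q i t\<bar>)"] by (simp add: power2_eq_square algebra_simps)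
    also have "(\<Sum>i\<in>J. \<bar>q i t\<bar>)\<^sup>2 \<le> S * card J"
      unfolding S_def using sum_squared_le_sum_of_squares[of "\<lambda>i. \<bar>q i t\<bar>" J] by simp
    finally have "(\<bar>p t\<bar> + (\<Sum>i\<in>J. \<bar>q i t\<bar>))\<^sup>2 \<le> 2 * (p t)\<^sup>2 + 2 * (S * card J)" by simp
    moreover have "0 \<le> card J * (p t)\<^sup>2" by simp
    moreover have "2 * (real (card J) + 1) * ((p t)\<^sup>2 + S)
        = 2 * (p t)\<^sup>2 + 2 * (S * card J) + 2 * (card J * (p t)\<^sup>2) + 2 * S"
      by (simp add: algebra_simps)
    ultimately show ?thesis using S0 unfolding S_def[symmetric] by linarith
  qed
  then have "(\<Sum>t\<in>I. (\<bar>p t\<bar> + (\<Sum>i\<in>J. \<bar>q i t\<bar>))\<^sup>2) \<le> (\<Sum>t\<in>I. 2 * (real (card J) + 1) * ((p t)\<^sup>2 + (\<Sum>i\<in>J. (q i t)\<^sup>2)))"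
    by (rule sum_mono)
  then have "(\<Sum>t\<in>I. (\<bar>p t\<bar> + (\<Sum>i\<in>J. \<bar>q i t\<bar>))\<^sup>2) * card I
     \<le> (\<Sum>t\<in>I. 2 * (real (card J) + 1) * ((p t)\<^sup>2 + (\<Sum>i\<in>J. (q i t)\<^sup>2))) * card I"
    by (rule mult_right_mono) simp
  moreover have "(\<Sum>t\<in>I. 2 * (real (card J) + 1) * ((p t)\<^sup>2 + (\<Sum>i\<in>J. (q i t)\<^sup>2))) * card I
     = 2 * (real (card J) + 1) * real (card I) * (\<Sum>t\<in>I. (p t)\<^sup>2 + (\<Sum>i\<in>J. (q i t)\<^sup>2))"
    unfolding sum_distrib_left[symmetric] by (simp only: mult_ac)
  ultimately show ?thesis
    using sum_squared_le_sum_of_squares[of "\<lambda>t. \<bar>p t\<bar> + (\<Sum>i\<in>J. \<bar>q i t\<bar>)" I]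
    by linarith
qed

lemma exp_growth_contradiction:
  fixes e D d :: real
  assumes "e > 0" "d > 0" "\<And>\<tau>. \<tau> \<ge> T \<Longrightarrow> e * exp (2 * \<tau> * d) \<le> D"
  shows False
proof -
  define \<tau> where "\<tau> = max T (D / (2 * e * d))"
  have "D / (2 * e * d) \<le> \<tau>" by (simp add: \<tau>_def)
  then have "D \<le> 2 * \<tau> * d * e" using assms(1,2) by (simp add: pos_divide_le_eq mult_ac)
  also have "\<dots> < exp (2 * \<tau> * d) * e"
    using exp_ge_add_one_self[of "2 * \<tau> * d"] assms(1) by (intro mult_strict_right_mono) linarith+
  also have "\<dots> = e * exp (2 * \<tau> * d)" by (rule mult.commute)
  also have "\<dots> \<le> D" by (rule assms(3)) (simp add: \<tau>_def)
  finally show False by simp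
qed

text \<open>The truncated cube \<open>k\<close> is used twice: \<open>k (\<rho> x)\<close> vanishes
  up to radius \<open>R1\<close> and is at least 1 from \<open>R2\<close> on, so \<open>k\<close>
  applied to \<open>1 - k (\<rho> x)\<close> is 1 in the first region and 0 in the second.\<close>

lemma radial_cutoff:
  fixes x0 :: "'a::euclidean_space"
  assumes "0 < R1" "R1 < R2"
  obtains \<eta> :: "'a \<Rightarrow> real" where "Ck_on 2 UNIV \<eta>" "\<And>x. dist x0 x \<le> R1 \<Longrightarrow> \<eta> x = 1"
    "\<And>x. dist x0 x \<ge> R2 \<Longrightarrow> \<eta> x = 0"
proof
  define k where "k s = max 0 s ^ Suc 2" for s :: real
  define \<rho> where "\<rho> x = ((x - x0) \<bullet> (x - x0) - R1\<^sup>2) * inverse (R2\<^sup>2 - R1\<^sup>2)" for x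
  define \<eta> where "\<eta> x = k (1 - k (\<rho> x))" for x
  have k: "Ck_on 2 UNIV k" unfolding k_def by (rule Ck_on_pos_part_power)
  have \<rho>: "Ck_on 2 UNIV \<rho>"
    unfolding \<rho>_def by (intro Ck_on_mult Ck_on_diff Ck_on_inner) auto
  have k\<rho>: "Ck_on 2 UNIV (\<lambda>x. 1 - k (\<rho> x))"
    by (intro Ck_on_diff Ck_on_const Ck_on_compose[OF open_UNIV open_UNIV \<rho> k]) auto
  show "Ck_on 2 UNIV \<eta>"
    unfolding \<eta>_def by (rule Ck_on_compose[OF open_UNIV open_UNIV k\<rho> k]) auto
  have pos: "R2\<^sup>2 - R1\<^sup>2 > 0" using assms by (simp add: power_strict_mono)
  have dd: "(x - x0) \<bullet> (x - x0) = (dist x0 x)\<^sup>2" for x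
    by (simp add: dist_norm power2_norm_eq_inner[symmetric] norm_minus_commute)
  show "\<eta> x = 1" if "dist x0 x \<le> R1" for x
  proof -
    have "(dist x0 x)\<^sup>2 \<le> R1\<^sup>2" using that by (simp add: power_mono)
    then have "\<rho> x \<le> 0" unfolding \<rho>_def dd using pos by (simp add: mult_nonpos_nonneg)
    then show ?thesis by (simp add: \<eta>_def k_def max_def)
  qed
  show "\<eta> x = 0" if "dist x0 x \<ge> R2" for x
  proof -
    have "R2\<^sup>2 \<le> (dist x0 x)\<^sup>2" using that assms by (simp add: power_mono)
    then have "1 \<le> \<rho> x" unfolding \<rho>_def dd using pos by (simp add: field_simps)
    then have "1 \<le> k (\<rho> x)" by (simp add: k_def max_def one_le_power del: power_Suc)
    then show ?thesis by (simp add: \<eta>_def k_def max_def)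
  qed
qed

section \<open>Unique continuation on balls\<close>

context elliptic_op
begin

lemma div_op_expand:
  assumes "x \<in> \<Omega>" "Ck_on 2 \<Omega> f"
  shows "div_op f x = (\<Sum>i\<in>Basis. \<Sum>j\<in>Basis. a i j x * pd i (pd j f) x)
    + (\<Sum>i\<in>Basis. \<Sum>j\<in>Basis. pd i (a i j) x * pd j f x)"
proof -
  have f: "Ck_on (Suc (Suc 0)) \<Omega> f" using assms(2) by (simp add: numeral_2_eq_2)
  have "pd j f differentiable (at x)" for j
    by (rule Ck_on_differentiable[OF Ck_on_pd[OF f] assms(1)])
  moreover have "a i j differentiable (at x)" if "i \<in> Basis" "j \<in> Basis" for i j
    by (rule Ck_on_differentiable[OF a_smooth[OF that] assms(1)])
  ultimately have "pd i (flux f i) x = (\<Sum>j\<in>Basis. a i j x * pd i (pd j f) x + pd i (a i j) x * pd j f x)"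
    if "i \<in> Basis" for i
    unfolding flux_def[abs_def] using that by (subst pd_sum) (simp_all add: pd_mult)
  then show ?thesis by (simp add: div_op_def sum.distrib)
qed

text \<open>The Carleman estimate is applied to cut-off solutions. Where the cut-off is 1 the
  inequality lets \<tau> absorb the right-hand side; where it varies only a bound is known, but
  there the weight is at most \<open>\<phi>1\<close>, which is less than its value at
  \<open>x1\<close>. The two growth rates in \<tau> contradict each other.\<close>

theorem unique_continuation_ball:
  fixes u :: "'s \<Rightarrow> 'e \<Rightarrow> real"
  assumes \<Omega>: "\<Omega> = ball x0 R" and I: "finite I" and r: "0 < r"
    and u: "\<And>s. s \<in> I \<Longrightarrow> Ck_on 2 \<Omega> (u s)"
    and ineq: "\<And>x s. x \<in> \<Omega> \<Longrightarrow> s \<in> I \<Longrightarrow>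
      \<bar>\<Sum>i\<in>Basis. \<Sum>j\<in>Basis. a i j x * pd i (pd j (u s)) x\<bar>
        \<le> C * (\<Sum>t\<in>I. \<bar>u t x\<bar> + (\<Sum>i\<in>Basis. \<bar>pd i (u t) x\<bar>))"
    and zero: "\<And>x s. x \<in> ball x0 r \<Longrightarrow> s \<in> I \<Longrightarrow> u s x = 0"
    and x1: "x1 \<in> \<Omega>" and s1: "s1 \<in> I"
  shows "u s1 x1 = 0"
proof (rule ccontr)
  assume nz: "u s1 x1 \<noteq> 0"
  have r1: "r \<le> dist x0 x1" using nz zero s1 by (meson leI mem_ball)
  have d1: "dist x0 x1 < R" using x1 \<Omega> by simp
  \<comment> \<open>\<open>R1\<close> and \<open>R2\<close> divide the gap between the distance of
    \<open>x1\<close> and \<open>R\<close> into thirds, so the cut-off varies strictly outside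
    \<open>x1\<close> and strictly inside the domain.\<close>
  define R1 where "R1 = (2 * dist x0 x1 + R) / 3"
  define R2 where "R2 = (dist x0 x1 + 2 * R) / 3"
  have R: "dist x0 x1 < R1" "R1 < R2" "R2 < R" "0 < R1" using d1 r r1 by (auto simp: R1_def R2_def)
  obtain \<eta> :: "'e \<Rightarrow> real" where \<eta>: "Ck_on 2 UNIV \<eta>" "\<And>x. dist x0 x \<le> R1 \<Longrightarrow> \<eta> x = 1"
    "\<And>x. dist x0 x \<ge> R2 \<Longrightarrow> \<eta> x = 0" using radial_cutoff[OF R(4,2)] by metis
  \<comment> \<open>The annulus carries all cut-off solutions: they vanish in the inner ball by
    \<open>zero\<close> and outside by the cut-off. It excludes \<open>x0\<close>, the only point
    where the gradient of \<open>\<psi>\<close> vanishes.\<close>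
  define K where "K = cball x0 R2 - ball x0 r"
  have K: "compact K" "K \<subseteq> \<Omega>" unfolding K_def \<Omega> using R
    by (auto intro: compact_diff)
  have oK: "open (- K)" using K(1) compact_imp_closed by blast
  define v where "v s x = \<eta> x * u s x" for s x
  have v\<Omega>: "Ck_on 2 \<Omega> (v s)" if "s \<in> I" for s
    unfolding v_def by (intro Ck_on_mult open_\<Omega> u that Ck_on_subset[OF \<eta>(1)]) simp
  have v0: "v s x = 0" if "s \<in> I" "x \<notin> K" for s x
    using that \<eta>(3)[of x] zero[of x s] by (auto simp: v_def K_def)
  have v: "Ck_on 2 UNIV (v s)" if "s \<in> I" for s
    by (rule Ck_on_UNIV_extension[OF v\<Omega>[OF that] K v0[OF that]])
  have veq: "v s x = u s x" if "x \<in> ball x0 R1" for s x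
    using that \<eta>(2)[of x] by (simp add: v_def)
  define \<psi> :: "'e \<Rightarrow> real" where "\<psi> x = - ((x - x0) \<bullet> (x - x0))" for x
  have \<psi>dist: "\<psi> x = - (dist x0 x)\<^sup>2" for x
    by (simp add: \<psi>_def dist_norm power2_norm_eq_inner[symmetric] norm_minus_commute)
  have \<psi>: "Ck_on k S \<psi>" if "open S" for k S
    unfolding \<psi>_def by (intro Ck_on_minus Ck_on_inner Ck_on_diff that) auto
  have grad: "\<exists>i\<in>Basis. pd i \<psi> x \<noteq> 0" if "x \<in> K" for x
  proof -
    have "x - x0 \<noteq> 0" using that r by (auto simp: K_def)
    then obtain i where i: "i \<in> Basis" "(x - x0) \<bullet> i \<noteq> 0" using euclidean_all_zero_iff by blast
    have "(\<psi> has_derivative (\<lambda>h. - ((x - x0) \<bullet> h + h \<bullet> (x - x0)))) (at x)"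
      unfolding \<psi>_def by (auto intro!: derivative_eq_intros)
    then have "pd i \<psi> x = - ((x - x0) \<bullet> i + i \<bullet> (x - x0))" by (rule pd_eqI)
    then show ?thesis using i by (intro bexI[of _ i]) (auto simp: inner_commute)
  qed
  obtain \<kappa> \<nu> c where w: "\<kappa> > 0" "c > 0" "\<And>k. Ck_on k \<Omega> \<nu>"
    "\<And>x \<xi>. x \<in> K \<Longrightarrow> c * (\<Sum>i\<in>Basis. (\<xi> i)\<^sup>2) \<le> hess_form (\<lambda>x. exp (\<kappa> * \<psi> x)) x \<xi> + \<nu> x * a_form x \<xi>"
    "\<And>x. x \<in> K \<Longrightarrow> c \<le> grad_inner (\<lambda>x. exp (\<kappa> * \<psi> x)) (grad_inner (\<lambda>x. exp (\<kappa> * \<psi> x)) (\<lambda>x. exp (\<kappa> * \<psi> x))) x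
        - \<nu> x * grad_inner (\<lambda>x. exp (\<kappa> * \<psi> x)) (\<lambda>x. exp (\<kappa> * \<psi> x)) x"
    using pseudoconvex_weight[OF K \<psi>[OF open_\<Omega>] grad] by blast
  define \<phi> where "\<phi> = (\<lambda>x. exp (\<kappa> * \<psi> x))"
  have \<phi>: "Ck_on k S \<phi>" if "open S" for k S
    unfolding \<phi>_def by (intro Ck_on_exp Ck_on_mult that Ck_on_const \<psi>)
  \<comment> \<open>The value of the weight on the sphere of radius \<open>R1\<close>, which
    separates \<open>x1\<close> from the region where the cut-off varies.\<close>
  define \<phi>1 where "\<phi>1 = exp (\<kappa> * - R1\<^sup>2)"
  have \<phi>_out: "\<phi> x \<le> \<phi>1" if "x \<notin> ball x0 R1" for x
    using that R(4) w(1) by (auto simp: \<phi>_def \<phi>1_def \<psi>dist power_mono)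
  have \<phi>_in: "\<phi> x1 > \<phi>1"
    using R w(1) by (auto simp: \<phi>_def \<phi>1_def \<psi>dist power_strict_mono)
  obtain C0 \<tau>0 where C0: "C0 > 0" and \<tau>0: "\<tau>0 > 0" and carl: "\<And>\<tau> u A B. \<tau> \<ge> \<tau>0 \<Longrightarrow>
     Ck_on 2 UNIV u \<Longrightarrow> (\<And>x. x \<notin> K \<Longrightarrow> u x = 0) \<Longrightarrow> K \<subseteq> box A B \<Longrightarrow>
    \<tau> * integral (cbox A B) (\<lambda>x. exp (2 * \<tau> * \<phi> x) * ((u x)\<^sup>2 + (\<Sum>i\<in>Basis. (pd i u x)\<^sup>2)))
      \<le> C0 * integral (cbox A B) (\<lambda>x. exp (2 * \<tau> * \<phi> x) * (div_op u x)\<^sup>2)"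
    using carleman_weighted[OF K \<phi>[OF open_\<Omega>] w(3) w(2) w(4,5)[folded \<phi>_def]] by blast
  have cK: "continuous_on K f" if "Ck_on 0 \<Omega> f" for f :: "'e \<Rightarrow> real"
    using that K(2) continuous_on_subset by fastforce
  define n where "n = real DIM('e)"
  obtain M where M: "M \<ge> 0" "\<And>i j x. i \<in> Basis \<Longrightarrow> j \<in> Basis \<Longrightarrow> x \<in> K \<Longrightarrow> \<bar>pd i (a i j) x\<bar> \<le> M"
  proof -
    have "\<exists>M\<ge>0. \<forall>ij\<in>Basis \<times> Basis. \<forall>x\<in>K. \<bar>(case ij of (i, j) \<Rightarrow> pd i (a i j)) x\<bar> \<le> M"
      by (intro compact_family_bound K cK) (auto intro!: Ck_on_pd a_smooth simp del: Ck_on.simps)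
    then show ?thesis using that by auto
  qed
  have vS: "Ck_on (Suc (Suc 0)) \<Omega> (v s)" if "s \<in> I" for s
    using v\<Omega>[OF that] by (simp add: numeral_2_eq_2)
  \<comment> \<open>No differential inequality is available where the cut-off varies; a bound
    independent of \<tau> replaces it.\<close>
  obtain M5 where M5: "M5 \<ge> 0" "\<And>s x. s \<in> I \<Longrightarrow> x \<in> K \<Longrightarrow> \<bar>(div_op (v s) x)\<^sup>2\<bar> \<le> M5"
  proof -
    have "\<exists>M\<ge>0. \<forall>s\<in>I. \<forall>x\<in>K. \<bar>(div_op (v s) x)\<^sup>2\<bar> \<le> M"
      by (intro compact_family_bound I K cK Ck_on_power Ck_div_op open_\<Omega> vS)
    then show ?thesis using that by auto
  qed
  have pdv0: "pd i (v s) x = 0" if "s \<in> I" "x \<notin> K" for i s x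
    using pd_cong_open[OF oK, of x "v s" "\<lambda>_. 0" i] v0[OF that(1)] that(2) by simp
  have divv0: "div_op (v s) x = 0" if "s \<in> I" "x \<notin> K" for s x
  proof -
    have "flux (v s) i y = 0" if "y \<notin> K" for i y by (simp add: flux_def pdv0 \<open>s \<in> I\<close> that)
    then have "pd i (flux (v s) i) x = 0" for i
      using pd_cong_open[OF oK, of x "flux (v s) i" "\<lambda>_. 0"] that(2) by simp
    then show ?thesis by (simp add: div_op_def)
  qed
  define V where "V x = (\<Sum>t\<in>I. (v t x)\<^sup>2 + (\<Sum>i\<in>Basis. (pd i (v t) x)\<^sup>2))" for x
  have V0: "V x \<ge> 0" for x unfolding V_def by (intro sum_nonneg add_nonneg_nonneg) auto
  define C' where "C' = \<bar>C\<bar> + M * n"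
  define C2 where "C2 = C'\<^sup>2 * (2 * (n + 1) * card I)"
  have C2: "C2 \<ge> 0" by (simp add: C2_def n_def)
  \<comment> \<open>Here \<open>v\<close> and \<open>u\<close> agree near \<open>x\<close>. The
    passage to divergence form adds the first derivatives of the coefficients, which is why
    \<open>C'\<close> contains \<open>M * n\<close>.\<close>
  have inside: "(div_op (v s) x)\<^sup>2 \<le> C2 * V x" if s: "s \<in> I" and x: "x \<in> K" "x \<in> ball x0 R1" for s x
  proof -
    define L where "L = (\<Sum>t\<in>I. \<bar>v t x\<bar> + (\<Sum>i\<in>Basis. \<bar>pd i (v t) x\<bar>))"
    have x\<Omega>: "x \<in> \<Omega>" using x K by blast
    have pv: "pd i (v t) y = pd i (u t) y" if "y \<in> ball x0 R1" for i t y
      by (rule pd_cong_open[OF open_ball that veq])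
    have ppv: "pd i (pd j (v t)) x = pd i (pd j (u t)) x" for i j t
      by (rule pd_cong_open[OF open_ball x(2) pv])
    have L0: "L \<ge> 0" unfolding L_def by (intro sum_nonneg add_nonneg_nonneg) auto
    have "\<bar>\<Sum>i\<in>Basis. \<Sum>j\<in>Basis. a i j x * pd i (pd j (v s)) x\<bar> \<le> C * L"
      unfolding L_def ppv veq[OF x(2)] pv[OF x(2)] by (rule ineq[OF x\<Omega> s])
    also have "\<dots> \<le> \<bar>C\<bar> * L" using L0 by (intro mult_right_mono) auto
    finally have 1: "\<bar>\<Sum>i\<in>Basis. \<Sum>j\<in>Basis. a i j x * pd i (pd j (v s)) x\<bar> \<le> \<bar>C\<bar> * L" .
    have pL: "\<bar>v s x\<bar> + (\<Sum>i\<in>Basis. \<bar>pd i (v s) x\<bar>) \<le> L"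
      unfolding L_def by (rule member_le_sum[OF s _ I]) (auto intro!: add_nonneg_nonneg sum_nonneg)
    have "\<bar>\<Sum>i\<in>Basis. \<Sum>j\<in>Basis. pd i (a i j) x * pd j (v s) x\<bar>
      \<le> (\<Sum>i\<in>Basis. \<Sum>j\<in>Basis. \<bar>pd i (a i j) x * pd j (v s) x\<bar>)"
      by (rule order_trans[OF sum_abs]) (intro sum_mono sum_abs)
    also have "\<dots> \<le> (\<Sum>i\<in>(Basis::'e set). \<Sum>j\<in>Basis. M * \<bar>pd j (v s) x\<bar>)"
      unfolding abs_mult by (intro sum_mono mult_right_mono M x) auto
    also have "\<dots> = M * n * (\<Sum>j\<in>Basis. \<bar>pd j (v s) x\<bar>)"
      by (simp add: n_def sum_distrib_left[symmetric])
    also have "\<dots> \<le> M * n * L" using pL M by (intro mult_left_mono) (auto simp: n_def)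
    finally have "\<bar>div_op (v s) x\<bar> \<le> C' * L"
      unfolding div_op_expand[OF x\<Omega> v\<Omega>[OF s]] C'_def distrib_right using 1 by linarith
    then have "(div_op (v s) x)\<^sup>2 \<le> (C' * L)\<^sup>2" by (meson abs_ge_self abs_le_square_iff order_trans)
    also have "\<dots> \<le> C'\<^sup>2 * (2 * (n + 1) * card I * V x)"
      unfolding power_mult_distrib L_def V_def n_def
      by (intro mult_left_mono sum_abs_power2_le[OF I finite_Basis]) auto
    finally show ?thesis by (simp add: C2_def mult.assoc)
  qed
  obtain A where A: "K \<subseteq> box (- A) A"
    using bounded_subset_box_symmetric[OF compact_imp_bounded[OF K(1)]] by metis
  define Q where "Q = cbox (- A) A"
  define W where "W = measure lborel Q"
  have W0: "W \<ge> 0" by (simp add: W_def)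
  define E where "E \<tau> s x = exp (2 * \<tau> * \<phi> x) * ((v s x)\<^sup>2 + (\<Sum>i\<in>Basis. (pd i (v s) x)\<^sup>2))" for \<tau> s x
  define G where "G \<tau> s x = exp (2 * \<tau> * \<phi> x) * (div_op (v s) x)\<^sup>2" for \<tau> s x
  have E0: "E \<tau> s x \<ge> 0" for \<tau> s x
    unfolding E_def by (intro mult_nonneg_nonneg add_nonneg_nonneg sum_nonneg) auto
  have int: "f integrable_on Q" if "Ck_on 0 \<Omega> f" "\<And>x. x \<notin> K \<Longrightarrow> f x = 0" for f :: "'e \<Rightarrow> real"
    unfolding Q_def
  proof (rule integrable_continuous)
    have "continuous_on UNIV f" using Ck_on_UNIV_extension[OF that(1) K that(2)] by simp
    then show "continuous_on (cbox (- A) A) f" by (rule continuous_on_subset) simp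
  qed
  have Eint: "E \<tau> s integrable_on Q" if "s \<in> I" for \<tau> s
    unfolding E_def
    by (intro int Ck_on_mult Ck_on_add Ck_on_sum Ck_on_power Ck_on_exp open_\<Omega> Ck_on_const \<phi>
        Ck_on_pd Ck_on_mono[OF v\<Omega>[OF that]]) (auto simp: v0 pdv0 that)
  have Gint: "G \<tau> s integrable_on Q" if "s \<in> I" for \<tau> s
    unfolding G_def
    by (intro int Ck_on_mult Ck_on_power Ck_on_exp open_\<Omega> Ck_on_const \<phi> Ck_div_op vS that) (auto simp: divv0 that)
  \<comment> \<open>The inequality couples the components, so their energies can be absorbed only
    all at once.\<close>
  define S where "S \<tau> = (\<Sum>t\<in>I. integral Q (E \<tau> t))" for \<tau>
  have ES: "integral Q (E \<tau> s) \<le> S \<tau>" if "s \<in> I" for \<tau> s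
    unfolding S_def by (rule member_le_sum[OF that _ I]) (auto intro!: integral_nonneg Eint E0)
  have S0: "S \<tau> \<ge> 0" for \<tau> unfolding S_def by (auto intro!: sum_nonneg integral_nonneg Eint E0)
  have Gle: "integral Q (G \<tau> s) \<le> C2 * S \<tau> + exp (2 * \<tau> * \<phi>1) * M5 * W" if s: "s \<in> I" and \<tau>: "\<tau> > 0" for \<tau> s
  proof -
    have point: "G \<tau> s x \<le> C2 * (\<Sum>t\<in>I. E \<tau> t x) + exp (2 * \<tau> * \<phi>1) * M5" for x
    proof -
      have EV: "(\<Sum>t\<in>I. E \<tau> t x) = exp (2 * \<tau> * \<phi> x) * V x"
        by (simp add: E_def V_def sum_distrib_left)
      have nn: "0 \<le> exp (2 * \<tau> * \<phi>1) * M5" "0 \<le> C2 * (\<Sum>t\<in>I. E \<tau> t x)"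
        using M5 C2 by (auto intro!: mult_nonneg_nonneg sum_nonneg E0)
      consider "x \<notin> K" | "x \<in> K" "x \<in> ball x0 R1" | "x \<in> K" "x \<notin> ball x0 R1" by blast
      then show ?thesis
      proof cases
        case 1
        then show ?thesis using nn by (simp add: G_def divv0 s)
      next
        case 2
        have "G \<tau> s x \<le> exp (2 * \<tau> * \<phi> x) * (C2 * V x)"
          unfolding G_def by (intro mult_left_mono inside s 2) auto
        then show ?thesis using nn(1) unfolding EV by (simp add: algebra_simps)
      next
        case 3
        have "G \<tau> s x \<le> exp (2 * \<tau> * \<phi>1) * M5"
          unfolding G_def using M5(2)[OF s 3(1)] \<phi>_out[OF 3(2)] \<tau>
          by (intro mult_mono) auto
        then show ?thesis using nn(2) by linarith
      qed
    qed
    have I1: "(\<lambda>x. C2 * (\<Sum>t\<in>I. E \<tau> t x)) integrable_on Q"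
      by (intro integrable_on_mult_right integrable_sum I Eint)
    have I2: "(\<lambda>x. exp (2 * \<tau> * \<phi>1) * M5) integrable_on Q"
      unfolding Q_def by (rule integrable_const)
    have "integral Q (G \<tau> s) \<le> integral Q (\<lambda>x. C2 * (\<Sum>t\<in>I. E \<tau> t x) + exp (2 * \<tau> * \<phi>1) * M5)"
      by (rule integral_le[OF Gint[OF s] integrable_add[OF I1 I2] point])
    also have "\<dots> = C2 * S \<tau> + exp (2 * \<tau> * \<phi>1) * M5 * W"
    proof -
      have "integral Q (\<lambda>x. \<Sum>t\<in>I. E \<tau> t x) = S \<tau>"
        unfolding S_def by (rule integral_sum[OF I Eint])
      then show ?thesis
        unfolding integral_add[OF I1 I2] integral_mult_right W_def by (simp add: Q_def)
    qed
    finally show ?thesis .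
  qed
  define D where "D = 2 * C0 * card I * M5 * W"
  \<comment> \<open>From here on \<open>C0 * card I * C2\<close> is at most
    \<open>\<tau> / 2\<close>, so the energy on the right is absorbed by half of the left
    side.\<close>
  define T where "T = \<tau>0 + 1 + 2 * C0 * card I * C2"
  have upper: "integral Q (E \<tau> s1) \<le> D * exp (2 * \<tau> * \<phi>1)" if \<tau>: "\<tau> \<ge> T" for \<tau>
  proof -
    have \<tau>1: "\<tau> \<ge> \<tau>0" "\<tau> \<ge> 1" "\<tau> \<ge> 2 * C0 * card I * C2"
    proof -
      have "0 \<le> 2 * C0 * card I * C2" using C0 C2 by simp
      then show "\<tau> \<ge> \<tau>0" "\<tau> \<ge> 1" "\<tau> \<ge> 2 * C0 * card I * C2"
        using \<tau> \<tau>0 unfolding T_def by linarith+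
    qed
    have "\<tau> * S \<tau> = (\<Sum>t\<in>I. \<tau> * integral Q (E \<tau> t))" by (simp add: S_def sum_distrib_left)
    also have "\<dots> \<le> (\<Sum>t\<in>I. C0 * integral Q (G \<tau> t))"
      unfolding E_def G_def Q_def by (intro sum_mono carl \<tau>1 v v0 A)
    also have "\<dots> \<le> (\<Sum>t\<in>I. C0 * (C2 * S \<tau> + exp (2 * \<tau> * \<phi>1) * M5 * W))"
      using C0 \<tau>1 by (intro sum_mono mult_left_mono Gle) auto
    also have "\<dots> = (C0 * card I * C2) * S \<tau> + (D / 2) * exp (2 * \<tau> * \<phi>1)"
      by (simp add: D_def algebra_simps)
    also have "\<dots> \<le> (\<tau> / 2) * S \<tau> + (D / 2) * exp (2 * \<tau> * \<phi>1)"
      using \<tau>1(3) S0[of \<tau>] by (intro add_right_mono mult_right_mono) auto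
    finally have "\<tau> * S \<tau> \<le> D * exp (2 * \<tau> * \<phi>1)" by (simp add: field_simps)
    moreover have "1 * S \<tau> \<le> \<tau> * S \<tau>" using \<tau>1 S0 by (intro mult_right_mono) auto
    ultimately show ?thesis using ES[OF s1, of \<tau>] by linarith
  qed
  have vx1: "v s1 x1 \<noteq> 0" using nz veq[of x1 s1] R by simp
  \<comment> \<open>Half of the gap in the weight and, in \<open>e\<close>, half of the square at
    \<open>x1\<close>: by continuity both lower bounds persist on a small box around
    \<open>x1\<close>, whose positive volume gives growth at the rate
    \<open>\<phi>1 + d\<close>.\<close>
  define d where "d = (\<phi> x1 - \<phi>1) / 2"
  define e where "e = (v s1 x1)\<^sup>2 / 2"
  have de: "d > 0" "e > 0" using \<phi>_in vx1 by (auto simp: d_def e_def)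
  define U where "U = box (- A) A \<inter> ((\<lambda>x. (v s1 x)\<^sup>2) -` {e<..} \<inter> \<phi> -` {\<phi>1 + d<..})"
  have x1K: "x1 \<in> K" using v0[OF s1] vx1 by blast
  have "open U"
    unfolding U_def
    using Ck_on_imp_continuous_on[OF v[OF s1]] Ck_on_imp_continuous_on[OF \<phi>[OF open_UNIV, of 0]]
    by (intro open_Int open_box open_vimage) (auto intro!: continuous_intros)
  moreover have "x1 \<in> U"
    using x1K A de vx1 \<phi>_in by (auto simp: U_def e_def d_def field_simps)
  ultimately obtain b c' where bc: "cbox b c' \<subseteq> U" "x1 \<in> box b c'"
    by (metis open_contains_cbox)
  define m where "m = measure lborel (cbox b c')"
  have m: "m > 0" using bc(2) unfolding m_def
    by (subst content_pos_lt_eq) (auto simp: mem_box intro: less_trans)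
  have lower: "e * exp (2 * \<tau> * (\<phi>1 + d)) * m \<le> integral Q (E \<tau> s1)" if \<tau>: "\<tau> > 0" for \<tau>
  proof -
    have sub: "cbox b c' \<subseteq> Q" using bc(1) box_subset_cbox[of "- A" A] unfolding U_def Q_def by blast
    have E': "E \<tau> s1 integrable_on cbox b c'"
      using integrable_on_subcbox[OF Eint[OF s1, of \<tau>, unfolded Q_def] sub[unfolded Q_def]] .
    have "e * exp (2 * \<tau> * (\<phi>1 + d)) * m = integral (cbox b c') (\<lambda>x. e * exp (2 * \<tau> * (\<phi>1 + d)))"
      by (simp add: m_def)
    also have "\<dots> \<le> integral (cbox b c') (E \<tau> s1)"
    proof (rule integral_le[OF integrable_const E'])
      fix x assume "x \<in> cbox b c'"
      then have x: "(v s1 x)\<^sup>2 > e" "\<phi> x > \<phi>1 + d" using bc(1) by (auto simp: U_def)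
      have "exp (2 * \<tau> * (\<phi>1 + d)) * e \<le> E \<tau> s1 x"
        unfolding E_def
      proof (rule mult_mono)
        have "0 \<le> (\<Sum>i\<in>Basis. (pd i (v s1) x)\<^sup>2)" by (simp add: sum_nonneg)
        then show "e \<le> (v s1 x)\<^sup>2 + (\<Sum>i\<in>Basis. (pd i (v s1) x)\<^sup>2)" using x(1) by linarith
      qed (use x \<tau> de in auto)
      then show "e * exp (2 * \<tau> * (\<phi>1 + d)) \<le> E \<tau> s1 x" by (simp add: mult.commute)
    qed
    also have "\<dots> \<le> integral Q (E \<tau> s1)"
      by (rule integral_subset_le[OF sub E' Eint[OF s1]]) (simp add: E0)
    finally show ?thesis .
  qed
  show False
  proof (rule exp_growth_contradiction[of "e * m" d T D])
    fix \<tau> assume \<tau>: "\<tau> \<ge> T"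
    have "T > 0" using \<tau>0 C0 C2 by (simp add: T_def add_pos_nonneg)
    then have "e * exp (2 * \<tau> * (\<phi>1 + d)) * m \<le> D * exp (2 * \<tau> * \<phi>1)"
      using lower[of \<tau>] upper[OF \<tau>] \<tau> by linarith
    then have "exp (2 * \<tau> * \<phi>1) * (e * m * exp (2 * \<tau> * d)) \<le> exp (2 * \<tau> * \<phi>1) * D"
      by (simp add: distrib_left exp_add algebra_simps)
    then show "e * m * exp (2 * \<tau> * d) \<le> D" by simp
  qed (use de m in auto)
qed

end

section \<open>Local Riemannian metrics\<close>

locale inner_form =
  fixes G :: "'e::euclidean_space \<Rightarrow> 'e \<Rightarrow> real"
  assumes bil: "bilinear G" and sym: "\<And>v w. G v w = G w v" and pos: "\<And>v. v \<noteq> 0 \<Longrightarrow> G v v > 0"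
begin

lemma linear_left: "linear (\<lambda>v. G v w)" and linear_right: "linear (G v)"
  using bil by (auto simp: bilinear_def)

lemmas form_simps =
  linear_add[OF linear_left] linear_diff[OF linear_left] linear_cmul[OF linear_left] linear_sum[OF linear_left]
  linear_add[OF linear_right] linear_diff[OF linear_right] linear_cmul[OF linear_right] linear_sum[OF linear_right]
  linear_0[OF linear_left] linear_0[OF linear_right]

lemma eqI:
  assumes "\<And>w. G a w = G b w"
  shows "a = b"
proof (rule ccontr)
  assume "a \<noteq> b"
  then have "G (a - b) (a - b) > 0" by (intro pos) simp
  moreover have "G (a - b) (a - b) = 0" using assms by (simp add: form_simps(2))
  ultimately show False by simp
qed

text \<open>Each induction step is one step of Gram-Schmidt: by dimension some vector lies outside
  the span, and subtracting its projection and normalising extends the set.\<close>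

lemma orthonormal_set_exists:
  assumes "n \<le> DIM('e)"
  shows "\<exists>E. finite E \<and> card E = n \<and> (\<forall>a\<in>E. \<forall>b\<in>E. G a b = (if a = b then 1 else 0))"
  using assms
proof (induction n)
  case 0
  show ?case by (rule exI[of _ "{}"]) simp
next
  case (Suc n)
  then obtain E where E: "finite E" "card E = n" "\<And>a b. a \<in> E \<Longrightarrow> b \<in> E \<Longrightarrow> G a b = (if a = b then 1 else 0)"
    by auto
  have "dim (span E) \<le> n" using dim_le_card'[OF E(1)] E(2) by simp
  then have "span E \<noteq> UNIV" using Suc.prems by (metis dim_UNIV not_less_eq_eq)
  then obtain v where v: "v \<notin> span E" by auto
  define w where "w = v - (\<Sum>e\<in>E. G v e *\<^sub>R e)"
  have "(\<Sum>e\<in>E. G v e *\<^sub>R e) \<in> span E" by (intro span_sum span_scale span_base)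
  then have "w \<noteq> 0" using v by (auto simp: w_def)
  then have Gw: "G w w > 0" by (rule pos)
  have wE: "G w b = 0" if "b \<in> E" for b
  proof -
    have "(\<Sum>e\<in>E. G v e * G e b) = (\<Sum>e\<in>E. if e = b then G v e else 0)"
      using E(3) that by (intro sum.cong) auto
    then show ?thesis using E(1) that by (simp add: w_def form_simps)
  qed
  define w' where "w' = (1 / sqrt (G w w)) *\<^sub>R w"
  have w'E: "G w' b = 0" "G b w' = 0" if "b \<in> E" for b
    using wE[OF that] by (simp_all add: w'_def form_simps sym[of b])
  have w'w': "G w' w' = 1" using Gw by (simp add: w'_def form_simps)
  have "w' \<notin> E" using w'E w'w' by force
  then show ?case
    by (intro exI[of _ "insert w' E"]) (use E w'E w'w' in auto)
qed

text \<open>The same choice as in \<open>trace_wrt\<close>, so unfolding a trace produces this very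
  set.\<close>

definition onb :: "'e set" where "onb = (SOME E. orthonormal_basis G E)"

lemma onb: "orthonormal_basis G onb"
  unfolding onb_def by (rule someI_ex) (use orthonormal_set_exists[of "DIM('e)"] in \<open>auto simp: orthonormal_basis_def\<close>)

lemma onb_form: "a \<in> onb \<Longrightarrow> b \<in> onb \<Longrightarrow> G a b = (if a = b then 1 else 0)"
  and card_onb: "card onb = DIM('e)"
  using onb by (auto simp: orthonormal_basis_def)

lemma finite_onb: "finite onb"
  using card_onb DIM_positive[where 'a='e] card.infinite by fastforce

lemma form_onb_sum: "b \<in> onb \<Longrightarrow> G (\<Sum>e\<in>onb. r e *\<^sub>R e) b = r b"
proof -
  assume b: "b \<in> onb"
  have "(\<Sum>e\<in>onb. r e * G e b) = (\<Sum>e\<in>onb. if e = b then r e else 0)"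
    using b by (intro sum.cong) (auto simp: onb_form)
  then show ?thesis using b finite_onb by (simp add: form_simps)
qed

lemma span_onb: "span onb = UNIV"
proof -
  have "independent onb"
  proof (rule independent_if_scalars_zero[OF finite_onb])
    fix f x assume "(\<Sum>x\<in>onb. f x *\<^sub>R x) = 0" "x \<in> onb"
    then show "f x = 0" using form_onb_sum[of x f] by (simp add: form_simps)
  qed
  then have "UNIV \<subseteq> span onb"
    by (intro card_ge_dim_independent) (auto simp: card_onb)
  then show ?thesis by blast
qed

lemma onb_expansion: "v = (\<Sum>e\<in>onb. G e v *\<^sub>R e)"
proof -
  have "v \<in> span onb" by (simp add: span_onb)
  then obtain r where r: "v = (\<Sum>e\<in>onb. r e *\<^sub>R e)"
    unfolding span_finite[OF finite_onb] by auto
  have "G e v = r e" if "e \<in> onb" for e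
    using form_onb_sum[OF that, of r] r sym by metis
  then show ?thesis using r by simp
qed

text \<open>The entries of the inverse Gram matrix. If \<open>E\<close> has the vectors of
  \<open>onb\<close> as columns, then \<open>E^T G E = 1\<close> gives
  \<open>G^{-1} = E E^T\<close>. In particular the arbitrary choice of \<open>onb\<close> leaves no
  trace in the value.\<close>

definition inv_form :: "'e \<Rightarrow> 'e \<Rightarrow> real" where
  "inv_form i j = (\<Sum>e\<in>onb. (e \<bullet> i) * (e \<bullet> j))"

lemma inv_form_sym: "inv_form i j = inv_form j i"
  by (simp add: inv_form_def mult.commute)

lemma inv_form_inverse: "(\<Sum>j\<in>Basis. inv_form i j * G j k) = i \<bullet> k"
proof -
  have "(\<Sum>j\<in>Basis. inv_form i j * G j k) = (\<Sum>j\<in>Basis. \<Sum>e\<in>onb. (e \<bullet> i) * ((e \<bullet> j) * G j k))"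
    by (simp add: inv_form_def sum_distrib_right mult.assoc)
  also have "\<dots> = (\<Sum>e\<in>onb. \<Sum>j\<in>Basis. (e \<bullet> i) * ((e \<bullet> j) * G j k))" by (rule sum.swap)
  also have "\<dots> = (\<Sum>e\<in>onb. (e \<bullet> i) * G (\<Sum>j\<in>Basis. (e \<bullet> j) *\<^sub>R j) k)"
    by (simp add: form_simps sum_distrib_left)
  also have "\<dots> = (\<Sum>e\<in>onb. (e \<bullet> i) * G e k)" by (simp add: euclidean_representation)
  also have "\<dots> = (\<Sum>e\<in>onb. G e k *\<^sub>R e) \<bullet> i" by (simp add: inner_sum_left mult.commute)
  also have "\<dots> = i \<bullet> k" using onb_expansion[of k] by (simp add: inner_commute)
  finally show ?thesis .
qed

lemma inv_form_pos:
  assumes "\<exists>i\<in>Basis. \<xi> i \<noteq> 0"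
  shows "(\<Sum>i\<in>Basis. \<Sum>j\<in>Basis. inv_form i j * \<xi> i * \<xi> j) > 0"
proof -
  define v :: 'e where "v = (\<Sum>i\<in>Basis. \<xi> i *\<^sub>R i)"
  have "v \<noteq> 0"
  proof
    assume v: "v = 0"
    obtain i where i: "i \<in> Basis" "\<xi> i \<noteq> 0" using assms by blast
    have "v \<bullet> i = \<xi> i" using i(1) by (simp add: v_def)
    then show False using i(2) v by simp
  qed
  have ev: "e \<bullet> v = (\<Sum>i\<in>Basis. \<xi> i * (e \<bullet> i))" for e by (simp add: v_def inner_sum_right)
  have "(\<Sum>i\<in>Basis. \<Sum>j\<in>Basis. inv_form i j * \<xi> i * \<xi> j)
     = (\<Sum>i\<in>Basis. \<Sum>j\<in>Basis. \<Sum>e\<in>onb. (\<xi> i * (e \<bullet> i)) * (\<xi> j * (e \<bullet> j)))"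
    by (simp add: inv_form_def sum_distrib_left sum_distrib_right mult_ac)
  also have "\<dots> = (\<Sum>i\<in>Basis. \<Sum>e\<in>onb. \<Sum>j\<in>Basis. (\<xi> i * (e \<bullet> i)) * (\<xi> j * (e \<bullet> j)))"
    by (intro sum.cong refl sum.swap)
  also have "\<dots> = (\<Sum>e\<in>onb. \<Sum>i\<in>Basis. \<Sum>j\<in>Basis. (\<xi> i * (e \<bullet> i)) * (\<xi> j * (e \<bullet> j)))"
    by (rule sum.swap)
  also have "\<dots> = (\<Sum>e\<in>onb. (e \<bullet> v)\<^sup>2)"
    by (simp add: ev power2_eq_square sum_product)
  finally have eq: "(\<Sum>i\<in>Basis. \<Sum>j\<in>Basis. inv_form i j * \<xi> i * \<xi> j) = (\<Sum>e\<in>onb. (e \<bullet> v)\<^sup>2)" .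
  have "\<exists>e\<in>onb. e \<bullet> v \<noteq> 0"
  proof (rule ccontr)
    assume "\<not> ?thesis"
    then have "(\<Sum>e\<in>onb. G e v *\<^sub>R e) \<bullet> v = 0" by (simp add: inner_sum_left)
    then show False using onb_expansion[of v] \<open>v \<noteq> 0\<close> by simp
  qed
  then obtain e where "e \<in> onb" "e \<bullet> v \<noteq> 0" by blast
  then show ?thesis unfolding eq using finite_onb by (intro sum_pos2[of _ e]) auto
qed

text \<open>The orthonormal basis is chosen independently at every point, so a trace over it cannot
  be differentiated directly. Moving to the fixed coordinate basis puts the dependence on the point
  into \<open>inv_form\<close>.\<close>

lemma trace_wrt_eq:
  fixes B :: "'e \<Rightarrow> 'e \<Rightarrow> 'f::real_vector"
  assumes l: "\<And>w. linear (\<lambda>v. B v w)" and r: "\<And>v. linear (B v)"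
  shows "trace_wrt G B = (\<Sum>i\<in>Basis. \<Sum>j\<in>Basis. inv_form i j *\<^sub>R B i j)"
proof -
  have B: "B e e = (\<Sum>i\<in>Basis. \<Sum>j\<in>Basis. ((e \<bullet> i) * (e \<bullet> j)) *\<^sub>R B i j)" for e
  proof -
    have "B e e = B (\<Sum>i\<in>Basis. (e \<bullet> i) *\<^sub>R i) (\<Sum>j\<in>Basis. (e \<bullet> j) *\<^sub>R j)"
      by (simp add: euclidean_representation)
    also have "\<dots> = (\<Sum>i\<in>Basis. (e \<bullet> i) *\<^sub>R B i (\<Sum>j\<in>Basis. (e \<bullet> j) *\<^sub>R j))"
      unfolding linear_sum[OF l] linear_cmul[OF l] ..
    also have "\<dots> = (\<Sum>i\<in>Basis. (e \<bullet> i) *\<^sub>R (\<Sum>j\<in>Basis. (e \<bullet> j) *\<^sub>R B i j))"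
      unfolding linear_sum[OF r] linear_cmul[OF r] ..
    finally show ?thesis by (simp add: scaleR_sum_right)
  qed
  have "trace_wrt G B = (\<Sum>e\<in>onb. \<Sum>i\<in>Basis. \<Sum>j\<in>Basis. ((e \<bullet> i) * (e \<bullet> j)) *\<^sub>R B i j)"
    unfolding trace_wrt_def onb_def[symmetric] by (intro sum.cong refl B)
  also have "\<dots> = (\<Sum>i\<in>Basis. \<Sum>e\<in>onb. \<Sum>j\<in>Basis. ((e \<bullet> i) * (e \<bullet> j)) *\<^sub>R B i j)"
    by (rule sum.swap)
  also have "\<dots> = (\<Sum>i\<in>Basis. \<Sum>j\<in>Basis. \<Sum>e\<in>onb. ((e \<bullet> i) * (e \<bullet> j)) *\<^sub>R B i j)"
    by (intro sum.cong refl sum.swap)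
  finally show ?thesis by (simp add: inv_form_def scaleR_sum_left)
qed

end

text \<open>At a zero of \<open>h\<close> the product rule needs only continuity of
  \<open>f\<close>, as the remainder \<open>(f y - f x) * h y\<close> is small of higher order. It
  is used for an inverse matrix whose differentiability is still to be proved.\<close>

lemma has_derivative_mult_vanishing:
  fixes f h :: "'a::real_normed_vector \<Rightarrow> real"
  assumes f: "isCont f x" and h: "(h has_derivative h') (at x)" and 0: "h x = 0"
  shows "((\<lambda>y. f y * h y) has_derivative (\<lambda>v. f x * h' v)) (at x)"
proof -
  have "((\<lambda>y. f x * h y) has_derivative (\<lambda>v. f x * h' v)) (at x)"
    using has_derivative_mult_right[OF h] .
  moreover have "((\<lambda>y. (f y - f x) * h y) has_derivative (\<lambda>v. 0)) (at x)"
    unfolding has_derivative_iff_norm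
  proof (intro conjI)
    obtain c where c: "\<And>v. \<bar>h' v\<bar> \<le> norm v * c" "c > 0"
      using bounded_linear.pos_bounded[OF has_derivative_bounded_linear[OF h]] by auto
    have lim: "((\<lambda>y. \<bar>f y - f x\<bar> * (norm (h y - h x - h' (y - x)) / norm (y - x) + c)) \<longlongrightarrow> \<bar>0\<bar> * (0 + c)) (at x)"
      using h f unfolding has_derivative_iff_norm isCont_def
      by (intro tendsto_intros) (auto simp: LIM_zero_iff)
    show "((\<lambda>y. norm ((f y - f x) * h y - (f x - f x) * h x - 0) / norm (y - x)) \<longlongrightarrow> 0) (at x)"
    proof (rule tendsto_sandwich[where f="\<lambda>_. 0"])
      show "\<forall>\<^sub>F y in at x. norm ((f y - f x) * h y - (f x - f x) * h x - 0) / norm (y - x)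
         \<le> \<bar>f y - f x\<bar> * (norm (h y - h x - h' (y - x)) / norm (y - x) + c)"
      proof (rule always_eventually, rule allI)
        fix y
        show "norm ((f y - f x) * h y - (f x - f x) * h x - 0) / norm (y - x)
         \<le> \<bar>f y - f x\<bar> * (norm (h y - h x - h' (y - x)) / norm (y - x) + c)"
        proof (cases "y = x")
          case False
          then have n: "norm (y - x) > 0" by simp
          have "\<bar>h y\<bar> \<le> \<bar>h y - h x - h' (y - x)\<bar> + norm (y - x) * c"
            using c(1)[of "y - x"] 0 by linarith
          then have "\<bar>h y\<bar> / norm (y - x) \<le> \<bar>h y - h x - h' (y - x)\<bar> / norm (y - x) + c"
            using n by (simp add: field_simps)
          then have "\<bar>f y - f x\<bar> * (\<bar>h y\<bar> / norm (y - x)) \<le> \<bar>f y - f x\<bar> * (\<bar>h y - h x - h' (y - x)\<bar> / norm (y - x) + c)"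
            by (rule mult_left_mono) simp
          then show ?thesis by (simp add: abs_mult)
        qed simp
      qed
    qed (use lim in auto)
  qed simp
  ultimately have "((\<lambda>y. f x * h y + (f y - f x) * h y) has_derivative (\<lambda>v. f x * h' v + 0)) (at x)"
    by (rule has_derivative_add)
  then show ?thesis by (simp add: algebra_simps)
qed

section \<open>Regularity of the inverse of a matrix field\<close>

locale matrix_inverse_field =
  fixes \<Omega> :: "'e::euclidean_space set" and I :: "'i set" and a G :: "'i \<Rightarrow> 'i \<Rightarrow> 'e \<Rightarrow> real"
  assumes \<Omega>: "open \<Omega>" and I: "finite I"
    and left: "\<And>x i k. x \<in> \<Omega> \<Longrightarrow> i \<in> I \<Longrightarrow> k \<in> I \<Longrightarrow> (\<Sum>j\<in>I. a i j x * G j k x) = (if i = k then 1 else 0)"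
    and right: "\<And>x i k. x \<in> \<Omega> \<Longrightarrow> i \<in> I \<Longrightarrow> k \<in> I \<Longrightarrow> (\<Sum>j\<in>I. G i j x * a j k x) = (if i = k then 1 else 0)"
    and G: "\<And>k i j. i \<in> I \<Longrightarrow> j \<in> I \<Longrightarrow> Ck_on k \<Omega> (G i j)"
begin

text \<open>In matrix notation \<open>A(x) = A(y) - A(x) (G(x) - G(y)) A(y)\<close>, so regularity of \<open>G\<close> passes to its
  inverse \<open>A\<close>.\<close>

lemma resolvent:
  assumes x: "x \<in> \<Omega>" and y: "y \<in> \<Omega>" and i: "i \<in> I" and l: "l \<in> I"
  shows "a i l x = a i l y - (\<Sum>j\<in>I. \<Sum>k\<in>I. a i j x * (G j k x - G j k y) * a k l y)"
proof -
  have 1: "(\<Sum>j\<in>I. \<Sum>k\<in>I. a i j x * G j k x * a k l y) = a i l y"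
  proof -
    have "(\<Sum>j\<in>I. \<Sum>k\<in>I. a i j x * G j k x * a k l y) = (\<Sum>k\<in>I. (\<Sum>j\<in>I. a i j x * G j k x) * a k l y)"
      by (subst sum.swap) (simp add: sum_distrib_right)
    also have "\<dots> = (\<Sum>k\<in>I. if i = k then a k l y else 0)"
      by (intro sum.cong refl) (simp add: left x i)
    also have "\<dots> = a i l y" using I i by simp
    finally show ?thesis .
  qed
  have 2: "(\<Sum>j\<in>I. \<Sum>k\<in>I. a i j x * G j k y * a k l y) = a i l x"
  proof -
    have "(\<Sum>j\<in>I. \<Sum>k\<in>I. a i j x * G j k y * a k l y) = (\<Sum>j\<in>I. a i j x * (\<Sum>k\<in>I. G j k y * a k l y))"
      by (simp add: sum_distrib_left mult.assoc)
    also have "\<dots> = (\<Sum>j\<in>I. if j = l then a i j x else 0)"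
      by (intro sum.cong refl) (simp add: right y l)
    also have "\<dots> = a i l x" using I l by simp
    finally show ?thesis .
  qed
  show ?thesis
    by (simp add: right_diff_distrib left_diff_distrib sum_subtractf 1 2)
qed

text \<open>The resolvent identity bounds the increment of the inverse by the increment
  \<open>D x\<close> of \<open>G\<close>, but with the size \<open>N x\<close> of the inverse at the
  moving point as a factor. That size has to be bounded near \<open>y\<close> first.\<close>

lemma a_isCont:
  assumes y: "y \<in> \<Omega>" and i: "i \<in> I" and l: "l \<in> I"
  shows "isCont (a i l) y"
proof -
  define N where "N x = (\<Sum>i\<in>I. \<Sum>l\<in>I. \<bar>a i l x\<bar>)" for x
  define D where "D x = (\<Sum>j\<in>I. \<Sum>k\<in>I. \<bar>G j k x - G j k y\<bar>)" for x
  define n where "n = real (card I)"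
  have aN: "\<bar>a i l x\<bar> \<le> N x" if "i \<in> I" "l \<in> I" for i l x
  proof -
    have "\<bar>a i l x\<bar> \<le> (\<Sum>l\<in>I. \<bar>a i l x\<bar>)" using that I by (intro member_le_sum) auto
    also have "\<dots> \<le> N x" unfolding N_def using that I by (intro member_le_sum[of i]) (auto intro: sum_nonneg)
    finally show ?thesis .
  qed
  have N0: "N x \<ge> 0" for x unfolding N_def by (intro sum_nonneg) auto
  have diff: "\<bar>a i l x - a i l y\<bar> \<le> N x * N y * D x" if "i \<in> I" "l \<in> I" "x \<in> \<Omega>" for i l x
  proof -
    have "a i l x - a i l y = - (\<Sum>j\<in>I. \<Sum>k\<in>I. a i j x * (G j k x - G j k y) * a k l y)"
      using resolvent[OF that(3) y that(1,2)] by simp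
    then have "\<bar>a i l x - a i l y\<bar> \<le> (\<Sum>j\<in>I. \<Sum>k\<in>I. \<bar>a i j x * (G j k x - G j k y) * a k l y\<bar>)"
      by (simp only: abs_minus_cancel) (rule order_trans[OF sum_abs], intro sum_mono sum_abs)
    also have "\<dots> \<le> (\<Sum>j\<in>I. \<Sum>k\<in>I. N x * \<bar>G j k x - G j k y\<bar> * N y)"
      unfolding abs_mult using that by (intro sum_mono mult_mono aN order_refl mult_nonneg_nonneg N0) auto
    also have "\<dots> = N x * N y * D x"
      by (simp add: D_def sum_distrib_left mult_ac)
    finally show ?thesis .
  qed
  define c where "c = n\<^sup>2 * N y + 1"
  have c: "c > 0" using N0[of y] by (simp add: c_def add_nonneg_pos)
  \<comment> \<open>For small \<open>D x\<close> the term with \<open>N x\<close> on the right is at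
    most half of \<open>N x\<close> and can be moved to the left.\<close>
  have Nx: "N x \<le> 2 * N y" if "x \<in> \<Omega>" "D x < 1 / (2 * c)" for x
  proof -
    have "N x \<le> (\<Sum>i\<in>I. \<Sum>l\<in>I. \<bar>a i l y\<bar> + N x * N y * D x)"
      unfolding N_def[of x]
    proof (intro sum_mono)
      fix i l assume "i \<in> I" "l \<in> I"
      then have "\<bar>a i l x\<bar> \<le> \<bar>a i l y\<bar> + N x * N y * D x" using diff[of i l x] that(1) by linarith
      then show "\<bar>a i l x\<bar> \<le> \<bar>a i l y\<bar> + (\<Sum>i\<in>I. \<Sum>l\<in>I. \<bar>a i l x\<bar>) * N y * D x" by (simp add: N_def)
    qed
    also have "\<dots> = N y + N x * (n\<^sup>2 * N y * D x)"
      by (simp add: sum.distrib N_def[of y] n_def power2_eq_square)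
    finally have 1: "N x \<le> N y + N x * (n\<^sup>2 * N y * D x)" .
    have D0: "D x \<ge> 0" unfolding D_def by (intro sum_nonneg) auto
    have "n\<^sup>2 * N y * D x \<le> c * D x" using D0 by (intro mult_right_mono) (auto simp: c_def)
    also have "\<dots> \<le> 1 / 2" using that(2) c by (simp add: field_simps)
    finally have "N x * (n\<^sup>2 * N y * D x) \<le> N x * (1 / 2)" by (rule mult_left_mono[OF _ N0])
    then show ?thesis using 1 by simp
  qed
  have Glim: "(G j k \<longlongrightarrow> G j k y) (at y)" if "j \<in> I" "k \<in> I" for j k
    using Ck_on_imp_continuous_on[OF G[OF that, of 0]] y \<Omega> by (simp add: continuous_on_eq_continuous_at isCont_def)
  have "(D \<longlongrightarrow> (\<Sum>j\<in>I. \<Sum>k\<in>I. \<bar>G j k y - G j k y\<bar>)) (at y)"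
    unfolding D_def by (intro tendsto_sum tendsto_rabs tendsto_diff tendsto_const Glim)
  then have Dlim: "(D \<longlongrightarrow> 0) (at y)" by simp
  have ev: "\<forall>\<^sub>F x in at y. x \<in> \<Omega> \<and> D x < 1 / (2 * c)"
    using order_tendstoD(2)[OF Dlim, of "1 / (2 * c)"] eventually_at_in_open'[OF \<Omega> y] c
    by (auto intro: eventually_conj)
  have "((\<lambda>x. a i l x - a i l y) \<longlongrightarrow> 0) (at y)"
  proof (rule Lim_null_comparison)
    show "\<forall>\<^sub>F x in at y. norm (a i l x - a i l y) \<le> 2 * N y * N y * D x"
      using ev
    proof eventually_elim
      case (elim x)
      have D0: "D x \<ge> 0" unfolding D_def by (intro sum_nonneg) auto
      have "norm (a i l x - a i l y) \<le> N x * N y * D x" using diff[OF i l] elim by simp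
      also have "\<dots> \<le> 2 * N y * N y * D x" using Nx elim D0 N0 by (intro mult_right_mono) auto
      finally show ?case .
    qed
    show "((\<lambda>x. 2 * N y * N y * D x) \<longlongrightarrow> 0) (at y)" using tendsto_mult_right_zero[OF Dlim] .
  qed
  then show ?thesis by (simp add: isCont_def LIM_zero_iff)
qed

text \<open>In the resolvent identity the middle factor vanishes at \<open>y\<close>, so continuity
  of the first factor is enough, and the result is the formula \<open>dA = - A dG A\<close>.\<close>

lemma a_has_derivative:
  assumes y: "y \<in> \<Omega>" and i: "i \<in> I" and l: "l \<in> I"
  shows "(a i l has_derivative (\<lambda>v. - (\<Sum>j\<in>I. \<Sum>k\<in>I. a i j y * pd v (G j k) y * a k l y))) (at y)"
proof -
  have "((\<lambda>x. a i j x * (G j k x - G j k y)) has_derivative (\<lambda>v. a i j y * pd v (G j k) y)) (at y)"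
    if "j \<in> I" "k \<in> I" for j k
  proof (rule has_derivative_mult_vanishing[OF a_isCont[OF y i that(1)]])
    have "G j k differentiable (at y)" by (rule Ck_on_differentiable[OF G[OF that] y])
    from has_derivative_diff[OF pd_has_derivative[OF this] has_derivative_const]
    show "((\<lambda>x. G j k x - G j k y) has_derivative (\<lambda>v. pd v (G j k) y)) (at y)" by simp
  qed simp
  then have "((\<lambda>x. a i l y - (\<Sum>j\<in>I. \<Sum>k\<in>I. a i j x * (G j k x - G j k y) * a k l y)) has_derivative
     (\<lambda>v. 0 - (\<Sum>j\<in>I. \<Sum>k\<in>I. a i j y * pd v (G j k) y * a k l y))) (at y)"
    by (intro has_derivative_diff has_derivative_const has_derivative_sum has_derivative_mult_left)
  then have "((\<lambda>x. a i l y - (\<Sum>j\<in>I. \<Sum>k\<in>I. a i j x * (G j k x - G j k y) * a k l y)) has_derivative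
     (\<lambda>v. - (\<Sum>j\<in>I. \<Sum>k\<in>I. a i j y * pd v (G j k) y * a k l y))) (at y)" by simp
  then show ?thesis
    by (rule has_derivative_transform_within_open[OF _ \<Omega> y]) (simp add: resolvent[OF _ y i l, symmetric])
qed

lemma a_smooth:
  assumes "i \<in> I" "l \<in> I"
  shows "Ck_on k \<Omega> (a i l)"
  using assms
proof (induction k arbitrary: i l)
  case 0
  then show ?case by (auto intro!: continuous_at_imp_continuous_on a_isCont)
next
  case (Suc n)
  have "Ck_on n \<Omega> (pd v (a i l))" for v
    by (subst Ck_on_cong[OF \<Omega> pd_eqI[OF a_has_derivative]])
      (auto intro!: Ck_on_minus Ck_on_sum Ck_on_mult \<Omega> Ck_on_pd G Suc simp del: Ck_on.simps)
  then show ?case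
    unfolding Ck_on_Suc_pd differentiable_def using a_has_derivative Suc.prems by blast
qed

end

section \<open>Christoffel symbols and curvature in coordinates\<close>

locale local_metric =
  fixes \<Omega> :: "'e::euclidean_space set" and g :: "'e \<Rightarrow> 'e \<Rightarrow> 'e \<Rightarrow> real"
  assumes open_dom: "open \<Omega>"
    and smooth: "\<And>k v w. Ck_on k \<Omega> (\<lambda>y. g y v w)"
    and form: "\<And>y. y \<in> \<Omega> \<Longrightarrow> inner_form (g y)"
begin

definition ginv :: "'e \<Rightarrow> 'e \<Rightarrow> 'e \<Rightarrow> real" where
  "ginv i j y = inner_form.inv_form (g y) i j"

lemma ginv_inverse: "y \<in> \<Omega> \<Longrightarrow> (\<Sum>j\<in>Basis. ginv i j y * g y j k) = i \<bullet> k"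
  unfolding ginv_def by (rule inner_form.inv_form_inverse[OF form])

lemma ginv_sym: "y \<in> \<Omega> \<Longrightarrow> ginv i j y = ginv j i y"
  unfolding ginv_def by (rule inner_form.inv_form_sym[OF form])

lemma ginv_smooth:
  assumes "i \<in> Basis" "j \<in> Basis"
  shows "Ck_on k \<Omega> (ginv i j)"
proof -
  have "matrix_inverse_field \<Omega> Basis ginv (\<lambda>i j y. g y i j)"
  proof (unfold_locales, goal_cases)
    case (3 x i k)
    then show ?case by (simp add: ginv_inverse inner_Basis)
  next
    case (4 x i k)
    have "(\<Sum>j\<in>Basis. g x i j * ginv j k x) = (\<Sum>j\<in>Basis. ginv k j x * g x j i)"
      by (intro sum.cong refl) (simp add: ginv_sym[OF 4(1), of _ k] inner_form.sym[OF form[OF 4(1)], of i])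
    then show ?case using 4 by (auto simp: ginv_inverse inner_Basis)
  qed (auto simp: open_dom smooth)
  from matrix_inverse_field.a_smooth[OF this assms] show ?thesis .
qed

lemma elliptic_op_ginv:
  assumes "open U" "U \<subseteq> \<Omega>"
  shows "elliptic_op U ginv"
proof (unfold_locales, goal_cases)
  case (2 i j k)
  then show ?case using Ck_on_subset[OF ginv_smooth assms(2)] by blast
next
  case (4 x \<xi>)
  then have "x \<in> \<Omega>" using assms by blast
  then show ?case unfolding ginv_def by (rule inner_form.inv_form_pos[OF form 4(2)])
qed (use assms ginv_sym in auto)

definition dg :: "'e \<Rightarrow> 'e \<Rightarrow> 'e \<Rightarrow> 'e \<Rightarrow> real" where
  "dg u v w y = pd u (\<lambda>z. g z v w) y"

lemma g_differentiable: "y \<in> \<Omega> \<Longrightarrow> (\<lambda>z. g z v w) differentiable (at y)"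
  by (rule Ck_on_differentiable[OF smooth])

lemma dg_sym: "y \<in> \<Omega> \<Longrightarrow> dg u v w y = dg u w v y"
  unfolding dg_def by (rule pd_cong_open[OF open_dom]) (auto intro: inner_form.sym[OF form])

lemma dg_linear:
  assumes y: "y \<in> \<Omega>"
  shows "linear (\<lambda>u. dg u v w y)" "linear (\<lambda>v. dg u v w y)" "linear (\<lambda>w. dg u v w y)"
proof -
  show "linear (\<lambda>u. dg u v w y)"
    unfolding dg_def by (rule linear_pd[OF g_differentiable[OF y]])
  have l: "linear (\<lambda>v. dg u v w y)" for w
  proof (rule linearI)
    fix b c r
    have "dg u (b + c) w y = pd u (\<lambda>z. g z b w + g z c w) y"
      unfolding dg_def by (rule pd_cong_open[OF open_dom y]) (simp add: inner_form.form_simps form)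
    then show "dg u (b + c) w y = dg u b w y + dg u c w y"
      by (simp add: dg_def pd_add g_differentiable y)
    have "dg u (r *\<^sub>R b) w y = pd u (\<lambda>z. r * g z b w) y"
      unfolding dg_def by (rule pd_cong_open[OF open_dom y]) (simp add: inner_form.form_simps form)
    then show "dg u (r *\<^sub>R b) w y = r *\<^sub>R dg u b w y"
      by (simp add: dg_def pd_mult g_differentiable y)
  qed
  then show "linear (\<lambda>v. dg u v w y)" .
  show "linear (\<lambda>w. dg u v w y)"
    using l[of v] by (simp only: dg_sym[OF y, of u _ v])
qed

text \<open>The Christoffel symbols of the first kind: the Koszul formula for constant fields, whose
  Lie brackets vanish.\<close>

definition koszul :: "'e \<Rightarrow> 'e \<Rightarrow> 'e \<Rightarrow> 'e \<Rightarrow> real" where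
  "koszul u v w y = (dg u v w y + dg v u w y - dg w u v y) / 2"

definition christoffel :: "'e \<Rightarrow> 'e \<Rightarrow> 'e \<Rightarrow> 'e" where
  "christoffel y u v = (\<Sum>j\<in>Basis. \<Sum>k\<in>Basis. (ginv j k y * koszul u v j y) *\<^sub>R k)"

lemma koszul_linear:
  assumes y: "y \<in> \<Omega>"
  shows "linear (\<lambda>u. koszul u v w y)" "linear (\<lambda>v. koszul u v w y)" "linear (\<lambda>w. koszul u v w y)"
  unfolding koszul_def
  by (rule linearI; simp add: linear_add[OF dg_linear(1)[OF y]] linear_add[OF dg_linear(2)[OF y]]
      linear_add[OF dg_linear(3)[OF y]] linear_cmul[OF dg_linear(1)[OF y]] linear_cmul[OF dg_linear(2)[OF y]]
      linear_cmul[OF dg_linear(3)[OF y]] field_simps)+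

lemma g_christoffel:
  assumes y: "y \<in> \<Omega>"
  shows "g y (christoffel y u v) w = koszul u v w y"
proof -
  interpret inner_form "g y" by (rule form[OF y])
  have "g y (christoffel y u v) w = (\<Sum>j\<in>Basis. koszul u v j y * (\<Sum>k\<in>Basis. ginv j k y * g y k w))"
    unfolding christoffel_def by (simp add: form_simps sum_distrib_left mult_ac)
  also have "\<dots> = (\<Sum>j\<in>Basis. koszul u v j y * (j \<bullet> w))" by (simp add: ginv_inverse y)
  also have "\<dots> = koszul u v (\<Sum>j\<in>Basis. (w \<bullet> j) *\<^sub>R j) y"
    by (simp add: linear_sum[OF koszul_linear(3)[OF y]] linear_cmul[OF koszul_linear(3)[OF y]] inner_commute mult.commute)
  finally show ?thesis by (simp add: euclidean_representation)
qed

text \<open>Permuting the three arguments of the metric condition and using symmetry isolates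
  \<open>g y (\<Gamma> u v) w\<close>, which forces uniqueness by nondegeneracy. The definite
  description becomes an explicit expression whose smoothness can be seen.\<close>

lemma levi_civita_christoffel:
  assumes y: "y \<in> \<Omega>"
  shows "levi_civita g y = christoffel y"
  unfolding levi_civita_def
proof (rule the_equality)
  interpret inner_form "g y" by (rule form[OF y])
  have D: "frechet_derivative (\<lambda>z. g z v w) (at y) u = dg u v w y" for u v w
    by (simp add: dg_def pd_def)
  have "bilinear (christoffel y)"
    unfolding bilinear_def
    by (intro conjI allI linearI)
      (simp_all add: christoffel_def linear_add[OF koszul_linear(1)[OF y]] linear_add[OF koszul_linear(2)[OF y]]
        linear_cmul[OF koszul_linear(1)[OF y]] linear_cmul[OF koszul_linear(2)[OF y]] distrib_left scaleR_left_distrib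
        sum.distrib scaleR_sum_right mult.left_commute)
  moreover have "christoffel y v w = christoffel y w v" for v w
    by (simp add: christoffel_def koszul_def dg_sym[OF y, of _ v w] add.commute)
  moreover have "dg u v w y = g y (christoffel y u v) w + g y v (christoffel y u w)" for u v w
    unfolding sym[of v] g_christoffel[OF y] koszul_def
    by (simp add: dg_sym[OF y, of u w v] dg_sym[OF y, of w v u] dg_sym[OF y, of v w u] field_simps)
  ultimately show "bilinear (christoffel y) \<and> (\<forall>v w. christoffel y v w = christoffel y w v) \<and>
     (\<forall>u v w. frechet_derivative (\<lambda>z. g z v w) (at y) u = g y (christoffel y u v) w + g y v (christoffel y u w))"
    unfolding D by blast
  fix \<Gamma> assume "bilinear \<Gamma> \<and> (\<forall>v w. \<Gamma> v w = \<Gamma> w v) \<and>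
     (\<forall>u v w. frechet_derivative (\<lambda>z. g z v w) (at y) u = g y (\<Gamma> u v) w + g y v (\<Gamma> u w))"
  then have \<Gamma>: "\<And>v w. \<Gamma> v w = \<Gamma> w v" "\<And>u v w. dg u v w y = g y (\<Gamma> u v) w + g y v (\<Gamma> u w)"
    unfolding D by blast+
  show "\<Gamma> = christoffel y"
  proof (intro ext eqI)
    fix u v w
    have "koszul u v w y = g y (\<Gamma> u v) w"
      unfolding koszul_def \<Gamma>(2) using \<Gamma>(1)[of v u] \<Gamma>(1)[of w u] \<Gamma>(1)[of w v]
        sym[of v "\<Gamma> u w"] sym[of u "\<Gamma> v w"]
      by simp
    then show "g y (\<Gamma> u v) w = g y (christoffel y u v) w" by (simp add: g_christoffel y)
  qed
qed

lemma levi_civita_linear: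
  assumes y: "y \<in> \<Omega>"
  shows "linear (\<lambda>u. levi_civita g y u v)" "linear (levi_civita g y u)"
  unfolding levi_civita_christoffel[OF y] christoffel_def
  by (rule linearI; simp add: linear_add[OF koszul_linear(1)[OF y]] linear_add[OF koszul_linear(2)[OF y]]
        linear_cmul[OF koszul_linear(1)[OF y]] linear_cmul[OF koszul_linear(2)[OF y]] distrib_left scaleR_left_distrib
        sum.distrib scaleR_sum_right mult.left_commute)+

lemma levi_civita_smooth: "Ck_on k \<Omega> (\<lambda>y. levi_civita g y u v)"
proof -
  have "Ck_on k \<Omega> (koszul u v w)" for u v w
    unfolding koszul_def[abs_def] dg_def divide_inverse
    by (intro Ck_on_mult Ck_on_diff Ck_on_add open_dom Ck_on_const Ck_on_pd smooth)
  then have "Ck_on k \<Omega> (\<lambda>y. christoffel y u v)"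
    unfolding christoffel_def
    by (intro Ck_on_sum Ck_on_scaleR Ck_on_mult open_dom ginv_smooth Ck_on_const)
  then show ?thesis
    using Ck_on_cong[OF open_dom, of "\<lambda>y. levi_civita g y u v" "\<lambda>y. christoffel y u v"]
    by (simp add: levi_civita_christoffel)
qed

lemma trace_ginv:
  fixes B :: "'e \<Rightarrow> 'e \<Rightarrow> 'f::real_vector"
  assumes "y \<in> \<Omega>" "\<And>w. linear (\<lambda>v. B v w)" "\<And>v. linear (B v)"
  shows "trace_wrt (g y) B = (\<Sum>i\<in>Basis. \<Sum>j\<in>Basis. ginv i j y *\<^sub>R B i j)"
  unfolding ginv_def using assms by (intro inner_form.trace_wrt_eq form)

text \<open>Separates the dependence on the point from the dependence on the two vectors, which vary
  with the point in all applications.\<close>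

lemma levi_civita_expansion:
  assumes y: "y \<in> \<Omega>"
  shows "levi_civita g y P Q = (\<Sum>l\<in>Basis. \<Sum>m\<in>Basis. ((P \<bullet> l) * (Q \<bullet> m)) *\<^sub>R levi_civita g y l m)"
proof -
  have "levi_civita g y P Q = levi_civita g y (\<Sum>l\<in>Basis. (P \<bullet> l) *\<^sub>R l) (\<Sum>m\<in>Basis. (Q \<bullet> m) *\<^sub>R m)"
    by (simp add: euclidean_representation)
  also have "\<dots> = (\<Sum>l\<in>Basis. (P \<bullet> l) *\<^sub>R levi_civita g y l (\<Sum>m\<in>Basis. (Q \<bullet> m) *\<^sub>R m))"
    unfolding linear_sum[OF levi_civita_linear(1)[OF y]] linear_cmul[OF levi_civita_linear(1)[OF y]] ..
  also have "\<dots> = (\<Sum>l\<in>Basis. (P \<bullet> l) *\<^sub>R (\<Sum>m\<in>Basis. (Q \<bullet> m) *\<^sub>R levi_civita g y l m))"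
    unfolding linear_sum[OF levi_civita_linear(2)[OF y]] linear_cmul[OF levi_civita_linear(2)[OF y]] ..
  finally show ?thesis by (simp add: scaleR_sum_right)
qed

text \<open>The derivative of the Christoffel form in the direction \<open>R\<close> at the
  arguments \<open>P\<close> and \<open>Q\<close>. Written in the basis it is linear in all three
  slots by construction.\<close>

definition dchristoffel :: "'e \<Rightarrow> 'e \<Rightarrow> 'e \<Rightarrow> 'e \<Rightarrow> 'e" where
  "dchristoffel y R P Q = (\<Sum>k\<in>Basis. \<Sum>l\<in>Basis. \<Sum>m\<in>Basis.
     ((R \<bullet> k) * (P \<bullet> l) * (Q \<bullet> m)) *\<^sub>R pd k (\<lambda>z. levi_civita g z l m) y)"

lemma levi_civita_differentiable: "y \<in> \<Omega> \<Longrightarrow> (\<lambda>z. levi_civita g z u v) differentiable (at y)"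
  by (rule Ck_on_differentiable[OF levi_civita_smooth])

lemma pd_levi_civita:
  assumes y: "y \<in> \<Omega>"
  shows "pd R (\<lambda>z. levi_civita g z P Q) y = dchristoffel y R P Q"
proof -
  have "pd R (\<lambda>z. levi_civita g z P Q) y
    = pd R (\<lambda>z. \<Sum>l\<in>Basis. \<Sum>m\<in>Basis. ((P \<bullet> l) * (Q \<bullet> m)) *\<^sub>R levi_civita g z l m) y"
    by (rule pd_cong_open[OF open_dom y levi_civita_expansion])
  also have "\<dots> = (\<Sum>l\<in>Basis. \<Sum>m\<in>Basis. ((P \<bullet> l) * (Q \<bullet> m)) *\<^sub>R pd R (\<lambda>z. levi_civita g z l m) y)"
    using y by (simp add: pd_sum pd_scaleR levi_civita_differentiable)
  also have "\<dots> = (\<Sum>l\<in>Basis. \<Sum>m\<in>Basis. \<Sum>k\<in>Basis.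
       ((R \<bullet> k) * (P \<bullet> l) * (Q \<bullet> m)) *\<^sub>R pd k (\<lambda>z. levi_civita g z l m) y)"
    by (simp add: pd_basis_expansion[OF levi_civita_differentiable[OF y], of R] scaleR_sum_right mult_ac)
  also have "\<dots> = (\<Sum>l\<in>Basis. \<Sum>k\<in>Basis. \<Sum>m\<in>Basis.
       ((R \<bullet> k) * (P \<bullet> l) * (Q \<bullet> m)) *\<^sub>R pd k (\<lambda>z. levi_civita g z l m) y)"
    by (intro sum.cong refl sum.swap)
  also have "\<dots> = dchristoffel y R P Q"
    unfolding dchristoffel_def by (rule sum.swap)
  finally show ?thesis .
qed

text \<open>Constant fields commute, and the covariant derivative of one along another is the
  Christoffel form itself; only its derivatives and quadratic terms remain.\<close>

lemma curvature_tensor_eq: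
  assumes y: "y \<in> \<Omega>"
  shows "curvature_tensor g y a b c = dchristoffel y a b c + levi_civita g y a (levi_civita g y b c)
     - dchristoffel y b a c - levi_civita g y b (levi_civita g y a c)"
proof -
  have n: "nabla g (\<lambda>_. a) (\<lambda>_. b) = (\<lambda>z. levi_civita g z a b)" for a b
    by (simp add: nabla_def fun_eq_iff)
  have "lie_bracket (\<lambda>_. a) (\<lambda>_. b) = (\<lambda>_. 0)" by (simp add: lie_bracket_def fun_eq_iff)
  then show ?thesis
    unfolding curvature_tensor_def curvature_def n
    by (simp add: nabla_def pd_def[symmetric] pd_levi_civita[OF y] linear_0[OF levi_civita_linear(1)[OF y]])
qed

end

section \<open>The bitension field in charts\<close>

lemma (in local_metric) dchristoffel_linear:
  "linear (\<lambda>R. dchristoffel y R P Q)" "linear (\<lambda>P. dchristoffel y R P Q)" "linear (\<lambda>Q. dchristoffel y R P Q)"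
  unfolding dchristoffel_def
  by (rule linearI; simp add: inner_add_left distrib_left distrib_right scaleR_add_left sum.distrib
      scaleR_sum_right mult_ac)+

locale chart_map = M: local_metric \<Omega> g + N: local_metric \<Omega>' h
  for \<Omega> :: "'e::euclidean_space set" and g and \<Omega>' :: "'f::euclidean_space set" and h +
  fixes U :: "'e set" and F :: "'e \<Rightarrow> 'f"
  assumes open_U: "open U" and U\<Omega>: "U \<subseteq> \<Omega>"
    and F: "\<And>k. Ck_on k U F" and F\<Omega>: "\<And>y. y \<in> U \<Longrightarrow> F y \<in> \<Omega>'"
begin

abbreviation "\<Gamma> z \<equiv> levi_civita h z"
abbreviation "\<Gamma>\<^sub>M y \<equiv> levi_civita g y"

lemma F_differentiable: "y \<in> U \<Longrightarrow> F differentiable (at y)"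
  and pdF_differentiable: "y \<in> U \<Longrightarrow> pd v F differentiable (at y)"
  using Ck_on_differentiable[OF F] Ck_on_differentiable[OF Ck_on_pd[OF F]] by blast+

lemmas \<Gamma>_linear = N.levi_civita_linear[OF F\<Omega>] 
lemmas \<Gamma>_simps = linear_add[OF \<Gamma>_linear(1)] linear_add[OF \<Gamma>_linear(2)]
  linear_cmul[OF \<Gamma>_linear(1)] linear_cmul[OF \<Gamma>_linear(2)]
lemmas \<Gamma>M_linear = M.levi_civita_linear[OF subsetD[OF U\<Omega>]]
lemmas \<Gamma>M_simps = linear_add[OF \<Gamma>M_linear(1)] linear_add[OF \<Gamma>M_linear(2)]
  linear_cmul[OF \<Gamma>M_linear(1)] linear_cmul[OF \<Gamma>M_linear(2)]
lemmas dchristoffel_simps = linear_add[OF N.dchristoffel_linear(1)] linear_add[OF N.dchristoffel_linear(2)]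
  linear_add[OF N.dchristoffel_linear(3)] linear_cmul[OF N.dchristoffel_linear(1)] linear_cmul[OF N.dchristoffel_linear(2)]
  linear_cmul[OF N.dchristoffel_linear(3)]

lemma pd_linear_simps:
  assumes "f differentiable (at y)"
  shows "pd (a + b) f y = pd a f y + pd b f y" "pd (r *\<^sub>R a) f y = r *\<^sub>R pd a f y"
  by (rule linear_add[OF linear_pd[OF assms]], rule linear_cmul[OF linear_pd[OF assms]])

lemma pd_pd_linear_simps:
  fixes f :: "'e \<Rightarrow> 'f"
  assumes f: "Ck_on 2 U f" and y: "y \<in> U"
  shows "pd v (pd (a + b) f) y = pd v (pd a f) y + pd v (pd b f) y"
    and "pd v (pd (r *\<^sub>R a) f) y = r *\<^sub>R pd v (pd a f) y"
proof -
  have f': "Ck_on (Suc (Suc 0)) U f" using f by (simp add: numeral_2_eq_2)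
  have d: "f differentiable (at z)" "pd v f differentiable (at z)" if "z \<in> U" for z v
    using Ck_on_differentiable[OF f' that] Ck_on_differentiable[OF Ck_on_pd[OF f'] that] by blast+
  have "pd v (pd (a + b) f) y = pd v (\<lambda>z. pd a f z + pd b f z) y"
    by (rule pd_cong_open[OF open_U y]) (simp add: pd_linear_simps d)
  then show "pd v (pd (a + b) f) y = pd v (pd a f) y + pd v (pd b f) y"
    by (simp add: pd_add d y)
  have "pd v (pd (r *\<^sub>R a) f) y = pd v (\<lambda>z. r *\<^sub>R pd a f z) y"
    by (rule pd_cong_open[OF open_U y]) (simp add: pd_linear_simps d)
  then show "pd v (pd (r *\<^sub>R a) f) y = r *\<^sub>R pd v (pd a f) y"
    by (simp add: pd_scaleR d y)
qed

lemma \<Gamma>_comp_smooth: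
  assumes "Ck_on k U P" "Ck_on k U Q"
  shows "Ck_on k U (\<lambda>y. \<Gamma> (F y) (P y) (Q y))"
proof -
  have c: "Ck_on k U (\<lambda>y. \<Gamma> (F y) l m)" for l m
    by (rule Ck_on_compose[OF open_U N.open_dom F N.levi_civita_smooth]) (rule F\<Omega>)
  have "Ck_on k U (\<lambda>y. \<Sum>l\<in>Basis. \<Sum>m\<in>Basis. ((P y \<bullet> l) * (Q y \<bullet> m)) *\<^sub>R \<Gamma> (F y) l m)"
    by (intro Ck_on_sum Ck_on_scaleR Ck_on_mult Ck_on_inner_left open_U assms c)
  then show ?thesis
    by (rule Ck_on_cong[THEN iffD2, OF open_U, rotated]) (rule N.levi_civita_expansion[OF F\<Omega>])
qed

lemma pd_\<Gamma>_comp: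
  assumes y: "y \<in> U" and P: "P differentiable (at y)" and Q: "Q differentiable (at y)"
  shows "pd v (\<lambda>z. \<Gamma> (F z) (P z) (Q z)) y
    = N.dchristoffel (F y) (pd v F y) (P y) (Q y) + \<Gamma> (F y) (pd v P y) (Q y) + \<Gamma> (F y) (P y) (pd v Q y)"
proof -
  have dc: "(\<lambda>z. \<Gamma> (F z) l m) differentiable (at y)" for l m
    by (rule Ck_on_differentiable[OF Ck_on_compose[OF open_U N.open_dom F N.levi_civita_smooth] y]) (rule F\<Omega>)
  have pc: "pd v (\<lambda>z. \<Gamma> (F z) l m) y = (\<Sum>k\<in>Basis. (pd v F y \<bullet> k) *\<^sub>R pd k (\<lambda>z. \<Gamma> z l m) (F y))" for l m
  proof -
    have "((\<lambda>z. \<Gamma> (F z) l m) has_derivative (\<lambda>v. pd (pd v F y) (\<lambda>z. \<Gamma> z l m) (F y))) (at y)"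
      by (rule has_derivative_compose; rule pd_has_derivative)
        (use F_differentiable N.levi_civita_differentiable F\<Omega> y in auto)
    then have "pd v (\<lambda>z. \<Gamma> (F z) l m) y = pd (pd v F y) (\<lambda>z. \<Gamma> z l m) (F y)" by (rule pd_eqI)
    then show ?thesis
      by (rule trans[OF _ pd_basis_expansion[OF N.levi_civita_differentiable[OF F\<Omega>[OF y]]]])
  qed
  have dP: "(\<lambda>z. P z \<bullet> l) differentiable (at y)" and dQ: "(\<lambda>z. Q z \<bullet> l) differentiable (at y)" for l
    using P Q by auto
  have "pd v (\<lambda>z. \<Gamma> (F z) (P z) (Q z)) y
    = pd v (\<lambda>z. \<Sum>l\<in>Basis. \<Sum>m\<in>Basis. ((P z \<bullet> l) * (Q z \<bullet> m)) *\<^sub>R \<Gamma> (F z) l m) y"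
    by (rule pd_cong_open[OF open_U y N.levi_civita_expansion[OF F\<Omega>]])
  also have "\<dots> = (\<Sum>l\<in>Basis. \<Sum>m\<in>Basis. pd v (\<lambda>z. ((P z \<bullet> l) * (Q z \<bullet> m)) *\<^sub>R \<Gamma> (F z) l m) y)"
    by (simp add: pd_sum dc dP dQ)
  also have "\<dots> = (\<Sum>l\<in>Basis. \<Sum>m\<in>Basis.
      ((P y \<bullet> l) * (Q y \<bullet> m)) *\<^sub>R (\<Sum>k\<in>Basis. (pd v F y \<bullet> k) *\<^sub>R pd k (\<lambda>z. \<Gamma> z l m) (F y))
      + ((pd v P y \<bullet> l) * (Q y \<bullet> m)) *\<^sub>R \<Gamma> (F y) l m + ((P y \<bullet> l) * (pd v Q y \<bullet> m)) *\<^sub>R \<Gamma> (F y) l m)"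
    by (intro sum.cong refl) (simp add: pd_scaleR pd_mult pd_inner_left dc dP dQ P Q pc scaleR_add_left)
  also have "\<dots> = (\<Sum>l\<in>Basis. \<Sum>m\<in>Basis. \<Sum>k\<in>Basis.
        ((pd v F y \<bullet> k) * (P y \<bullet> l) * (Q y \<bullet> m)) *\<^sub>R pd k (\<lambda>z. \<Gamma> z l m) (F y))
      + \<Gamma> (F y) (pd v P y) (Q y) + \<Gamma> (F y) (P y) (pd v Q y)"
    by (simp add: sum.distrib N.levi_civita_expansion[OF F\<Omega>[OF y], of "pd v P y"]
       N.levi_civita_expansion[OF F\<Omega>[OF y], of "P y"] scaleR_sum_right mult_ac)
  also have "(\<Sum>l\<in>Basis. \<Sum>m\<in>Basis. \<Sum>k\<in>Basis.
        ((pd v F y \<bullet> k) * (P y \<bullet> l) * (Q y \<bullet> m)) *\<^sub>R pd k (\<lambda>z. \<Gamma> z l m) (F y)) = N.dchristoffel (F y) (pd v F y) (P y) (Q y)"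
  proof -
    have "(\<Sum>l\<in>Basis. \<Sum>m\<in>Basis. \<Sum>k\<in>Basis.
        ((pd v F y \<bullet> k) * (P y \<bullet> l) * (Q y \<bullet> m)) *\<^sub>R pd k (\<lambda>z. \<Gamma> z l m) (F y))
      = (\<Sum>l\<in>Basis. \<Sum>k\<in>Basis. \<Sum>m\<in>Basis.
        ((pd v F y \<bullet> k) * (P y \<bullet> l) * (Q y \<bullet> m)) *\<^sub>R pd k (\<lambda>z. \<Gamma> z l m) (F y))"
      by (intro sum.cong refl sum.swap)
    also have "\<dots> = N.dchristoffel (F y) (pd v F y) (P y) (Q y)"
      unfolding N.dchristoffel_def by (rule sum.swap)
    finally show ?thesis .
  qed
  finally show ?thesis .
qed

lemma nabla_const: "nabla g (\<lambda>_. v) (\<lambda>_. w) y = \<Gamma>\<^sub>M y v w"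
  by (simp add: nabla_def)

lemma pullback_nabla_eq:
  "pullback_nabla h F X V y = pd (X y) V y + \<Gamma> (F y) (pd (X y) F y) (V y)"
  by (simp add: pullback_nabla_def pd_def)

lemma nabla_d_eq:
  "nabla_d g h F (\<lambda>_. v) (\<lambda>_. w) y
    = pd v (pd w F) y + \<Gamma> (F y) (pd v F y) (pd w F y) - pd (\<Gamma>\<^sub>M y v w) F y"
  unfolding nabla_d_def pullback_nabla_eq nabla_const by (simp add: pd_def[abs_def])

abbreviation "V \<equiv> tension g h F"

lemma tension_eq:
  assumes y: "y \<in> U"
  shows "V y = (\<Sum>i\<in>Basis. \<Sum>j\<in>Basis. M.ginv i j y *\<^sub>R
    (pd i (pd j F) y + \<Gamma> (F y) (pd i F y) (pd j F y) - pd (\<Gamma>\<^sub>M y i j) F y))"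
  unfolding tension_def nabla_d_eq
  by (rule M.trace_ginv[OF subsetD[OF U\<Omega> y]]; rule linearI)
    (simp_all add: pd_linear_simps pd_pd_linear_simps F y F_differentiable pdF_differentiable \<Gamma>_simps \<Gamma>M_simps
      scaleR_right_diff_distrib scaleR_right_distrib)

text \<open>The bitension field differentiates \<open>V\<close> twice, and \<open>V\<close> is
  defined through a basis chosen separately at every point. Its regularity is read off from the
  coordinate formula.\<close>

lemma tension_smooth: "Ck_on k U V"
proof -
  have pdF: "Ck_on k U (pd v F)" "Ck_on k U (pd u (pd v F))" for u v
    by (intro Ck_on_pd F)+
  have c: "Ck_on k U (\<lambda>y. \<Gamma>\<^sub>M y i j)" for i j
    using Ck_on_subset[OF M.levi_civita_smooth U\<Omega>] .
  have a: "i \<in> Basis \<Longrightarrow> j \<in> Basis \<Longrightarrow> Ck_on k U (M.ginv i j)" for i j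
    using Ck_on_subset[OF M.ginv_smooth U\<Omega>] .
  have "Ck_on k U (\<lambda>y. \<Sum>i\<in>Basis. \<Sum>j\<in>Basis. M.ginv i j y *\<^sub>R
    (pd i (pd j F) y + \<Gamma> (F y) (pd i F y) (pd j F y) - (\<Sum>l\<in>Basis. (\<Gamma>\<^sub>M y i j \<bullet> l) *\<^sub>R pd l F y)))"
    by (intro Ck_on_sum Ck_on_scaleR Ck_on_diff Ck_on_add Ck_on_inner_left \<Gamma>_comp_smooth open_U a c pdF)
  moreover have "V y = (\<Sum>i\<in>Basis. \<Sum>j\<in>Basis. M.ginv i j y *\<^sub>R
    (pd i (pd j F) y + \<Gamma> (F y) (pd i F y) (pd j F y) - (\<Sum>l\<in>Basis. (\<Gamma>\<^sub>M y i j \<bullet> l) *\<^sub>R pd l F y)))"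
    if "y \<in> U" for y
    unfolding tension_eq[OF that] by (simp add: pd_basis_expansion[OF F_differentiable[OF that], of "\<Gamma>\<^sub>M y _ _"])
  ultimately show ?thesis by (rule Ck_on_cong[THEN iffD2, OF open_U, rotated])
qed

lemma V_differentiable: "y \<in> U \<Longrightarrow> V differentiable (at y)"
  and pdV_differentiable: "y \<in> U \<Longrightarrow> pd v V differentiable (at y)"
  using Ck_on_differentiable[OF tension_smooth] Ck_on_differentiable[OF Ck_on_pd[OF tension_smooth]] by blast+

definition L where "L f y = (\<Sum>i\<in>Basis. \<Sum>j\<in>Basis. M.ginv i j y *\<^sub>R pd i (pd j f) y)"
  for f :: "'e \<Rightarrow> 'f"

definition tension_lower where "tension_lower y = (\<Sum>i\<in>Basis. \<Sum>j\<in>Basis. M.ginv i j y *\<^sub>R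
    (\<Gamma> (F y) (pd i F y) (pd j F y) - pd (\<Gamma>\<^sub>M y i j) F y))"

lemma L_F: "y \<in> U \<Longrightarrow> L F y = V y - tension_lower y"
  unfolding L_def tension_lower_def tension_eq by (simp add: sum_subtractf[symmetric] algebra_simps)

text \<open>The part of the second covariant derivative of \<open>V\<close> that contains only
  \<open>F\<close>, \<open>V\<close> and their first derivatives.\<close>

definition bitension_lower where "bitension_lower y i j =
    N.dchristoffel (F y) (pd i F y) (pd j F y) (V y) + \<Gamma> (F y) (pd j F y) (pd i V y)
    + \<Gamma> (F y) (pd i F y) (pd j V y) + \<Gamma> (F y) (pd i F y) (\<Gamma> (F y) (pd j F y) (V y))
    - pd (\<Gamma>\<^sub>M y i j) V y - \<Gamma> (F y) (pd (\<Gamma>\<^sub>M y i j) F y) (V y)"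

definition curvature_term where "curvature_term y i j =
    N.dchristoffel (F y) (pd i F y) (V y) (pd j F y) + \<Gamma> (F y) (pd i F y) (\<Gamma> (F y) (V y) (pd j F y))
    - N.dchristoffel (F y) (V y) (pd i F y) (pd j F y) - \<Gamma> (F y) (V y) (\<Gamma> (F y) (pd i F y) (pd j F y))"

lemma rough_laplacian_eq:
  assumes y: "y \<in> U"
  shows "rough_laplacian g h F V y = (\<Sum>i\<in>Basis. \<Sum>j\<in>Basis. M.ginv i j y *\<^sub>R
     (pd i (pd j V) y + \<Gamma> (F y) (pd i (pd j F) y) (V y) + bitension_lower y i j))"
proof -
  \<comment> \<open>Differentiating \<open>\<Gamma> (F z) (pd w F z) (V z)\<close> produces
    \<open>\<Gamma> (F y) (pd v (pd w F) y) (V y)\<close>, kept apart from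
    \<open>bitension_lower\<close> because it contains second derivatives of
    \<open>F\<close>.\<close>
  have B: "pullback_nabla h F (\<lambda>_. v) (pullback_nabla h F (\<lambda>_. w) V) y -
     pullback_nabla h F (nabla g (\<lambda>_. v) (\<lambda>_. w)) V y
    = pd v (pd w V) y + \<Gamma> (F y) (pd v (pd w F) y) (V y) + bitension_lower y v w" for v w
  proof -
    have W: "(\<lambda>z. \<Gamma> (F z) (pd w F z) (V z)) differentiable (at y)"
      by (rule Ck_on_differentiable[OF \<Gamma>_comp_smooth[OF Ck_on_pd[OF F] tension_smooth] y])
    have "pullback_nabla h F (\<lambda>_. w) V = (\<lambda>z. pd w V z + \<Gamma> (F z) (pd w F z) (V z))"
      by (simp add: pullback_nabla_eq fun_eq_iff)
    then show ?thesis
      using y by (simp add: pullback_nabla_eq nabla_const pd_add pdV_differentiable W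
          pd_\<Gamma>_comp pdF_differentiable V_differentiable \<Gamma>_simps bitension_lower_def)
  qed
  show ?thesis
    unfolding rough_laplacian_def B
    by (rule M.trace_ginv[OF subsetD[OF U\<Omega> y]]; rule linearI)
      (simp_all add: bitension_lower_def pd_linear_simps pd_pd_linear_simps F tension_smooth y F_differentiable pdF_differentiable
        V_differentiable pdV_differentiable \<Gamma>_simps \<Gamma>M_simps dchristoffel_simps
        scaleR_right_diff_distrib scaleR_right_distrib)
qed

lemma curvature_trace_eq:
  assumes y: "y \<in> U"
  shows "trace_wrt (g y) (\<lambda>v w. curvature_tensor h (F y)
       (frechet_derivative F (at y) v) (V y) (frechet_derivative F (at y) w))
     = (\<Sum>i\<in>Basis. \<Sum>j\<in>Basis. M.ginv i j y *\<^sub>R curvature_term y i j)"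
  unfolding pd_def[symmetric] N.curvature_tensor_eq[OF F\<Omega>[OF y]] curvature_term_def
  by (rule M.trace_ginv[OF subsetD[OF U\<Omega> y]]; rule linearI)
    (simp_all add: pd_linear_simps y F_differentiable \<Gamma>_simps dchristoffel_simps
        scaleR_right_diff_distrib scaleR_right_distrib)

text \<open>The Christoffel form is linear in its first argument, so the trace of the terms with
  second derivatives of \<open>F\<close> can be taken inside it and becomes
  \<open>L F\<close>.\<close>

lemma L_V:
  assumes y: "y \<in> U" and 0: "bitension g h F y = 0"
  shows "L V y = (\<Sum>i\<in>Basis. \<Sum>j\<in>Basis. M.ginv i j y *\<^sub>R (curvature_term y i j - bitension_lower y i j)) - \<Gamma> (F y) (L F y) (V y)"
proof -
  have LF: "\<Gamma> (F y) (L F y) (V y) = (\<Sum>i\<in>Basis. \<Sum>j\<in>Basis. M.ginv i j y *\<^sub>R \<Gamma> (F y) (pd i (pd j F) y) (V y))"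
    unfolding L_def linear_sum[OF \<Gamma>_linear(1)[OF y]] linear_cmul[OF \<Gamma>_linear(1)[OF y]] ..
  show ?thesis
    using 0 unfolding bitension_def rough_laplacian_eq[OF y] curvature_trace_eq[OF y] LF
    by (simp add: L_def scaleR_right_distrib scaleR_right_diff_distrib sum.distrib sum_subtractf algebra_simps)
qed

end

text \<open>The derivative is bounded on the compact set, and convexity keeps the segments of the
  mean value inequality inside it.\<close>

lemma Ck_on_Lipschitz:
  fixes f :: "'a::euclidean_space \<Rightarrow> 'b::real_normed_vector"
  assumes f: "Ck_on 1 \<Omega> f" and T: "compact T" "convex T" "T \<subseteq> \<Omega>"
  shows "\<exists>B\<ge>0. \<forall>x\<in>T. \<forall>y\<in>T. norm (f x - f y) \<le> B * norm (x - y)"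
proof -
  have "\<exists>B0\<ge>0. \<forall>i\<in>Basis. \<forall>x\<in>T. \<bar>norm (pd i f x)\<bar> \<le> B0"
  proof (intro compact_family_bound finite_Basis T continuous_on_norm)
    fix i :: 'a
    have "continuous_on \<Omega> (pd i f)" using f by (simp add: Ck_on_Suc_pd)
    then show "continuous_on T (pd i f)" by (rule continuous_on_subset[OF _ T(3)])
  qed
  then obtain B0 where B0: "B0 \<ge> 0" "\<And>i x. i \<in> Basis \<Longrightarrow> x \<in> T \<Longrightarrow> norm (pd i f x) \<le> B0" by auto
  have d: "f differentiable (at x)" if "x \<in> T" for x
    using f T(3) that by (auto simp: Ck_on_Suc_pd)
  have "norm (f x - f y) \<le> (DIM('a) * B0) * norm (x - y)" if "x \<in> T" "y \<in> T" for x y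
  proof (rule differentiable_bound[OF T(2) _ _ that])
    fix z assume z: "z \<in> T"
    show "(f has_derivative (\<lambda>v. pd v f z)) (at z within T)"
      by (rule has_derivative_at_withinI[OF pd_has_derivative[OF d[OF z]]])
    show "onorm (\<lambda>v. pd v f z) \<le> DIM('a) * B0"
    proof (rule onorm_le)
      fix v :: 'a
      have "norm (pd v f z) \<le> (\<Sum>i\<in>Basis. norm ((v \<bullet> i) *\<^sub>R pd i f z))"
        unfolding pd_basis_expansion[OF d[OF z], of v] by (rule norm_sum)
      also have "\<dots> \<le> (\<Sum>i\<in>(Basis::'a set). norm v * B0)"
        unfolding norm_scaleR using B0 z by (intro sum_mono mult_mono) (auto simp: Basis_le_norm)
      finally show "norm (pd v f z) \<le> DIM('a) * B0 * norm v" by (simp add: mult_ac)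
    qed
  qed
  then show ?thesis using B0(1) by (intro exI[of _ "DIM('a) * B0"]) auto
qed

section \<open>Comparison of nonlinear expressions in two solutions\<close>

locale controlled_pairs =
  fixes K :: "'e::topological_space set" and \<rho> :: "'e \<Rightarrow> real"
  assumes K: "compact K" and \<rho>: "\<And>x. x \<in> K \<Longrightarrow> 0 \<le> \<rho> x"
begin

text \<open>The relation is stable under algebraic operations and composition with Lipschitz maps. It is used
  with \<open>\<rho>\<close> the right-hand side of the differential inequality for the difference of two solutions.\<close>

definition controlled :: "('e \<Rightarrow> 'b::real_normed_vector) \<Rightarrow> ('e \<Rightarrow> 'b) \<Rightarrow> bool" where
  "controlled P Q \<longleftrightarrow> (\<exists>C\<ge>0. \<forall>x\<in>K. norm (P x) \<le> C \<and> norm (Q x) \<le> C \<and> norm (P x - Q x) \<le> C * \<rho> x)"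

lemma controlledI:
  assumes "\<And>x. x \<in> K \<Longrightarrow> norm (P x) \<le> A" "\<And>x. x \<in> K \<Longrightarrow> norm (Q x) \<le> B"
    "\<And>x. x \<in> K \<Longrightarrow> norm (P x - Q x) \<le> C * \<rho> x"
  shows "controlled P Q"
  unfolding controlled_def
proof (intro exI[of _ "max 0 (max A (max B C))"] conjI ballI)
  fix x assume x: "x \<in> K"
  have "C * \<rho> x \<le> max 0 (max A (max B C)) * \<rho> x" using \<rho>[OF x] by (intro mult_right_mono) auto
  then show "norm (P x - Q x) \<le> max 0 (max A (max B C)) * \<rho> x" using assms(3)[OF x] by linarith
qed (use assms in \<open>auto simp: le_max_iff_disj\<close>)

lemma controlledE:
  assumes "controlled P Q"
  obtains C where "C \<ge> 0" "\<And>x. x \<in> K \<Longrightarrow> norm (P x) \<le> C" "\<And>x. x \<in> K \<Longrightarrow> norm (Q x) \<le> C"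
    "\<And>x. x \<in> K \<Longrightarrow> norm (P x - Q x) \<le> C * \<rho> x"
  using assms unfolding controlled_def by auto

lemma controlled_diff_bound: "controlled P Q \<Longrightarrow> \<exists>C. \<forall>x\<in>K. norm (P x - Q x) \<le> C * \<rho> x"
  unfolding controlled_def by blast

lemma controlled_cong:
  assumes "controlled P Q" "\<And>x. x \<in> K \<Longrightarrow> P' x = P x" "\<And>x. x \<in> K \<Longrightarrow> Q' x = Q x"
  shows "controlled P' Q'"
  using assms unfolding controlled_def by simp

lemma controlled_add:
  assumes "controlled P Q" "controlled P' Q'"
  shows "controlled (\<lambda>x. P x + P' x) (\<lambda>x. Q x + Q' x)"
proof -
  obtain C where C: "C \<ge> 0" "\<And>x. x \<in> K \<Longrightarrow> norm (P x) \<le> C" "\<And>x. x \<in> K \<Longrightarrow> norm (Q x) \<le> C"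
    "\<And>x. x \<in> K \<Longrightarrow> norm (P x - Q x) \<le> C * \<rho> x" using controlledE[OF assms(1)] by blast
  obtain D where D: "D \<ge> 0" "\<And>x. x \<in> K \<Longrightarrow> norm (P' x) \<le> D" "\<And>x. x \<in> K \<Longrightarrow> norm (Q' x) \<le> D"
    "\<And>x. x \<in> K \<Longrightarrow> norm (P' x - Q' x) \<le> D * \<rho> x" using controlledE[OF assms(2)] by blast
  show ?thesis
  proof (rule controlledI[where A="C + D" and B="C + D" and C="C + D"])
    fix x assume x: "x \<in> K"
    show "norm (P x + P' x) \<le> C + D" "norm (Q x + Q' x) \<le> C + D"
      by (intro norm_triangle_le add_mono C D x)+
    have "norm (P x + P' x - (Q x + Q' x)) \<le> norm (P x - Q x) + norm (P' x - Q' x)"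
      using norm_triangle_ineq[of "P x - Q x" "P' x - Q' x"] by (simp add: algebra_simps)
    then show "norm (P x + P' x - (Q x + Q' x)) \<le> (C + D) * \<rho> x"
      using C(4)[OF x] D(4)[OF x] by (simp add: distrib_right)
  qed
qed

text \<open>The difference splits as
  \<open>f x *\<^sub>R (P x - Q x) + (f x - f' x) *\<^sub>R Q x\<close>; this is where the bounds on
  the functions themselves, included in \<open>controlled\<close>, are used.\<close>

lemma controlled_scaleR:
  assumes "controlled f f'" "controlled P Q"
  shows "controlled (\<lambda>x. f x *\<^sub>R P x) (\<lambda>x. f' x *\<^sub>R Q x)"
proof -
  obtain C where C: "C \<ge> 0" "\<And>x. x \<in> K \<Longrightarrow> norm (f x) \<le> C" "\<And>x. x \<in> K \<Longrightarrow> norm (f' x) \<le> C"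
    "\<And>x. x \<in> K \<Longrightarrow> norm (f x - f' x) \<le> C * \<rho> x" using controlledE[OF assms(1)] by blast
  obtain D where D: "D \<ge> 0" "\<And>x. x \<in> K \<Longrightarrow> norm (P x) \<le> D" "\<And>x. x \<in> K \<Longrightarrow> norm (Q x) \<le> D"
    "\<And>x. x \<in> K \<Longrightarrow> norm (P x - Q x) \<le> D * \<rho> x" using controlledE[OF assms(2)] by blast
  show ?thesis
  proof (rule controlledI[where A="C * D" and B="C * D" and C="C * D + C * D"])
    fix x assume x: "x \<in> K"
    show "norm (f x *\<^sub>R P x) \<le> C * D" "norm (f' x *\<^sub>R Q x) \<le> C * D"
      unfolding norm_scaleR using C(2,3)[OF x] D(2,3)[OF x] C(1) by (auto intro!: mult_mono)
    have "f x *\<^sub>R P x - f' x *\<^sub>R Q x = f x *\<^sub>R (P x - Q x) + (f x - f' x) *\<^sub>R Q x"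
      by (simp add: algebra_simps)
    then have "norm (f x *\<^sub>R P x - f' x *\<^sub>R Q x) \<le> norm (f x) * norm (P x - Q x) + norm (f x - f' x) * norm (Q x)"
      using norm_triangle_ineq[of "f x *\<^sub>R (P x - Q x)" "(f x - f' x) *\<^sub>R Q x"] by simp
    also have "\<dots> \<le> C * (D * \<rho> x) + (C * \<rho> x) * D"
      using C D x \<rho>[OF x] by (intro add_mono mult_mono) auto
    finally show "norm (f x *\<^sub>R P x - f' x *\<^sub>R Q x) \<le> (C * D + C * D) * \<rho> x" by (simp add: algebra_simps)
  qed
qed

text \<open>For coefficients common to both solutions: they must be bounded but contribute no
  difference.\<close>

lemma controlled_refl:
  assumes "continuous_on K P"
  shows "controlled P P"
proof -
  have "bounded (P ` K)" using assms K compact_continuous_image compact_imp_bounded by blast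
  then obtain B where "\<And>x. x \<in> K \<Longrightarrow> norm (P x) \<le> B" by (auto simp: bounded_iff)
  then show ?thesis by (intro controlledI[where A=B and B=B and C=0]) auto
qed

lemma controlled_diff:
  assumes "controlled P Q" "controlled P' Q'"
  shows "controlled (\<lambda>x. P x - P' x) (\<lambda>x. Q x - Q' x)"
proof -
  have "controlled (\<lambda>x. (-1::real) *\<^sub>R P' x) (\<lambda>x. (-1) *\<^sub>R Q' x)"
    by (intro controlled_scaleR assms controlled_refl continuous_on_const)
  from controlled_add[OF assms(1) this] show ?thesis by simp
qed

lemma controlled_mult:
  fixes f f' P Q :: "'e \<Rightarrow> real"
  assumes "controlled f f'" "controlled P Q"
  shows "controlled (\<lambda>x. f x * P x) (\<lambda>x. f' x * Q x)"
  using controlled_scaleR[OF assms] by simp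

lemma controlled_sum:
  assumes "\<And>i. i \<in> I \<Longrightarrow> controlled (P i) (Q i)"
  shows "controlled (\<lambda>x. \<Sum>i\<in>I. P i x) (\<lambda>x. \<Sum>i\<in>I. Q i x)"
  using assms
  by (induction I rule: infinite_finite_induct) (auto intro: controlled_add controlled_refl)

lemma controlled_inner:
  assumes "controlled P Q" "norm k \<le> 1"
  shows "controlled (\<lambda>x. P x \<bullet> k) (\<lambda>x. Q x \<bullet> k)"
proof -
  obtain C where C: "C \<ge> 0" "\<And>x. x \<in> K \<Longrightarrow> norm (P x) \<le> C" "\<And>x. x \<in> K \<Longrightarrow> norm (Q x) \<le> C"
    "\<And>x. x \<in> K \<Longrightarrow> norm (P x - Q x) \<le> C * \<rho> x" using controlledE[OF assms(1)] by blast
  have n: "norm (v \<bullet> k) \<le> norm v" for v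
    using Cauchy_Schwarz_ineq2[of v k] mult_left_mono[OF assms(2), of "norm v"] by simp
  show ?thesis
  proof (rule controlledI[where A=C and B=C and C=C])
    fix x assume x: "x \<in> K"
    show "norm (P x \<bullet> k) \<le> C" by (rule order_trans[OF n C(2)[OF x]])
    show "norm (Q x \<bullet> k) \<le> C" by (rule order_trans[OF n C(3)[OF x]])
    show "norm (P x \<bullet> k - Q x \<bullet> k) \<le> C * \<rho> x"
      unfolding inner_diff_left[symmetric] by (rule order_trans[OF n C(4)[OF x]])
  qed
qed

text \<open>Treats coefficients evaluated along the solutions, such as Christoffel symbols of the
  target. Both solutions must take values in one compact convex set where the coefficient is
  defined.\<close>

lemma controlled_Lipschitz:
  fixes f :: "'f::euclidean_space \<Rightarrow> 'b::real_normed_vector"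
  assumes F: "controlled F1 F2" and f: "Ck_on 1 \<Omega> f" and T: "compact T" "convex T" "T \<subseteq> \<Omega>"
    and FT: "\<And>x. x \<in> K \<Longrightarrow> F1 x \<in> T" "\<And>x. x \<in> K \<Longrightarrow> F2 x \<in> T"
  shows "controlled (\<lambda>x. f (F1 x)) (\<lambda>x. f (F2 x))"
proof -
  obtain B where B: "B \<ge> 0" "\<And>x y. x \<in> T \<Longrightarrow> y \<in> T \<Longrightarrow> norm (f x - f y) \<le> B * norm (x - y)"
    using Ck_on_Lipschitz[OF f T] by blast
  have "continuous_on T f" using continuous_on_subset[OF Ck_on_imp_continuous_on[OF f] T(3)] .
  then have "bounded (f ` T)" using T(1) compact_continuous_image compact_imp_bounded by blast
  then obtain A where A: "\<And>z. z \<in> T \<Longrightarrow> norm (f z) \<le> A" by (auto simp: bounded_iff)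
  obtain C where C: "\<And>x. x \<in> K \<Longrightarrow> norm (F1 x - F2 x) \<le> C * \<rho> x" using controlled_diff_bound[OF F] by auto
  show ?thesis
  proof (rule controlledI[where A=A and B=A and C="B * C"])
    fix x assume x: "x \<in> K"
    show "norm (f (F1 x)) \<le> A" by (rule A[OF FT(1)[OF x]])
    show "norm (f (F2 x)) \<le> A" by (rule A[OF FT(2)[OF x]])
    have "norm (f (F1 x) - f (F2 x)) \<le> B * norm (F1 x - F2 x)" by (intro B FT x)
    also have "\<dots> \<le> B * (C * \<rho> x)" by (intro mult_left_mono C B x)
    finally show "norm (f (F1 x) - f (F2 x)) \<le> B * C * \<rho> x" by (simp add: mult.assoc)
  qed
qed

end

lemma norm_le_component_sum:
  fixes v :: "'f::euclidean_space"
  assumes "\<And>k. k \<in> Basis \<Longrightarrow> \<bar>v \<bullet> k\<bar> \<le> f k" "(\<Sum>k\<in>Basis. f k) \<le> r"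
  shows "norm v \<le> r"
  using norm_le_l1[of v] sum_mono[of Basis "\<lambda>k. \<bar>v \<bullet> k\<bar>" f] assms by fastforce

text \<open>All lower order expressions are polynomial in \<open>F\<close>, \<open>V\<close>, their
  first derivatives and smooth coefficients, so the calculus of \<open>controlled\<close> yields the
  differential inequality for the differences without further computation.\<close>

theorem bitension_unique_continuation:
  fixes F1 F2 :: "'e::euclidean_space \<Rightarrow> 'f::euclidean_space"
  assumes c1: "chart_map \<Omega> g \<Omega>' h U F1" and c2: "chart_map \<Omega> g \<Omega>' h U F2"
    and b1: "\<And>y. y \<in> U \<Longrightarrow> bitension g h F1 y = 0" and b2: "\<And>y. y \<in> U \<Longrightarrow> bitension g h F2 y = 0"
    and KU: "cball x0 R \<subseteq> U" and T: "compact T" "convex T" "T \<subseteq> \<Omega>'"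
    and T1: "\<And>y. y \<in> cball x0 R \<Longrightarrow> F1 y \<in> T" and T2: "\<And>y. y \<in> cball x0 R \<Longrightarrow> F2 y \<in> T"
    and r: "0 < r" "r \<le> R" and eq: "\<And>y. y \<in> ball x0 r \<Longrightarrow> F1 y = F2 y"
    and y: "y \<in> ball x0 R"
  shows "F1 y = F2 y"
proof -
  interpret A: chart_map \<Omega> g \<Omega>' h U F1 by (rule c1)
  interpret B: chart_map \<Omega> g \<Omega>' h U F2 by (rule c2)
  define K where "K = cball x0 R"
  have ballU: "ball x0 R \<subseteq> U" using KU ball_subset_cball by blast
  have KU': "x \<in> U" if "x \<in> K" for x using that KU by (auto simp: K_def)
  \<comment> \<open>The flag \<open>False\<close> marks components of the difference of the maps,
    \<open>True\<close> those of the difference of the tension fields.\<close>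
  define I :: "(bool \<times> 'f) set" where "I = UNIV \<times> Basis"
  define u where "u = (\<lambda>(b::bool, k) x. (if b then A.V x - B.V x else F1 x - F2 x) \<bullet> k)"
  define \<rho> where "\<rho> x = (\<Sum>t\<in>I. \<bar>u t x\<bar> + (\<Sum>i\<in>Basis. \<bar>pd i (u t) x\<bar>))" for x
  have \<rho>0: "\<rho> x \<ge> 0" for x unfolding \<rho>_def by (intro sum_nonneg add_nonneg_nonneg) auto
  interpret controlled_pairs K \<rho> by unfold_locales (auto simp: K_def \<rho>0)
  define S where "S b x = (\<Sum>k\<in>Basis. \<bar>u (b, k) x\<bar> + (\<Sum>i\<in>Basis. \<bar>pd i (u (b, k)) x\<bar>))" for b x
  have \<rho>_split: "\<rho> x = S False x + S True x" for x
    unfolding \<rho>_def I_def S_def sum.cartesian_product' by (simp add: UNIV_bool)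
  have S0: "S b x \<ge> 0" for b x unfolding S_def by (intro sum_nonneg add_nonneg_nonneg) auto
  have S_\<rho>: "S b x \<le> \<rho> x" for b x
    using S0[of True x] S0[of False x] by (cases b) (simp_all add: \<rho>_split)
  have u_\<rho>: "(\<Sum>k\<in>Basis. \<bar>u (b, k) x\<bar>) \<le> \<rho> x" for b x
  proof (rule order_trans[OF _ S_\<rho>])
    show "(\<Sum>k\<in>Basis. \<bar>u (b, k) x\<bar>) \<le> S b x"
      unfolding S_def by (intro sum_mono) (simp add: sum_nonneg)
  qed
  have pdu_\<rho>: "(\<Sum>k\<in>Basis. \<bar>pd i (u (b, k)) x\<bar>) \<le> \<rho> x" if "i \<in> Basis" for b x i
  proof (rule order_trans[OF _ S_\<rho>])
    have "\<bar>pd i (u (b, k)) x\<bar> \<le> (\<Sum>i\<in>Basis. \<bar>pd i (u (b, k)) x\<bar>)" for k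
      by (rule member_le_sum[OF that]) auto
    then show "(\<Sum>k\<in>Basis. \<bar>pd i (u (b, k)) x\<bar>) \<le> S b x"
      unfolding S_def by (intro sum_mono) (simp add: add_increasing)
  qed
  note dF = A.F_differentiable B.F_differentiable A.V_differentiable B.V_differentiable
  note dpF = A.pdF_differentiable B.pdF_differentiable A.pdV_differentiable B.pdV_differentiable
  have pdu: "pd i (u (b, k)) x = (if b then pd i A.V x - pd i B.V x else pd i F1 x - pd i F2 x) \<bullet> k"
    if "x \<in> U" for b k i x
  proof (cases b)
    case True
    have "pd i (\<lambda>x. (A.V x - B.V x) \<bullet> k) x = (pd i A.V x - pd i B.V x) \<bullet> k"
      using that by (simp add: pd_inner_left pd_diff dF differentiable_diff)
    then show ?thesis using True by (simp add: u_def)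
  next
    case False
    have "pd i (\<lambda>x. (F1 x - F2 x) \<bullet> k) x = (pd i F1 x - pd i F2 x) \<bullet> k"
      using that by (simp add: pd_inner_left pd_diff dF differentiable_diff)
    then show ?thesis using False by (simp add: u_def)
  qed
  have ppdu: "pd i (pd j (u (b, k))) x
     = (if b then pd i (pd j A.V) x - pd i (pd j B.V) x else pd i (pd j F1) x - pd i (pd j F2) x) \<bullet> k"
    if x: "x \<in> U" for b k i j x
  proof (cases b)
    case True
    have "pd i (pd j (u (b, k))) x = pd i (\<lambda>x. (pd j A.V x - pd j B.V x) \<bullet> k) x"
      by (rule pd_cong_open[OF A.open_U x]) (simp add: pdu True)
    then show ?thesis using x True by (simp add: pd_inner_left pd_diff dpF differentiable_diff)
  next
    case False
    have "pd i (pd j (u (b, k))) x = pd i (\<lambda>x. (pd j F1 x - pd j F2 x) \<bullet> k) x"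
      by (rule pd_cong_open[OF A.open_U x]) (simp add: pdu False)
    then show ?thesis using x False by (simp add: pd_inner_left pd_diff dpF differentiable_diff)
  qed
  have controlled_basic: "controlled P Q" if "continuous_on K P" "continuous_on K Q"
    "\<And>x. x \<in> K \<Longrightarrow> norm (P x - Q x) \<le> \<rho> x" for P Q :: "'e \<Rightarrow> 'f"
  proof -
    have "bounded (P ` K)" "bounded (Q ` K)"
      using that(1,2) K compact_continuous_image compact_imp_bounded by blast+
    then obtain a b where "\<And>x. x \<in> K \<Longrightarrow> norm (P x) \<le> a" "\<And>x. x \<in> K \<Longrightarrow> norm (Q x) \<le> b"
      by (auto simp: bounded_iff)
    then show ?thesis using that(3) by (intro controlledI[where C=1]) auto
  qed
  have cont: "continuous_on K f" if "Ck_on 0 U f" for f :: "'e \<Rightarrow> 'c::real_normed_vector"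
    using that KU by (auto simp: K_def intro: continuous_on_subset)
  have cF: "controlled F1 F2"
    by (intro controlled_basic cont A.F B.F norm_le_component_sum[OF _ u_\<rho>[of False]]) (simp add: u_def)
  have cV: "controlled A.V B.V"
    by (intro controlled_basic cont A.tension_smooth B.tension_smooth norm_le_component_sum[OF _ u_\<rho>[of True]]) (simp add: u_def)
  have cdF: "controlled (pd i F1) (pd i F2)" if "i \<in> Basis" for i
    by (intro controlled_basic cont Ck_on_pd A.F B.F norm_le_component_sum[OF _ pdu_\<rho>[OF that, of False]])
      (simp add: pdu KU')
  have cdV: "controlled (pd i A.V) (pd i B.V)" if "i \<in> Basis" for i
    by (intro controlled_basic cont Ck_on_pd A.tension_smooth B.tension_smooth norm_le_component_sum[OF _ pdu_\<rho>[OF that, of True]])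
      (simp add: pdu KU')
  have ca: "controlled (A.M.ginv i j) (A.M.ginv i j)" if "i \<in> Basis" "j \<in> Basis" for i j
    by (intro controlled_refl cont Ck_on_subset[OF A.M.ginv_smooth A.U\<Omega>] that)
  have ccomp: "controlled (\<lambda>x. f (F1 x)) (\<lambda>x. f (F2 x))" if "Ck_on 1 \<Omega>' f" for f :: "'f \<Rightarrow> 'f"
    by (rule controlled_Lipschitz[OF cF that T]) (auto simp: K_def T1 T2)
  have nB: "norm k \<le> 1" if "k \<in> Basis" for k :: 'f using that by simp
  have c\<Gamma>: "controlled (\<lambda>x. levi_civita h (F1 x) (P1 x) (Q1 x)) (\<lambda>x. levi_civita h (F2 x) (P2 x) (Q2 x))"
    if "controlled P1 P2" "controlled Q1 Q2" for P1 P2 Q1 Q2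
  proof (rule controlled_cong)
    show "controlled (\<lambda>x. \<Sum>l\<in>Basis. \<Sum>m\<in>Basis. ((P1 x \<bullet> l) * (Q1 x \<bullet> m)) *\<^sub>R levi_civita h (F1 x) l m)
      (\<lambda>x. \<Sum>l\<in>Basis. \<Sum>m\<in>Basis. ((P2 x \<bullet> l) * (Q2 x \<bullet> m)) *\<^sub>R levi_civita h (F2 x) l m)"
      by (intro controlled_sum controlled_scaleR controlled_mult controlled_inner that nB ccomp A.N.levi_civita_smooth)
  qed (rule A.N.levi_civita_expansion, use A.F\<Omega> B.F\<Omega> KU' in auto)+
  have cD: "controlled (\<lambda>x. A.N.dchristoffel (F1 x) (R1 x) (P1 x) (Q1 x)) (\<lambda>x. A.N.dchristoffel (F2 x) (R2 x) (P2 x) (Q2 x))"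
    if "controlled R1 R2" "controlled P1 P2" "controlled Q1 Q2" for R1 R2 P1 P2 Q1 Q2
    unfolding A.N.dchristoffel_def
    by (intro controlled_sum controlled_scaleR controlled_mult controlled_inner that nB ccomp Ck_on_pd A.N.levi_civita_smooth)
  have cM: "controlled (\<lambda>x. pd (levi_civita g x i j) f x) (\<lambda>x. pd (levi_civita g x i j) f' x)"
    if "\<And>k. k \<in> Basis \<Longrightarrow> controlled (pd k f) (pd k f')" "\<And>x. x \<in> U \<Longrightarrow> f differentiable (at x)"
      "\<And>x. x \<in> U \<Longrightarrow> f' differentiable (at x)" for f f' :: "'e \<Rightarrow> 'f" and i j
  proof (rule controlled_cong)
    show "controlled (\<lambda>x. \<Sum>k\<in>Basis. (levi_civita g x i j \<bullet> k) *\<^sub>R pd k f x)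
      (\<lambda>x. \<Sum>k\<in>Basis. (levi_civita g x i j \<bullet> k) *\<^sub>R pd k f' x)"
      by (intro controlled_sum controlled_scaleR that controlled_refl cont Ck_on_inner_left A.open_U
          Ck_on_subset[OF A.M.levi_civita_smooth A.U\<Omega>])
  qed (rule pd_basis_expansion, use that KU' in auto)+
  note cbase = cF cV cdF cdV
  have cLF: "controlled (A.L F1) (A.L F2)"
  proof (rule controlled_cong)
    show "controlled (\<lambda>x. A.V x - A.tension_lower x) (\<lambda>x. B.V x - B.tension_lower x)"
      unfolding A.tension_lower_def B.tension_lower_def
      by (intro controlled_diff controlled_sum controlled_scaleR c\<Gamma> cM cbase ca dF)
  qed (simp_all add: A.L_F B.L_F KU')
  \<comment> \<open>The right-hand side contains \<open>A.L F1 x\<close>, hence second derivatives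
    of the map; they are already controlled by \<open>cLF\<close>. The operator \<open>L\<close>
    depends on the domain metric only, so \<open>A.L\<close> serves for both solutions.\<close>
  have cLV: "controlled (A.L A.V) (A.L B.V)"
  proof (rule controlled_cong)
    show "controlled (\<lambda>x. (\<Sum>i\<in>Basis. \<Sum>j\<in>Basis. A.M.ginv i j x *\<^sub>R (A.curvature_term x i j - A.bitension_lower x i j)) - levi_civita h (F1 x) (A.L F1 x) (A.V x))
      (\<lambda>x. (\<Sum>i\<in>Basis. \<Sum>j\<in>Basis. A.M.ginv i j x *\<^sub>R (B.curvature_term x i j - B.bitension_lower x i j)) - levi_civita h (F2 x) (A.L F2 x) (B.V x))"
      unfolding A.curvature_term_def B.curvature_term_def A.bitension_lower_def B.bitension_lower_def
      by (intro controlled_diff controlled_add controlled_sum controlled_scaleR c\<Gamma> cD cM cbase cLF ca dF)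
  qed (simp_all add: A.L_V B.L_V KU' b1 b2)
  obtain C1 where C1: "\<And>x. x \<in> K \<Longrightarrow> norm (A.L F1 x - A.L F2 x) \<le> C1 * \<rho> x" using controlled_diff_bound[OF cLF] by auto
  obtain C2 where C2: "\<And>x. x \<in> K \<Longrightarrow> norm (A.L A.V x - A.L B.V x) \<le> C2 * \<rho> x" using controlled_diff_bound[OF cLV] by auto
  interpret E: elliptic_op "ball x0 R" A.M.ginv
    by (rule A.M.elliptic_op_ginv) (use ballU A.U\<Omega> in auto)
  have uk: "u (False, k) y = 0" if k: "k \<in> Basis" for k
  proof (rule E.unique_continuation_ball[where I=I and C="max C1 C2" and r=r and u=u])
    show "Ck_on 2 (ball x0 R) (u s)" if "s \<in> I" for s
    proof (rule Ck_on_subset[OF _ ballU], cases s)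
      case (Pair b k)
      show "Ck_on 2 U (u s)"
        unfolding Pair u_def prod.case
        by (cases b) (auto intro!: Ck_on_inner_left Ck_on_diff A.open_U A.F B.F A.tension_smooth B.tension_smooth)
    qed
    show "\<bar>\<Sum>i\<in>Basis. \<Sum>j\<in>Basis. A.M.ginv i j x * pd i (pd j (u s)) x\<bar>
      \<le> max C1 C2 * (\<Sum>t\<in>I. \<bar>u t x\<bar> + (\<Sum>i\<in>Basis. \<bar>pd i (u t) x\<bar>))"
      if x: "x \<in> ball x0 R" and s: "s \<in> I" for x s
    proof -
      have xK: "x \<in> K" and xU: "x \<in> U" using x ballU by (auto simp: K_def)
      obtain b k where bk: "s = (b, k)" "k \<in> Basis" using s by (auto simp: I_def)
      have e: "(\<Sum>i\<in>Basis. \<Sum>j\<in>Basis. A.M.ginv i j x * pd i (pd j (u s)) x)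
         = (if b then A.L A.V x - A.L B.V x else A.L F1 x - A.L F2 x) \<bullet> k"
        unfolding bk(1) ppdu[OF xU] A.L_def
        by (simp add: inner_diff_left inner_sum_left right_diff_distrib sum_subtractf)
      have "\<bar>\<Sum>i\<in>Basis. \<Sum>j\<in>Basis. A.M.ginv i j x * pd i (pd j (u s)) x\<bar> \<le> norm (if b then A.L A.V x - A.L B.V x else A.L F1 x - A.L F2 x)"
        unfolding e by (rule Basis_le_norm[OF bk(2)])
      also have "\<dots> \<le> max (C1 * \<rho> x) (C2 * \<rho> x)" using C1[OF xK] C2[OF xK]
        by (cases b) (simp_all add: max.coboundedI1 max.coboundedI2)
      also have "\<dots> \<le> max C1 C2 * \<rho> x" by (intro max.boundedI mult_right_mono \<rho>0) auto
      finally show ?thesis by (simp add: \<rho>_def)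
    qed
    \<comment> \<open>The tension fields agree too, being computed from derivatives of maps that
      coincide on an open ball.\<close>
    show "u s x = 0" if x: "x \<in> ball x0 r" and "s \<in> I" for x s
    proof -
      have xU: "x \<in> U" using x r ballU by auto
      have p: "pd i F1 z = pd i F2 z" if "z \<in> ball x0 r" for i z
        by (rule pd_cong_open[OF open_ball that eq])
      have pp: "pd i (pd j F1) x = pd i (pd j F2) x" for i j
        by (rule pd_cong_open[OF open_ball x p])
      have "A.V x = B.V x"
        unfolding A.tension_eq[OF xU] B.tension_eq[OF xU] pp p[OF x] eq[OF x] ..
      then show ?thesis using eq[OF x] by (cases s) (simp add: u_def)
    qed
  qed (use r y k in \<open>auto simp: I_def\<close>)
  show ?thesis
  proof (rule euclidean_eqI)
    show "F1 y \<bullet> k = F2 y \<bullet> k" if "k \<in> Basis" for k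
      using uk[OF that] by (simp add: u_def inner_diff_left)
  qed
qed

section \<open>Charts of the sphere\<close>

lemma bilinear_imp_inner_form:
  assumes "bilinear G" "\<forall>v w. G v w = G w v" "\<forall>v. v \<noteq> 0 \<longrightarrow> G v v > 0"
  shows "inner_form G"
  using assms by unfold_locales auto

lemma Ck_on_sqrt_real: "Ck_on k {0<..} sqrt"
proof (induction k)
  case 0
  show ?case by (auto intro!: continuous_intros)
next
  case (Suc k)
  show ?case
  proof (rule Ck_on_real_fun)
    show "(sqrt has_real_derivative inverse (sqrt x) * (1/2)) (at x)" if "x \<in> {0<..}" for x
      using DERIV_real_sqrt[of x] that by (simp add: field_simps)
    show "Ck_on k {0<..} (\<lambda>x. inverse (sqrt x) * (1/2))"
      by (intro Ck_on_mult Ck_on_inverse Suc Ck_on_const open_greaterThan) simp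
  qed simp
qed

text \<open>Positivity of the induced form is the injectivity of the differential of the
  parametrisation.\<close>

lemma unit_sphere_metric:
  fixes d :: "('b::euclidean_space, 'f::euclidean_space) chart"
  assumes d: "d \<in> atlas (unit_sphere :: ('b, 'f) riemannian)"
  shows "local_metric (chart_image d) (metric (unit_sphere :: ('b, 'f) riemannian) d)"
proof -
  have d': "chart_of (top_of_set (sphere 0 1)) d" "smooth_on (chart_image d) (chart_inv d)"
    "\<And>y. y \<in> chart_image d \<Longrightarrow> inj (frechet_derivative (chart_inv d) (at y))"
    using d by (auto simp: unit_sphere_def)
  have o: "open (chart_image d)" using d'(1) by (simp add: chart_of_def)
  have s: "Ck_on k (chart_image d) (chart_inv d)" for k using d'(2) by (simp add: smooth_on_def)
  have m: "metric (unit_sphere :: ('b, 'f) riemannian) d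
    = (\<lambda>y v w. pd v (chart_inv d) y \<bullet> pd w (chart_inv d) y)"
    by (simp add: unit_sphere_def pd_def)
  show ?thesis
  proof (rule local_metric.intro)
    show "open (chart_image d)" by (rule o)
    show "Ck_on k (chart_image d) (\<lambda>y. metric unit_sphere d y v w)" for k v w
      unfolding m by (intro Ck_on_inner o Ck_on_pd s)
    show "inner_form (metric unit_sphere d y)" if y: "y \<in> chart_image d" for y
    proof -
      have l: "linear (\<lambda>v. pd v (chart_inv d) y)"
        by (rule linear_pd[OF Ck_on_differentiable[OF s y]])
      have "pd v (chart_inv d) y \<noteq> 0" if "v \<noteq> 0" for v
        using injD[OF d'(3)[OF y], of v 0] that linear_0[OF l] by (auto simp: pd_def)
      then show ?thesis
        unfolding m
        by unfold_locales (auto simp: bilinear_def inner_commute inner_add_left inner_add_right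
            linear_add[OF l] linear_cmul[OF l] intro!: linearI)
    qed
  qed
qed

text \<open>The chart is the orthogonal projection of the open hemisphere around \<open>p\<close> to the hyperplane
  orthogonal to \<open>p\<close>.\<close>

lemma unit_sphere_chart_exists:
  fixes p :: "'b::euclidean_space"
  assumes dims: "DIM('b) = DIM('f::euclidean_space) + 1" and p: "norm p = 1"
  shows "\<exists>d \<in> atlas (unit_sphere :: ('b, 'f) riemannian). p \<in> fst d"
proof -
  have pp: "p \<bullet> p = 1" using p by (simp add: dot_square_norm)
  define T where "T = {x. p \<bullet> x = 0}"
  have "p \<noteq> 0" using p by auto
  then have "dim T = DIM('f)" using dims dim_hyperplane[of p] by (simp add: T_def)
  then have dim: "dim (UNIV :: 'f set) = dim T" by simp
  have sT: "subspace T" unfolding T_def by (rule subspace_hyperplane)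
  obtain L :: "'f \<Rightarrow> 'b" and G :: "'b \<Rightarrow> 'f" where "linear L" "linear G" "L ` UNIV = T" "G ` T = UNIV"
    "\<And>x. x \<in> UNIV \<Longrightarrow> norm (L x) = norm x" "\<And>x. x \<in> T \<Longrightarrow> norm (G x) = norm x"
    "\<And>x. x \<in> UNIV \<Longrightarrow> G (L x) = x" "\<And>x. x \<in> T \<Longrightarrow> L (G x) = x"
    by (rule isometries_subspaces[OF subspace_UNIV sT dim], rule that)
  note LG = this(1-4) this(5)[OF UNIV_I] this(6) this(7)[OF UNIV_I] this(8)
  have pL: "p \<bullet> L y = 0" for y using LG(3) by (auto simp: T_def)
  have bL: "bounded_linear L" and bG: "bounded_linear G" using LG linear_conv_bounded_linear by blast+
  define D where "D = sphere 0 1 \<inter> {x. p \<bullet> x > 0}"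
  define \<pi> where "\<pi> x = G (x - (p \<bullet> x) *\<^sub>R p)" for x
  \<comment> \<open>The inverse of the projection: the hemisphere is the graph, in the direction
    \<open>p\<close>, of \<open>sqrt (1 - y \<bullet> y)\<close> over the unit ball.\<close>
  define \<sigma> where "\<sigma> y = L y + sqrt (1 - y \<bullet> y) *\<^sub>R p" for y
  have \<pi>\<sigma>: "\<pi> (\<sigma> y) = y" for y
    by (simp add: \<pi>_def \<sigma>_def inner_add_right pL pp LG(7))
  have proj: "x - (p \<bullet> x) *\<^sub>R p \<in> T" for x
    by (simp add: T_def inner_diff_right pp)
  have yy: "y \<bullet> y < 1 \<longleftrightarrow> y \<in> ball 0 1" for y :: 'f
    by (simp add: power2_norm_eq_inner[symmetric] power_less_one_iff abs_square_less_1)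
  have \<pi>norm: "\<pi> x \<bullet> \<pi> x = 1 - (p \<bullet> x)\<^sup>2" if "x \<in> D" for x
  proof -
    have "\<pi> x \<bullet> \<pi> x = (norm (x - (p \<bullet> x) *\<^sub>R p))\<^sup>2"
      using LG(6)[OF proj] by (simp add: \<pi>_def power2_norm_eq_inner[symmetric])
    also have "\<dots> = x \<bullet> x - (p \<bullet> x)\<^sup>2"
      unfolding power2_norm_eq_inner
      by (simp add: inner_diff_left inner_diff_right pp inner_commute power2_eq_square)
    also have "x \<bullet> x = 1" using that by (simp add: D_def dot_square_norm)
    finally show ?thesis .
  qed
  have \<sigma>\<pi>: "\<sigma> (\<pi> x) = x" if "x \<in> D" for x
  proof -
    have "sqrt (1 - \<pi> x \<bullet> \<pi> x) = p \<bullet> x" using that by (simp add: \<pi>norm D_def)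
    then show ?thesis by (simp add: \<sigma>_def) (simp add: \<pi>_def LG(8)[OF proj])
  qed
  have \<pi>ball: "\<pi> x \<in> ball 0 1" if "x \<in> D" for x
    unfolding yy[symmetric] \<pi>norm[OF that] using that by (simp add: D_def)
  have \<sigma>D: "\<sigma> y \<in> D" if "y \<in> ball 0 1" for y
  proof -
    have 1: "y \<bullet> y < 1" using that yy by blast
    have "\<sigma> y \<bullet> \<sigma> y = L y \<bullet> L y + (1 - y \<bullet> y)"
      using 1 pL[of y] by (simp add: \<sigma>_def inner_add_left inner_add_right pp inner_commute[of "L y" p])
    also have "L y \<bullet> L y = y \<bullet> y" using LG(5)[of y] by (simp add: norm_eq_sqrt_inner)
    finally have "norm (\<sigma> y) = 1" by (simp add: norm_eq_sqrt_inner)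
    moreover have "p \<bullet> \<sigma> y > 0" using 1 by (simp add: \<sigma>_def inner_add_right pL pp)
    ultimately show ?thesis by (simp add: D_def)
  qed
  have c\<pi>: "continuous_on S \<pi>" for S
    unfolding \<pi>_def by (intro bounded_linear.continuous_on[OF bG] continuous_intros)
  have s\<sigma>: "Ck_on k (ball 0 1) \<sigma>" for k
  proof -
    have "Ck_on k (ball (0::'f) 1) (\<lambda>y. sqrt (1 - y \<bullet> y))"
      by (rule Ck_on_compose[OF open_ball _ _ Ck_on_sqrt_real])
        (auto intro!: Ck_on_diff Ck_on_inner simp: yy simp del: mem_ball)
    then show ?thesis
      unfolding \<sigma>_def
      by (intro Ck_on_add Ck_on_scaleR open_ball Ck_on_const Ck_on_bounded_linear[OF bL] Ck_on_linear_id)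
  qed
  define d where "d = (D, \<pi>)"
  have im: "chart_image d = ball 0 1"
    unfolding chart_image_def d_def fst_conv snd_conv
  proof (rule equalityI; rule subsetI)
    show "y \<in> \<pi> ` D" if "y \<in> ball 0 1" for y
      by (rule rev_image_eqI[OF \<sigma>D[OF that]]) (simp add: \<pi>\<sigma>)
    show "y \<in> ball 0 1" if "y \<in> \<pi> ` D" for y
      using that by (rule imageE) (simp only: \<pi>ball)
  qed
  have inj: "inj_on \<pi> D" by (rule inj_on_inverseI[of _ \<sigma>]) (rule \<sigma>\<pi>)
  have inv: "chart_inv d y = \<sigma> y" if "y \<in> ball 0 1" for y
    unfolding chart_inv_def d_def fst_conv snd_conv
    by (rule inv_into_f_eq[OF inj \<sigma>D[OF that] \<pi>\<sigma>])
  have chart: "chart_of (top_of_set (sphere 0 1)) d"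
    unfolding chart_of_def im
  proof (intro conjI)
    have "open {x. p \<bullet> x > 0}" by (rule open_halfspace_gt)
    then show "openin (top_of_set (sphere 0 1)) (fst d)" by (auto simp: d_def D_def)
    have top: "subtopology (top_of_set (sphere 0 1)) (fst d) = top_of_set D"
      by (simp add: d_def D_def subtopology_subtopology inf.absorb_iff2[symmetric] Int_absorb1)
    have "homeomorphic_maps (top_of_set D) (top_of_set (ball 0 1)) \<pi> \<sigma>"
      unfolding homeomorphic_maps_def
      using \<pi>ball \<sigma>D \<pi>\<sigma> \<sigma>\<pi> c\<pi> Ck_on_imp_continuous_on[OF s\<sigma>] by (auto simp del: mem_ball)
    then show "homeomorphic_map (subtopology (top_of_set (sphere 0 1)) (fst d)) (top_of_set (ball 0 1)) (snd d)"
      unfolding top by (auto simp: d_def homeomorphic_map_maps)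
  qed simp
  have smooth: "smooth_on (chart_image d) (chart_inv d)"
    unfolding smooth_on_def im by (simp only: Ck_on_cong[OF open_ball inv] s\<sigma> simp_thms)
  \<comment> \<open>Differentiating \<open>\<pi> (\<sigma> y) = y\<close>, with \<open>\<pi>\<close>
    linear, gives a left inverse of the differential of \<open>\<sigma>\<close>.\<close>
  have "inj (frechet_derivative (chart_inv d) (at y))" if y: "y \<in> ball 0 1" for y
  proof -
    have "\<sigma> differentiable (at y)" by (rule Ck_on_differentiable[OF s\<sigma> y])
    from pd_has_derivative[OF this]
    have 1: "((\<lambda>z. \<pi> (\<sigma> z)) has_derivative (\<lambda>v. \<pi> (pd v \<sigma> y))) (at y)"
      unfolding \<pi>_def by (auto intro!: bounded_linear.has_derivative[OF bG] derivative_eq_intros)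
    have 2: "((\<lambda>z. \<pi> (\<sigma> z)) has_derivative (\<lambda>v. v)) (at y)"
      unfolding \<pi>\<sigma> by (rule has_derivative_ident)
    have "\<pi> (pd v \<sigma> y) = v" for v using fun_cong[OF has_derivative_unique[OF 1 2], of v] .
    moreover have "frechet_derivative (chart_inv d) (at y) v = pd v \<sigma> y" for v
      unfolding pd_def[symmetric] by (rule pd_cong_open[OF open_ball y inv])
    ultimately show ?thesis by (metis injI)
  qed
  then have "d \<in> atlas (unit_sphere :: ('b, 'f) riemannian)"
    using chart smooth by (simp add: unit_sphere_def im)
  moreover have "p \<in> fst d" using p pp by (simp add: d_def D_def)
  ultimately show ?thesis by blast
qed

section \<open>Charts as local homeomorphisms\<close>

lemma chart_inv_left:
  assumes "chart_of X c" "q \<in> fst c"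
  shows "chart_inv c (snd c q) = q"
  using assms homeomorphic_imp_injective_map[of "subtopology X (fst c)" _ "snd c"] openin_subset[of X "fst c"]
  unfolding chart_of_def chart_inv_def by (auto simp: Int_absorb1 intro: inv_into_f_f)

lemma chart_inj: "chart_of X c \<Longrightarrow> inj_on (snd c) (fst c)"
  by (rule inj_on_inverseI[of _ "chart_inv c"]) (rule chart_inv_left)

lemma chart_open_image:
  assumes c: "chart_of X c" and D: "openin X D" "D \<subseteq> fst c"
  shows "open (snd c ` D)"
proof -
  have "openin (subtopology X (fst c)) D"
    using c D by (simp add: chart_of_def openin_open_subtopology)
  then have "openin (top_of_set (chart_image c)) (snd c ` D)"
    using c homeomorphic_imp_open_map unfolding chart_of_def open_map_def by blast
  then show ?thesis using c by (simp add: chart_of_def openin_open_eq)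
qed

lemma chart_open_preimage:
  assumes c: "chart_of X c" and B: "open B"
  shows "openin X {q \<in> fst c. snd c q \<in> B}"
proof -
  have "continuous_map (subtopology X (fst c)) (top_of_set (chart_image c)) (snd c)"
    using c homeomorphic_imp_continuous_map by (auto simp: chart_of_def)
  then have "continuous_map (subtopology X (fst c)) euclidean (snd c)"
    by (simp add: continuous_map_in_subtopology)
  then have "openin (subtopology X (fst c)) {q \<in> topspace (subtopology X (fst c)). snd c q \<in> B}"
    using B by (intro openin_continuous_map_preimage) auto
  moreover have "{q \<in> topspace (subtopology X (fst c)). snd c q \<in> B} = {q \<in> fst c. snd c q \<in> B}"
    using c openin_subset[of X "fst c"] by (auto simp: chart_of_def)
  ultimately show ?thesis using c by (simp add: chart_of_def openin_open_subtopology)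
qed

section \<open>Propagation of the agreement over the connected manifold\<close>

theorem theorem1p4:
  fixes M :: "('a, 'e::euclidean_space) riemannian"
    and S :: "('b::euclidean_space, 'f::euclidean_space) riemannian"
    and \<phi>\<^sub>1 \<phi>\<^sub>2 :: "'a \<Rightarrow> 'b"
    and n :: nat
    and W :: "'a set"
  assumes "riemannian_manifold M" and "connected_space (mtop M)"
    and "DIM('f) = n" and "DIM('b) = n + 1" and "S = unit_sphere"
    and "biharmonic M S \<phi>\<^sub>1" and "biharmonic M S \<phi>\<^sub>2"
    and "openin (mtop M) W" and "W \<noteq> {}"
    and "\<forall>p\<in>W. \<phi>\<^sub>1 p = \<phi>\<^sub>2 p"
  shows "\<forall>p\<in>topspace (mtop M). \<phi>\<^sub>1 p = \<phi>\<^sub>2 p"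
proof -
  have S: "S = unit_sphere" by fact
  have charts: "chart_of (mtop M) c" if "c \<in> atlas M" for c
    using assms(1) that by (auto simp: riemannian_manifold_def smooth_atlas_def)
  have top: "(\<Union>c\<in>atlas M. fst c) = topspace (mtop M)"
    using assms(1) by (simp add: riemannian_manifold_def smooth_atlas_def)
  have metric: "local_metric (chart_image c) (metric M c)" if c: "c \<in> atlas M" for c
  proof (rule local_metric.intro)
    show "open (chart_image c)" using charts[OF c] by (simp add: chart_of_def)
    show "Ck_on k (chart_image c) (\<lambda>y. metric M c y v w)" for k v w
      using assms(1) c by (auto simp: riemannian_manifold_def smooth_on_def)
    show "inner_form (metric M c y)" if "y \<in> chart_image c" for y
      using assms(1) c that by (intro bilinear_imp_inner_form) (auto simp: riemannian_manifold_def)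
  qed
  have mtopS: "mtop S = top_of_set (sphere 0 1)" by (simp add: S unit_sphere_def)
  have chartS: "chart_of (mtop S) d" if "d \<in> atlas S" for d
    using that unfolding mtopS by (simp add: S unit_sphere_def)
  have cont: "continuous_map (mtop M) (mtop S) \<phi>\<^sub>1" "continuous_map (mtop M) (mtop S) \<phi>\<^sub>2"
    using assms(6,7) by (auto simp: biharmonic_def smooth_map_def)
  \<comment> \<open>The interior of the coincidence set. It is open by construction, so only its
    closedness needs the differential equation.\<close>
  define A where "A = \<Union>{U. openin (mtop M) U \<and> (\<forall>q\<in>U. \<phi>\<^sub>1 q = \<phi>\<^sub>2 q)}"
  have A_open: "openin (mtop M) A" unfolding A_def by (rule openin_Union) auto
  have A_eq: "\<phi>\<^sub>1 q = \<phi>\<^sub>2 q" if "q \<in> A" for q using that by (auto simp: A_def)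
  have A_sub: "A \<subseteq> topspace (mtop M)" by (rule openin_subset[OF A_open])
  have "W \<subseteq> A" unfolding A_def using assms(8,10) by blast
  then have A_ne: "A \<noteq> {}" using assms(9) by blast
  have "mtop M closure_of A \<subseteq> A"
  proof
    fix p assume p: "p \<in> mtop M closure_of A"
    then have ptop: "p \<in> topspace (mtop M)" by (simp add: in_closure_of)
    \<comment> \<open>By continuity the maps agree at the limit point \<open>p\<close>, so one chart
      of the sphere around the common value serves both.\<close>
    have "closedin (mtop M) {x \<in> topspace (mtop M). \<phi>\<^sub>1 x = \<phi>\<^sub>2 x}"
      by (rule closedin_continuous_maps_eq[OF _ cont]) (simp add: mtopS Hausdorff_space_subtopology)
    then have p_eq: "\<phi>\<^sub>1 p = \<phi>\<^sub>2 p"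
      using closure_of_minimal[of A "{x \<in> topspace (mtop M). \<phi>\<^sub>1 x = \<phi>\<^sub>2 x}" "mtop M"] A_eq A_sub p by blast
    have "\<phi>\<^sub>1 p \<in> topspace (mtop S)" using cont(1) ptop by (auto simp: continuous_map_def)
    then have "norm (\<phi>\<^sub>1 p) = 1" by (simp add: mtopS)
    then obtain d where d: "d \<in> atlas S" "\<phi>\<^sub>1 p \<in> fst d"
      using unit_sphere_chart_exists[where 'f='f, of "\<phi>\<^sub>1 p"] assms(3,4) unfolding S by auto
    obtain c where c: "c \<in> atlas M" "p \<in> fst c" using top ptop by blast
    note chc = charts[OF c(1)] and chd = chartS[OF d(1)]
    \<comment> \<open>Where both maps land in the domain of the chart \<open>d\<close>, so that
      their coordinate representations can be compared.\<close>
    define D where "D = fst c \<inter> {q \<in> topspace (mtop M). \<phi>\<^sub>1 q \<in> fst d} \<inter> {q \<in> topspace (mtop M). \<phi>\<^sub>2 q \<in> fst d}"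
    have D_open: "openin (mtop M) D"
      unfolding D_def using chc chd cont by (intro openin_Int openin_continuous_map_preimage) (auto simp: chart_of_def)
    have pD: "p \<in> D" using c d p_eq ptop by (simp add: D_def)
    have Dc: "D \<subseteq> fst c" by (auto simp: D_def)
    define U where "U = snd c ` D"
    have U_open: "open U" unfolding U_def by (rule chart_open_image[OF chc D_open Dc])
    have UD: "q \<in> D" if "q \<in> fst c" "snd c q \<in> U" for q
      using that chart_inj[OF chc] Dc by (auto simp: U_def dest: inj_onD)
    have map: "chart_map (chart_image c) (metric M c) (chart_image d) (metric S d) U (local_rep c d \<phi>) \<and>
       (\<forall>y\<in>U. bitension (metric M c) (metric S d) (local_rep c d \<phi>) y = 0) \<and>
       (\<forall>q\<in>D. local_rep c d \<phi> (snd c q) = snd d (\<phi> q))"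
      if bh: "biharmonic M S \<phi>" and \<phi>D: "\<And>q. q \<in> D \<Longrightarrow> \<phi> q \<in> fst d" for \<phi>
    proof (intro conjI ballI)
      show rep: "local_rep c d \<phi> (snd c q) = snd d (\<phi> q)" if "q \<in> D" for q
        using chart_inv_left[OF chc] that Dc by (auto simp: local_rep_def)
      have sub: "U \<subseteq> snd c ` (fst c \<inter> \<phi> -` fst d)" unfolding U_def using Dc \<phi>D by auto
      show "chart_map (chart_image c) (metric M c) (chart_image d) (metric S d) U (local_rep c d \<phi>)"
      proof (intro chart_map.intro chart_map_axioms.intro metric[OF c(1)] U_open)
        show "local_metric (chart_image d) (metric S d)"
          using unit_sphere_metric d(1) unfolding S .
        show "U \<subseteq> chart_image c" unfolding U_def chart_image_def using Dc by blast
        show "Ck_on k U (local_rep c d \<phi>)" for k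
          by (rule Ck_on_subset[OF _ sub])
            (use bh c(1) d(1) in \<open>simp add: biharmonic_def smooth_map_def smooth_on_def\<close>)
        show "local_rep c d \<phi> y \<in> chart_image d" if "y \<in> U" for y
          using that rep \<phi>D by (auto simp: U_def chart_image_def)
      qed
      show "bitension (metric M c) (metric S d) (local_rep c d \<phi>) y = 0" if "y \<in> U" for y
        using that bh c(1) d(1) Dc \<phi>D unfolding U_def biharmonic_def by blast
    qed
    define F1 where "F1 = local_rep c d \<phi>\<^sub>1"
    define F2 where "F2 = local_rep c d \<phi>\<^sub>2"
    have F1: "chart_map (chart_image c) (metric M c) (chart_image d) (metric S d) U F1"
       "\<And>y. y \<in> U \<Longrightarrow> bitension (metric M c) (metric S d) F1 y = 0" "\<And>q. q \<in> D \<Longrightarrow> F1 (snd c q) = snd d (\<phi>\<^sub>1 q)"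
      using map[OF assms(6)] by (auto simp: F1_def D_def)
    have F2: "chart_map (chart_image c) (metric M c) (chart_image d) (metric S d) U F2"
       "\<And>y. y \<in> U \<Longrightarrow> bitension (metric M c) (metric S d) F2 y = 0" "\<And>q. q \<in> D \<Longrightarrow> F2 (snd c q) = snd d (\<phi>\<^sub>2 q)"
      using map[OF assms(7)] by (auto simp: F2_def D_def)
    define y0 where "y0 = snd c p"
    define z0 where "z0 = snd d (\<phi>\<^sub>1 p)"
    have z0: "F1 y0 = z0" "F2 y0 = z0" using F1(3)[OF pD] F2(3)[OF pD] p_eq by (simp_all add: y0_def z0_def)
    have "z0 \<in> chart_image d" using d(2) by (simp add: z0_def chart_image_def)
    moreover have "open (chart_image d)" using chd by (simp add: chart_of_def)
    ultimately obtain \<epsilon> where \<epsilon>: "\<epsilon> > 0" "cball z0 \<epsilon> \<subseteq> chart_image d" using open_contains_cball by blast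
    have "continuous_on U F1" "continuous_on U F2"
      using Ck_on_imp_continuous_on[OF chart_map.F[OF F1(1)]] Ck_on_imp_continuous_on[OF chart_map.F[OF F2(1)]] by blast+
    then have "open ((U \<inter> F1 -` ball z0 \<epsilon>) \<inter> (U \<inter> F2 -` ball z0 \<epsilon>))"
      using U_open by (intro open_Int continuous_open_preimage) auto
    moreover have "y0 \<in> (U \<inter> F1 -` ball z0 \<epsilon>) \<inter> (U \<inter> F2 -` ball z0 \<epsilon>)"
      using pD z0 \<epsilon> by (auto simp: U_def y0_def)
    ultimately obtain \<rho> where \<rho>: "\<rho> > 0" "cball y0 \<rho> \<subseteq> (U \<inter> F1 -` ball z0 \<epsilon>) \<inter> (U \<inter> F2 -` ball z0 \<epsilon>)"
      using open_contains_cball by blast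
    \<comment> \<open>Half the radius: a ball of radius \<open>\<delta>\<close> centred within
      \<open>\<delta>\<close> of \<open>y0\<close> stays in the good ball of radius
      \<open>\<rho>\<close> and still contains \<open>y0\<close>.\<close>
    define \<delta> where "\<delta> = \<rho> / 2"
    have \<delta>: "\<delta> > 0" using \<rho> by (simp add: \<delta>_def)
    have sub: "cball x \<delta> \<subseteq> cball y0 \<rho>" if "x \<in> ball y0 \<delta>" for x
    proof
      fix z assume "z \<in> cball x \<delta>"
      then have "dist y0 z \<le> \<delta> + \<delta>" using dist_triangle[of y0 z x] that by simp
      then show "z \<in> cball y0 \<rho>" by (simp add: \<delta>_def)
    qed
    have near: "openin (mtop M) {q \<in> fst c. snd c q \<in> ball y0 \<delta>}" by (rule chart_open_preimage[OF chc open_ball])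
    have p_near: "p \<in> {q \<in> fst c. snd c q \<in> ball y0 \<delta>}" using c \<delta> by (simp add: y0_def)
    \<comment> \<open>Being a limit point, \<open>p\<close> has a point \<open>q\<close> of
      \<open>A\<close> in this coordinate ball; \<open>q\<close>, not \<open>p\<close>, becomes the
      centre of the local result.\<close>
    have "\<forall>T. p \<in> T \<and> openin (mtop M) T \<longrightarrow> (\<exists>y. y \<in> A \<and> y \<in> T)"
      using p unfolding in_closure_of by (rule conjunct2)
    from this[rule_format, OF conjI[OF p_near near]]
    obtain q where q: "q \<in> A" "q \<in> fst c" "snd c q \<in> ball y0 \<delta>" by auto
    define x0 where "x0 = snd c q"
    have x0: "x0 \<in> ball y0 \<delta>" using q by (simp add: x0_def)
    have Ksub: "cball x0 \<delta> \<subseteq> (U \<inter> F1 -` ball z0 \<epsilon>) \<inter> (U \<inter> F2 -` ball z0 \<epsilon>)"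
      using sub[OF x0] \<rho>(2) by blast
    have "x0 \<in> U" using Ksub \<delta> by auto
    then have qD: "q \<in> D" using UD q(2) by (simp add: x0_def)
    have o: "open (snd c ` (A \<inter> D))"
      using A_open D_open Dc by (intro chart_open_image[OF chc]) auto
    have x0_in: "x0 \<in> snd c ` (A \<inter> D)" unfolding x0_def using q(1) qD by blast
    obtain r where r: "r > 0" "ball x0 r \<subseteq> snd c ` (A \<inter> D)"
      by (rule openE[OF o x0_in], rule that)
    \<comment> \<open>The minimum with \<open>\<delta>\<close> keeps the ball of known agreement
      inside the ball on which agreement is to be shown.\<close>
    have eq0: "F1 y = F2 y" if "y \<in> ball x0 (min r \<delta>)" for y
    proof -
      have "y \<in> snd c ` (A \<inter> D)" using that r by auto
      then show ?thesis using F1(3) F2(3) A_eq by auto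
    qed
    have eq1: "F1 y = F2 y" if "y \<in> ball x0 \<delta>" for y
    proof (rule bitension_unique_continuation[where r="min r \<delta>",
          OF F1(1) F2(1) F1(2) F2(2) _ compact_cball convex_cball \<epsilon>(2) _ _ _ _ eq0 that])
      show "cball x0 \<delta> \<subseteq> U" using Ksub by blast
      show "F1 y \<in> cball z0 \<epsilon>" "F2 y \<in> cball z0 \<epsilon>" if "y \<in> cball x0 \<delta>" for y
        using Ksub that by (auto dest!: subsetD)
    qed (use r \<delta> in auto)
    define N where "N = {q \<in> fst c. snd c q \<in> ball x0 \<delta>}"
    have "openin (mtop M) N" unfolding N_def by (rule chart_open_preimage[OF chc open_ball])
    moreover have "\<phi>\<^sub>1 q' = \<phi>\<^sub>2 q'" if q': "q' \<in> N" for q'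
    proof -
      have "snd c q' \<in> U" using q' Ksub ball_subset_cball by (auto simp: N_def)
      then have q'D: "q' \<in> D" using UD q' by (simp add: N_def)
      have "snd d (\<phi>\<^sub>1 q') = snd d (\<phi>\<^sub>2 q')"
        using eq1[of "snd c q'"] q' F1(3)[OF q'D] F2(3)[OF q'D] by (simp add: N_def)
      then show ?thesis
        \<comment> \<open>Agreement of coordinates gives agreement of points, as both values lie in
          the domain of the injective chart \<open>d\<close>.\<close>
        using inj_onD[OF chart_inj[OF chd]] q'D by (auto simp: D_def)
    qed
    moreover have "p \<in> N" using x0 c by (simp add: N_def y0_def dist_commute)
    ultimately show "p \<in> A" unfolding A_def by blast
  qed
  then have "closedin (mtop M) A" using A_sub closure_of_subset_eq by blast
  then have "A = topspace (mtop M)"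
    using assms(2) A_open A_ne unfolding connected_space_clopen_in by blast
  then show ?thesis using A_eq by blast
qed

end
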